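(* Let $\omega_c$ be a mesh cell subdivided into $N_k=\frac{(k+1)(k+2)}{2}$ subcells $S_1^c,\dots,S_{N_k}^c$, such that the projection matrix $P_c$ is invertible and the interior subgrid graph is connected. Then the discontinuous Galerkin scheme on $\omega_c$, $$\int_{\omega_c}\frac{\partial u_h^c}{\partial t}\,\psi\,\mathrm{d}V=\int_{\omega_c}\boldsymbol{F}(u_h^c)\cdot\nabla_x\psi\,\mathrm{d}V-\int_{\partial\omega_c}\psi\,\mathcal{F}_n\,\mathrm{d}S,\qquad\forall\,\psi\in\mathbb{P}^k(\omega_c),$$ can be recast as (i.e. is equivalent to) the $N_k$ subcell finite-volume-like schemes $$\frac{\mathrm{d}\overline{u}_m^c}{\mathrm{d}t}=-\frac{1}{|S_m^c|}\sum_{S_p^v\in\mathcal{V}_m^c}\varepsilon_{mp}^c\,\widehat{F_{mp}},\qquad m=1,\dots,N_k,$$ where the finite volume fluxes $\widehat{F_{mp}}$ (the reconstructed fluxes) are defined as follows. If $S_p^v\subset\omega_c$, then $\widehat{F_{mp}}$ is the component attached to the interior face $f_{mp}^c$ of the vector $$\widehat{F_c}=F_c-A_c^{\mathrm t}\,\mathcal{L}_c^{-1}\,G_c .$$ Otherwise, when $f_{mp}^c\subset\partial\omega_c$, the reconstructed flux coincides with the DG numerical flux, i.e. $\varepsilon_{mp}^c\,\widehat{F_{mp}}=\int_{f_{mp}^c}\mathcal{F}_n\,\mathrm{d}S$.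
   Context: **Continuous problem and DG scheme.** Consider the scalar conservation law $\partial_t u+\nabla_x\cdot\boldsymbol{F}(u)=0$ on $\omega\subset\mathbb{R}^2$ with flux function $\boldsymbol{F}:\mathbb{R}\to\mathbb{R}^2$. The domain is partitioned into non-overlapping polygonal cells $\{\omega_c\}_c$. Let $k\ge0$, let $\mathbb{P}^k(\omega_c)$ be the space of polynomials in two variables of total degree at most $k$ on $\omega_c$, of dimension $N_k=\frac{(k+1)(k+2)}{2}$, and let $\{\sigma_m^c\}_{m=1}^{N_k}$ be a basis of it. The numerical solution on $\omega_c$ is $u_h^c(\boldsymbol{x},t)=\sum_{m=1}^{N_k}u_m^c(t)\,\sigma_m^c(\boldsymbol{x})$. On $\partial\omega_c$ a numerical flux $\mathcal{F}_n=\mathcal{F}(u^-,u^+,\boldsymbol{n})$ is given, where $u^-$ and $u^+$ are the traces of the numerical solution from inside $\omega_c$ and from the neighbouring cell, and $\boldsymbol{n}$ is the unit outward normal to $\omega_c$. **Subdivision.** The cell $\omega_c$ is partitioned into $N_k$ non-overlapping subcells $S_m^c$ of positive area $|S_m^c|$, and $\overline{u}_m^c=\frac{1}{|S_m^c|}\int_{S_m^c}u_h^c\,\mathrm{d}V$ are the submean values. The projection matrix is $(P_c)_{mp}=\frac{1}{|S_m^c|}\int_{S_m^c}\sigma_p^c\,\mathrm{d}V$. The subdivision is called admissible if $P_c$ is invertible. **Faces, signs, adjacency matrix.** $\mathcal{V}_m^c$ is the set of face-neighbouring subcells $S_p^v$ of $S_m^c$, either inside $\omega_c$ ($v=c$)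 or in a neighbouring cell $\omega_v$ ($v\neq c$). $f_{mp}^c$ is the face between $S_m^c$ and $S_p^v$, and the faces $f_{mp}^c$ cover $\partial S_m^c$. Each face interior to $\omega_c$ is given a fixed, arbitrary orientation. Set $\varepsilon_{mp}^c=1$ if $f_{mp}^c$ is direct (seen from $S_m^c$) or if $f_{mp}^c\subset\partial\omega_c$, and $\varepsilon_{mp}^c=-1$ if $f_{mp}^c$ is indirect. For two neighbouring subcells of $\omega_c$, $\varepsilon_{pm}^c=-\varepsilon_{mp}^c$. Let $N_f^c$ be the number of subcell faces inside $\omega_c$ (not contained in $\partial\omega_c$). The adjacency matrix $A_c\in\mathbb{R}^{N_k\times N_f^c}$ has one row per subcell of $\omega_c$ and one column per interior face: in the column of the face $f_{mp}^c$ the entry in row $m$ is $\varepsilon_{mp}^c$, the entry in row $p$ is $\varepsilon_{pm}^c=-\varepsilon_{mp}^c$, and all others are $0$. The interior subgrid graph has the subcells of $\omega_c$ as vertices and the interior faces as edges. It is connected. **Inverse graph Laplacian.** $L_c=A_cA_c^{\mathrm t}$ has kernel $\mathrm{span}\{\boldsymbol{1}\}$ with $\boldsymbol{1}=(1,\dots,1)^{\mathrm t}\in\mathbb{R}^{N_k}$. $\mathcal{L}_c^{-1}$ denotes the inverse of $L_c$ on the orthogonal of its kernel. For any $\lambda\neq0$ it is given by $\mathcal{L}_c^{-1}=(L_c+\lambda\Pi)^{-1}-\frac1\lambda\Pi$, with $\Pi=\frac{1}{N_k}\boldsymbol{1}\boldsymbol{1}^{\mathrm t}$. **Interior flux.**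 $\boldsymbol{F}_h^c$ is the $L^2(\omega_c)$ projection of $\boldsymbol{F}(u_h^c)$ onto $(\mathbb{P}^{k+1}(\omega_c))^2$. The vector $F_c\in\mathbb{R}^{N_f^c}$ has as component attached to the interior face $f_{mp}^c$ the number $F_{mp}=F_{pm}$ defined by $\int_{f_{mp}^c}\boldsymbol{F}_h^c\cdot\boldsymbol{n}\,\mathrm{d}S=\varepsilon_{mp}^c\,F_{mp}$, where $\boldsymbol{n}$ is the unit normal outward to $S_m^c$. **Boundary correction.** The sub-resolution basis functions $\phi_m\in\mathbb{P}^k(\omega_c)$, $m=1,\dots,N_k$, are defined by $\int_{\omega_c}\phi_m\psi\,\mathrm{d}V=\int_{S_m^c}\psi\,\mathrm{d}V$ for all $\psi\in\mathbb{P}^k(\omega_c)$. On $\partial\omega_c$ define $\widetilde{\phi_m}=\phi_m$ on $\partial\omega_c\setminus\partial S_m^c$ and $\widetilde{\phi_m}=\phi_m-1$ on $\partial\omega_c\cap\partial S_m^c$. The vector $G_c\in\mathbb{R}^{N_k}$ is $$(G_c)_m=\int_{\partial\omega_c}\widetilde{\phi_m}\left(\boldsymbol{F}_h^c\cdot\boldsymbol{n}-\mathcal{F}_n\right)\mathrm{d}S .$$ *)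

theory Defs
  imports "HOL-Analysis.Analysis" "Jordan_Normal_Form.Matrix"
begin

type_synonym point = "real \<times> real"

subsection \<open>Polygonal regions, integration over their boundaries\<close>

text \<open>A compact region whose boundary is a finite union of segments. Regular closedness rules out
  slits and isolated points; neither convexity nor simple connectedness is required.\<close>

definition polygonal :: "point set \<Rightarrow> bool" where
  "polygonal S \<longleftrightarrow> compact S \<and> S = closure (interior S) \<and>
     (\<exists>A. finite A \<and> frontier S \<subseteq> (\<Union>(a, b)\<in>A. closed_segment a b))"

text \<open>The normal is characterised by \<open>S\<close> being locally a half-plane; this determines it at all but
  finitely many boundary points of a polygonal region. Its value at the vertices is irrelevant.\<close>

definition outward_normal :: "point set \<Rightarrow> point \<Rightarrow> point" where
  "outward_normal S x = (THE n. norm n = 1 \<and>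
     (\<exists>r>0. S \<inter> ball x r = {y \<in> ball x r. inner (y - x) n \<le> 0}))"

text \<open>One-dimensional Lebesgue measure on a line of the plane; it does not depend on the chosen
  unit-speed parametrisation.\<close>

definition line_measure :: "point set \<Rightarrow> point measure" where
  "line_measure L = (let (a, u) = (SOME (a, u). norm u = 1 \<and> L = range (\<lambda>s. a + s *\<^sub>R u))
     in distr lborel borel (\<lambda>s. a + s *\<^sub>R u))"

definition lines_of :: "point set \<Rightarrow> point set set" where
  "lines_of E = {L. affine L \<and> aff_dim L = 1 \<and> infinite (E \<inter> L)}"

text \<open>Integration with respect to arc length over a set \<open>E\<close> consisting of finitely many segments
  and points. For such \<open>E\<close> only finitely many lines meet \<open>E\<close> in infinitely many points, and two
  of them share at most one point, so the sum below is the arc-length integral.\<close>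

definition bd_integral :: "point set \<Rightarrow> (point \<Rightarrow> real) \<Rightarrow> real" where
  "bd_integral E g = (\<Sum>L\<in>lines_of E. LINT x:E|line_measure L. g x)"

definition bd_integrable :: "point set \<Rightarrow> (point \<Rightarrow> real) \<Rightarrow> bool" where
  "bd_integrable E g \<longleftrightarrow> (\<forall>L\<in>lines_of E. set_integrable (line_measure L) E g)"

subsection \<open>Polynomials in two variables and the $L^2$ projection\<close>

definition Pk :: "nat \<Rightarrow> (point \<Rightarrow> real) set" where
  "Pk k = {f. \<exists>a. \<forall>x y. f (x, y) = (\<Sum>i\<le>k. \<Sum>j\<le>k - i. a i j * x ^ i * y ^ j)}"

definition dim_Pk :: "nat \<Rightarrow> nat" where
  "dim_Pk k = (k + 1) * (k + 2) div 2"

definition is_basis_Pk :: "nat \<Rightarrow> (nat \<Rightarrow> point \<Rightarrow> real) \<Rightarrow> bool" where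
  "is_basis_Pk k \<sigma> \<longleftrightarrow> (\<forall>m<dim_Pk k. \<sigma> m \<in> Pk k) \<and>
     (\<forall>f\<in>Pk k. \<exists>!a. a \<in> {..<dim_Pk k} \<rightarrow>\<^sub>E UNIV \<and> (\<forall>x. f x = (\<Sum>m<dim_Pk k. a m * \<sigma> m x)))"

definition grad :: "(point \<Rightarrow> real) \<Rightarrow> point \<Rightarrow> point" where
  "grad f x = (deriv (\<lambda>s. f (s, snd x)) (fst x), deriv (\<lambda>s. f (fst x, s)) (snd x))"

definition Pk_vec :: "nat \<Rightarrow> (point \<Rightarrow> point) set" where
  "Pk_vec k = {q. (\<lambda>x. fst (q x)) \<in> Pk k \<and> (\<lambda>x. snd (q x)) \<in> Pk k}"

definition square_integrable_on :: "point set \<Rightarrow> (point \<Rightarrow> point) \<Rightarrow> bool" where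
  "square_integrable_on D f \<longleftrightarrow>
     set_borel_measurable lborel D f \<and> set_integrable lborel D (\<lambda>x. (norm (f x))\<^sup>2)"

definition L2_proj :: "nat \<Rightarrow> point set \<Rightarrow> (point \<Rightarrow> point) \<Rightarrow> point \<Rightarrow> point" where
  "L2_proj k D f = (THE q. q \<in> Pk_vec k \<and>
     (\<forall>r\<in>Pk_vec k. (LINT x:D|lborel. inner (f x - q x) (r x)) = 0))"

subsection \<open>Meshes and subdivisions\<close>

text \<open>The subcells of a cell are indexed by \<open>0, \<dots>, dim_Pk (deg M) - 1\<close>. The orientation of the
  interior faces is recorded by \<open>direct M c m p\<close>: the face between the subcells \<open>m\<close> and \<open>p\<close> of
  \<open>c\<close> is direct seen from \<open>m\<close>.\<close>

record 'c mesh =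
  deg :: nat
  cells :: "'c set"
  cell :: "'c \<Rightarrow> point set"
  subcell :: "'c \<Rightarrow> nat \<Rightarrow> point set"
  direct :: "'c \<Rightarrow> nat \<Rightarrow> nat \<Rightarrow> bool"

abbreviation N_sub :: "'c mesh \<Rightarrow> nat" where
  "N_sub M \<equiv> dim_Pk (deg M)"

definition face :: "'c mesh \<Rightarrow> 'c \<Rightarrow> nat \<Rightarrow> 'c \<Rightarrow> nat \<Rightarrow> point set" where
  "face M c m v p = subcell M c m \<inter> subcell M v p"

text \<open>Face neighbours share a part of their boundary of positive length, not just vertices.\<close>

definition nbrs :: "'c mesh \<Rightarrow> 'c \<Rightarrow> nat \<Rightarrow> ('c \<times> nat) set" where
  "nbrs M c m = {(v, p). v \<in> cells M \<and> p < N_sub M \<and> (v, p) \<noteq> (c, m) \<and>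
     bd_integral (face M c m v p) (\<lambda>_. 1) > 0}"

definition valid_mesh :: "'c mesh \<Rightarrow> bool" where
  "valid_mesh M \<longleftrightarrow> finite (cells M) \<and>
     (\<forall>c\<in>cells M. polygonal (cell M c)) \<and>
     (\<forall>c\<in>cells M. \<forall>v\<in>cells M. c \<noteq> v \<longrightarrow> interior (cell M c) \<inter> interior (cell M v) = {}) \<and>
     (\<forall>c\<in>cells M.
        cell M c = (\<Union>m<N_sub M. subcell M c m) \<and>
        (\<forall>m<N_sub M. polygonal (subcell M c m) \<and> measure lborel (subcell M c m) > 0) \<and>
        (\<forall>m<N_sub M. \<forall>p<N_sub M. m \<noteq> p \<longrightarrow>
           interior (subcell M c m) \<inter> interior (subcell M c p) = {}) \<and>
        (\<forall>m<N_sub M. \<forall>p<N_sub M. (c, p) \<in> nbrs M c m \<longrightarrow>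
           (direct M c p m \<longleftrightarrow> \<not> direct M c m p)))"

text \<open>Every boundary point of a subcell of \<open>c\<close> lies on a face. A cell touching the boundary of the
  computational domain satisfies this once ghost cells are included in the mesh.\<close>

definition faces_cover :: "'c mesh \<Rightarrow> 'c \<Rightarrow> bool" where
  "faces_cover M c \<longleftrightarrow>
     (\<forall>m<N_sub M. frontier (subcell M c m) \<subseteq> (\<Union>(v, p)\<in>nbrs M c m. face M c m v p))"

definition subgrid_connected :: "'c mesh \<Rightarrow> 'c \<Rightarrow> bool" where
  "subgrid_connected M c \<longleftrightarrow>
     (\<forall>m<N_sub M. \<forall>p<N_sub M. (m, p) \<in> {(i, j). i < N_sub M \<and> (c, j) \<in> nbrs M c i}\<^sup>*)"

text \<open>Faces to a subcell of another cell lie on the boundary of \<open>c\<close>.\<close>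

definition face_sign :: "'c mesh \<Rightarrow> 'c \<Rightarrow> nat \<Rightarrow> 'c \<Rightarrow> nat \<Rightarrow> real" where
  "face_sign M c m v p = (if v \<noteq> c \<or> direct M c m p then 1 else - 1)"

text \<open>The columns of the adjacency matrix, one per interior face. The face between \<open>m\<close> and \<open>p\<close> is
  listed as the pair with \<open>m < p\<close>.\<close>

definition int_faces :: "'c mesh \<Rightarrow> 'c \<Rightarrow> (nat \<times> nat) list" where
  "int_faces M c = filter (\<lambda>(m, p). m < p \<and> (c, p) \<in> nbrs M c m)
     (List.product [0..<N_sub M] [0..<N_sub M])"

definition face_index :: "'c mesh \<Rightarrow> 'c \<Rightarrow> nat \<Rightarrow> nat \<Rightarrow> nat" where
  "face_index M c m p =
     (THE j. j < length (int_faces M c) \<and> int_faces M c ! j = (min m p, max m p))"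

definition adj_mat :: "'c mesh \<Rightarrow> 'c \<Rightarrow> real mat" where
  "adj_mat M c = mat (N_sub M) (length (int_faces M c)) (\<lambda>(i, j).
     let (m, p) = int_faces M c ! j
     in if i = m then face_sign M c m c p else if i = p then face_sign M c p c m else 0)"

definition lap_mat :: "'c mesh \<Rightarrow> 'c \<Rightarrow> real mat" where
  "lap_mat M c = adj_mat M c * transpose_mat (adj_mat M c)"

text \<open>The matrix that inverts \<open>L\<close> on the orthogonal complement of its kernel and vanishes on the
  kernel.\<close>

definition ker_orth :: "real mat \<Rightarrow> real vec set" where
  "ker_orth L = {v \<in> carrier_vec (dim_col L).
     \<forall>w\<in>carrier_vec (dim_col L). L *\<^sub>v w = 0\<^sub>v (dim_row L) \<longrightarrow> scalar_prod v w = 0}"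

definition inv_on_ker_orth :: "real mat \<Rightarrow> real mat" where
  "inv_on_ker_orth L = (THE B. B \<in> carrier_mat (dim_col L) (dim_row L) \<and>
     (\<forall>w\<in>carrier_vec (dim_col L). L *\<^sub>v w = 0\<^sub>v (dim_row L) \<longrightarrow> B *\<^sub>v w = 0\<^sub>v (dim_col L)) \<and>
     (\<forall>v\<in>ker_orth L. B *\<^sub>v v \<in> ker_orth L \<and> L *\<^sub>v (B *\<^sub>v v) = v \<and> B *\<^sub>v (L *\<^sub>v v) = v))"

subsection \<open>Discrete solution and fluxes\<close>

definition submean :: "'c mesh \<Rightarrow> 'c \<Rightarrow> nat \<Rightarrow> (point \<Rightarrow> real) \<Rightarrow> real" where
  "submean M c m f = (LINT x:subcell M c m|lborel. f x) / measure lborel (subcell M c m)"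

definition proj_mat :: "'c mesh \<Rightarrow> ('c \<Rightarrow> nat \<Rightarrow> point \<Rightarrow> real) \<Rightarrow> 'c \<Rightarrow> real mat" where
  "proj_mat M \<sigma> c = mat (N_sub M) (N_sub M) (\<lambda>(m, p). submean M c m (\<sigma> c p))"

definition u_h :: "'c mesh \<Rightarrow> ('c \<Rightarrow> nat \<Rightarrow> point \<Rightarrow> real) \<Rightarrow> ('c \<Rightarrow> nat \<Rightarrow> real \<Rightarrow> real) \<Rightarrow>
    real \<Rightarrow> 'c \<Rightarrow> point \<Rightarrow> real" where
  "u_h M \<sigma> U t c x = (\<Sum>m<N_sub M. U c m t * \<sigma> c m x)"

text \<open>In the following definitions \<open>w\<close> is the family of polynomials representing the discrete
  solution in the cells at a fixed time, \<open>F\<close> the flux function and \<open>NF\<close> the numerical flux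
  function. All but finitely many boundary points of \<open>c\<close> belong to a unique neighbouring cell.\<close>

definition num_flux :: "'c mesh \<Rightarrow> (real \<Rightarrow> real \<Rightarrow> point \<Rightarrow> real) \<Rightarrow> ('c \<Rightarrow> point \<Rightarrow> real) \<Rightarrow>
    'c \<Rightarrow> point \<Rightarrow> real" where
  "num_flux M NF w c x = NF (w c x)
     (w (THE v. v \<in> cells M \<and> v \<noteq> c \<and> x \<in> cell M v) x) (outward_normal (cell M c) x)"

definition int_flux :: "'c mesh \<Rightarrow> (real \<Rightarrow> point) \<Rightarrow> ('c \<Rightarrow> point \<Rightarrow> real) \<Rightarrow> 'c \<Rightarrow> point \<Rightarrow> point" where
  "int_flux M F w c = L2_proj (deg M + 1) (cell M c) (\<lambda>x. F (w c x))"

definition int_flux_vec :: "'c mesh \<Rightarrow> (real \<Rightarrow> point) \<Rightarrow> ('c \<Rightarrow> point \<Rightarrow> real) \<Rightarrow> 'c \<Rightarrow> real vec" where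
  "int_flux_vec M F w c = vec (length (int_faces M c)) (\<lambda>j.
     let (m, p) = int_faces M c ! j
     in bd_integral (face M c m c p)
          (\<lambda>x. inner (int_flux M F w c x) (outward_normal (subcell M c m) x))
        / face_sign M c m c p)"

definition subres_basis :: "'c mesh \<Rightarrow> 'c \<Rightarrow> nat \<Rightarrow> point \<Rightarrow> real" where
  "subres_basis M c m = (THE \<phi>. \<phi> \<in> Pk (deg M) \<and>
     (\<forall>\<psi>\<in>Pk (deg M). (LINT x:cell M c|lborel. \<phi> x * \<psi> x) = (LINT x:subcell M c m|lborel. \<psi> x)))"

definition subres_basis_mod :: "'c mesh \<Rightarrow> 'c \<Rightarrow> nat \<Rightarrow> point \<Rightarrow> real" where
  "subres_basis_mod M c m x =
     (if x \<in> frontier (subcell M c m) then subres_basis M c m x - 1 else subres_basis M c m x)"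

definition bd_corr_vec :: "'c mesh \<Rightarrow> (real \<Rightarrow> point) \<Rightarrow> (real \<Rightarrow> real \<Rightarrow> point \<Rightarrow> real) \<Rightarrow>
    ('c \<Rightarrow> point \<Rightarrow> real) \<Rightarrow> 'c \<Rightarrow> real vec" where
  "bd_corr_vec M F NF w c = vec (N_sub M) (\<lambda>m. bd_integral (frontier (cell M c))
     (\<lambda>x. subres_basis_mod M c m x *
        (inner (int_flux M F w c x) (outward_normal (cell M c) x) - num_flux M NF w c x)))"

definition recon_flux_vec :: "'c mesh \<Rightarrow> (real \<Rightarrow> point) \<Rightarrow> (real \<Rightarrow> real \<Rightarrow> point \<Rightarrow> real) \<Rightarrow>
    ('c \<Rightarrow> point \<Rightarrow> real) \<Rightarrow> 'c \<Rightarrow> real vec" where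
  "recon_flux_vec M F NF w c = int_flux_vec M F w c -
     transpose_mat (adj_mat M c) *\<^sub>v (inv_on_ker_orth (lap_mat M c) *\<^sub>v bd_corr_vec M F NF w c)"

definition recon_flux :: "'c mesh \<Rightarrow> (real \<Rightarrow> point) \<Rightarrow> (real \<Rightarrow> real \<Rightarrow> point \<Rightarrow> real) \<Rightarrow>
    ('c \<Rightarrow> point \<Rightarrow> real) \<Rightarrow> 'c \<Rightarrow> nat \<Rightarrow> 'c \<Rightarrow> nat \<Rightarrow> real" where
  "recon_flux M F NF w c m v p =
     (if v = c then vec_index (recon_flux_vec M F NF w c) (face_index M c m p)
      else bd_integral (face M c m v p) (num_flux M NF w c) / face_sign M c m v p)"

end

theory Submission
  imports Defs "Jordan_Normal_Form.Determinant"
begin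

text \<open>Let \<open>D\<close> be the cell, \<open>S\<^sub>m\<close> its subcells, \<open>q\<close> the projected flux and \<open>g\<close> the numerical flux on the
boundary of \<open>D\<close>. The components of \<open>grad \<psi>\<close> are polynomials of degree at most \<open>k + 1\<close>, so \<open>q\<close> may
replace the physical flux in the weak form. The subcell schemes are this weak form tested with the
sub-resolution functions \<open>\<phi>\<^sub>m\<close>, and these test functions suffice: the residual of the weak form is
represented by a polynomial \<open>e\<close>, its value at \<open>\<phi>\<^sub>m\<close> is the integral of \<open>e\<close> over \<open>S\<^sub>m\<close>, and by
invertibility of the projection matrix \<open>e\<close> vanishes as soon as all these integrals do
(\<open>residual_zero_iff\<close>).

Since \<open>div q\<close> has degree at most \<open>k\<close>, the integral of \<open>\<phi>\<^sub>m div q\<close> over \<open>D\<close> is that of \<open>div q\<close> over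
\<open>S\<^sub>m\<close>. Integrating by parts once over \<open>D\<close> and once over \<open>S\<^sub>m\<close>, the scheme tested with \<open>\<phi>\<^sub>m\<close> becomes

\<open>\<integral>\<^sub>S\<^sub>m \<partial>\<^sub>t u = - \<integral>\<^sub>\<partial>\<^sub>S\<^sub>m q \<cdot> n + \<integral>\<^sub>\<partial>\<^sub>D \<phi>\<^sub>m (q \<cdot> n - g)\<close>.

Write \<open>\<phi>\<^sub>m\<close> on the boundary of \<open>D\<close> as its modification plus the indicator of the boundary of \<open>S\<^sub>m\<close>.
The indicator turns the flux of \<open>q\<close> through the outer faces of \<open>S\<^sub>m\<close> into that of \<open>g\<close>, and the
modification contributes the component \<open>G\<^sub>m\<close> of the correction vector (\<open>residual_subres_basis\<close>). What
is left is to hide \<open>G\<close> in the fluxes through the interior faces. With \<open>L = A A\<^sup>T\<close>,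
\<open>A (F - A\<^sup>T L\<^sup>-\<^sup>1 G) = A F - G\<close> provided that \<open>G\<close> is orthogonal to the kernel of \<open>L\<close>. The graph being
connected, this kernel consists of the constants, and the components of \<open>G\<close> do add up to zero
(\<open>sum_bd_corr\<close>): the \<open>\<phi>\<^sub>m\<close> have sum \<open>1\<close> and almost every boundary point of \<open>D\<close> belongs to the boundary
of exactly one subcell.

The geometric input is the divergence theorem on polygonal regions and the fact that the faces of a
subcell tile its boundary. Both rest on one local picture. All boundaries lie on finitely many
lines. Away from their finitely many crossing points, every region of the mesh coincides near a
point \<open>x\<close> of a line with nothing, a full disc, or one of the two half-discs cut off by the line.
So a region is described at \<open>x\<close> by two truth values, one for each side of the line, and statements
about boundaries, normals and disjointness become propositional. The divergence theorem follows by
Fubini: a horizontal slice of the region is a finite union of intervals, and at an endpoint lying on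
a line of direction \<open>u\<close> the drop of the indicator from left to right, times \<open>\<bar>u\<^sub>y\<bar>\<close>, is the first component of
the normal, while \<open>\<bar>u\<^sub>y\<bar>\<close> is also the ratio of height to arc length.\<close>

section \<open>Integrating a derivative over a set with finite frontier\<close>

definition right_in :: "real set \<Rightarrow> real \<Rightarrow> bool" where
  "right_in T x \<longleftrightarrow> (\<exists>e>0. {x<..<x+e} \<subseteq> T)"
definition left_in :: "real set \<Rightarrow> real \<Rightarrow> bool" where
  "left_in T x \<longleftrightarrow> (\<exists>e>0. {x-e<..<x} \<subseteq> T)"

lemma connected_avoiding_frontier:
  assumes "connected C" "C \<inter> frontier T = {}"
  shows "C \<subseteq> T \<or> C \<inter> T = {}"
  using assms connected_Int_frontier[of C T] by blast

text \<open>Between consecutive points of \<open>X\<close> the indicator of \<open>T\<close> is constant, so its value at \<open>t\<close> is the sum of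
its jumps to the left of \<open>t\<close>. The induction passes from \<open>t\<close> to a point \<open>t'\<close> on the other side of
the last possible jump before \<open>t\<close>, with no further one in between; far to the left the indicator vanishes because \<open>T\<close> is bounded.\<close>

lemma jump_expansion:
  fixes T :: "real set"
  assumes T: "bounded T" and X: "finite X" "frontier T \<subseteq> X" and t: "t \<notin> X"
  shows "(indicator T t :: real) =
    (\<Sum>x | x \<in> X \<and> x < t. of_bool (right_in T x) - of_bool (left_in T x))"
  using t
proof (induction "card {x\<in>X. x < t}" arbitrary: t rule: less_induct)
  case less
  let ?Y = "{x\<in>X. x < t}"
  have finY: "finite ?Y" using X by simp
  show ?case
  proof (cases "?Y = {}")
    case True
    have "connected {..t}" by simp
    moreover have "{..t} \<inter> frontier T = {}"
      using True X(2) less.prems by (force simp: order_le_less)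
    ultimately have "{..t} \<subseteq> T \<or> {..t} \<inter> T = {}" by (rule connected_avoiding_frontier)
    moreover have "\<not> {..t} \<subseteq> T"
    proof
      assume "{..t} \<subseteq> T"
      then have "bounded {..t}" using T bounded_subset by blast
      then obtain b where b: "\<And>x. x \<le> t \<Longrightarrow> \<bar>x\<bar> \<le> b" unfolding bounded_real by auto
      show False using b[of "min t (- b - 1)"] by auto
    qed
    ultimately show ?thesis by (subst True) (auto simp: indicator_def)
  next
    case False
    define z where "z = Max ?Y"
    have zY: "z \<in> ?Y" using Max_in[OF finY False] unfolding z_def .
    have zmax: "x \<le> z" if "x \<in> ?Y" for x using Max_ge[OF finY that] unfolding z_def .
    define W where "W = {x\<in>X. x < z}"
    have Yz: "?Y = insert z W" using zY zmax unfolding W_def by force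
    have finW: "finite W" and zW: "z \<notin> W" using X unfolding W_def by auto
    define w where "w = (if W = {} then z - 1 else Max W)"
    have wz: "w < z" using Max_in[OF finW] unfolding w_def W_def by force
    have wW: "x \<le> w" if "x \<in> W" for x using that Max_ge[OF finW that] unfolding w_def by auto
    define t' where "t' = (w + z) / 2"
    have t': "w < t'" "t' < z" using wz unfolding t'_def by auto
    have t'X: "t' \<notin> X" using wW[of t'] t' unfolding W_def by force
    have Wt': "{x\<in>X. x < t'} = W" using wW t' unfolding W_def by force
    have IH: "indicator T t' = (\<Sum>x\<in>W. of_bool (right_in T x) - of_bool (left_in T x) :: real)"
      using less.hyps[of t'] t'X Wt' Yz finW zW by auto
    have "{z<..t} \<inter> frontier T = {}"
      using X(2) zmax less.prems by (force simp: order_le_less)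
    then have R: "{z<..t} \<subseteq> T \<or> {z<..t} \<inter> T = {}"
      by (intro connected_avoiding_frontier) auto
    have "t \<in> T \<longleftrightarrow> right_in T z"
    proof
      assume "t \<in> T"
      moreover have "t \<in> {z<..t}" using zY by simp
      ultimately have "{z<..t} \<subseteq> T" using R by blast
      then have "{z<..<z+(t-z)} \<subseteq> T" by auto
      then show "right_in T z" unfolding right_in_def using zY by (intro exI[of _ "t-z"]) auto
    next
      assume "right_in T z"
      then obtain e where e: "e > 0" "{z<..<z+e} \<subseteq> T" unfolding right_in_def by auto
      have "z + min (e/2) (t - z) \<in> T" using e zY by (intro subsetD[OF e(2)]) auto
      moreover have "z + min (e/2) (t - z) \<in> {z<..t}" using e zY by auto
      ultimately have "{z<..t} \<subseteq> T" using R by blast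
      then show "t \<in> T" using zY by auto
    qed
    moreover have "{t'..<z} \<inter> frontier T = {}"
      using X(2) wW t' unfolding W_def by force
    then have L: "{t'..<z} \<subseteq> T \<or> {t'..<z} \<inter> T = {}"
      by (intro connected_avoiding_frontier) auto
    have "t' \<in> T \<longleftrightarrow> left_in T z"
    proof
      assume "t' \<in> T"
      moreover have "t' \<in> {t'..<z}" using t' by simp
      ultimately have "{t'..<z} \<subseteq> T" using L by blast
      then have "{z-(z-t')<..<z} \<subseteq> T" by auto
      then show "left_in T z" unfolding left_in_def using t' by (intro exI[of _ "z-t'"]) auto
    next
      assume "left_in T z"
      then obtain e where e: "e > 0" "{z-e<..<z} \<subseteq> T" unfolding left_in_def by auto
      have "z - min (e/2) (z - t') \<in> T" using e t' by (intro subsetD[OF e(2)]) auto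
      moreover have "z - min (e/2) (z - t') \<in> {t'..<z}" using e t' by auto
      ultimately have "{t'..<z} \<subseteq> T" using L by blast
      then show "t' \<in> T" using t' by auto
    qed
    ultimately show ?thesis
      unfolding Yz using IH finW zW by (simp add: indicator_def)
  qed
qed

text \<open>The fundamental theorem of calculus for a finite union of intervals whose endpoints are among the
points of \<open>X\<close>. Points of \<open>X\<close> that are not endpoints contribute a zero jump, so \<open>X\<close> can be chosen
generously.\<close>

lemma integral_deriv_over_intervals:
  fixes T :: "real set" and g g' :: "real \<Rightarrow> real"
  assumes T: "bounded T" and X: "finite X" "frontier T \<subseteq> X"
    and g: "\<And>x. (g has_real_derivative g' x) (at x)" and g': "continuous_on UNIV g'"
  shows "(\<integral>x. indicator T x * g' x \<partial>lborel) =
    (\<Sum>x\<in>X. (of_bool (left_in T x) - of_bool (right_in T x)) * g x)"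
proof -
  \<comment> \<open>By the jump expansion the indicator of \<open>T\<close> is, off \<open>X\<close>, a combination of the indicators of \<open>{x..B}\<close>
    with coefficients \<open>j x\<close>; beyond \<open>B\<close> there is nothing left of \<open>T\<close>, whence \<open>total\<close>.\<close>
  define j where "j x = (of_bool (right_in T x) - of_bool (left_in T x) :: real)" for x
  have "bounded (T \<union> X)" using T X by (simp add: finite_imp_bounded)
  then obtain B0 where B0: "\<And>x. x \<in> T \<union> X \<Longrightarrow> \<bar>x\<bar> \<le> B0" unfolding bounded_real by auto
  define B where "B = B0 + 1"
  have B: "x < B" if "x \<in> T \<union> X" for x using B0[OF that] unfolding B_def by auto
  have FTC: "has_bochner_integral lborel (\<lambda>t. g' t * indicator {x..B} t) (g B - g x)" if "x \<in> X" for x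
    using B[of x] that g g' by (intro has_bochner_integral_FTC_Icc_real) (auto simp: continuous_on_eq_continuous_at)
  have total: "sum j X = 0"
  proof -
    have "{x\<in>X. x < B} = X" using B by auto
    moreover have "B \<notin> X" "B \<notin> T" using B by auto
    ultimately show ?thesis using jump_expansion[OF T X, of B] unfolding j_def by simp
  qed
  have "(\<integral>x. indicator T x * g' x \<partial>lborel) = (\<integral>t. (\<Sum>x\<in>X. j x * (g' t * indicator {x..B} t)) \<partial>lborel)"
  proof (rule integral_discrete_difference[where X = X])
    fix t assume t: "t \<in> space lborel" "t \<notin> X"
    show "indicator T t * g' t = (\<Sum>x\<in>X. j x * (g' t * indicator {x..B} t))"
    proof (cases "t \<le> B")
      case True
      have "(\<Sum>x\<in>X. j x * (g' t * indicator {x..B} t)) = (\<Sum>x\<in>X. if x < t then j x * g' t else 0)"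
        using True t by (intro sum.cong) (auto simp: indicator_def)
      also have "\<dots> = (\<Sum>x | x \<in> X \<and> x < t. j x) * g' t"
        using X by (simp add: sum_distrib_right sum.If_cases Int_def conj_commute)
      also have "\<dots> = indicator T t * g' t"
        using jump_expansion[OF T X t(2)] unfolding j_def by simp
      finally show ?thesis by simp
    next
      case False
      then show ?thesis using B[of t] by (auto simp: indicator_def)
    qed
  qed (use X in \<open>auto simp: countable_finite\<close>)
  also have "\<dots> = (\<Sum>x\<in>X. j x * (g B - g x))"
    using FTC by (subst Bochner_Integration.integral_sum) (auto simp: has_bochner_integral_iff)
  also have "\<dots> = sum j X * g B - (\<Sum>x\<in>X. j x * g x)"
    by (simp add: right_diff_distrib sum_subtractf sum_distrib_right)
  finally show ?thesis using total by (simp add: j_def sum_negf[symmetric] left_diff_distrib)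
qed

section \<open>Line arrangements\<close>

definition rot :: "point \<Rightarrow> point" where "rot v = (snd v, - fst v)"

lemma rot_simps [simp]: "fst (rot v) = snd v" "snd (rot v) = - fst v" by (auto simp: rot_def)
lemma norm_rot [simp]: "norm (rot v) = norm v" by (simp add: rot_def norm_prod_def algebra_simps)

locale line_arrangement =
  fixes I :: "'i set" and a u :: "'i \<Rightarrow> point"
  assumes finite_I: "finite I"
    and unit: "i \<in> I \<Longrightarrow> norm (u i) = 1"
    and distinct_lines: "i \<in> I \<Longrightarrow> j \<in> I \<Longrightarrow>
      range (\<lambda>s. a i + s *\<^sub>R u i) = range (\<lambda>s. a j + s *\<^sub>R u j) \<Longrightarrow> i = j"
begin

definition par :: "'i \<Rightarrow> real \<Rightarrow> point" where "par i s = a i + s *\<^sub>R u i"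
definition line :: "'i \<Rightarrow> point set" where "line i = range (par i)"
definition nrm :: "'i \<Rightarrow> point" where "nrm i = rot (u i)"
text \<open>All crossing points, whether or not a region has a corner there. They are finitely many, hence
negligible for arc length, and are excluded from every local argument.\<close>

definition vertices :: "point set" where
  "vertices = (\<Union>i\<in>I. \<Union>j\<in>I - {i}. line i \<inter> line j)"

text \<open>Polygonal regions whose frontier lies on the lines of the arrangement.\<close>

definition regular :: "point set \<Rightarrow> bool" where
  "regular S \<longleftrightarrow> compact S \<and> S = closure (interior S) \<and> frontier S \<subseteq> (\<Union>i\<in>I. line i)"

lemma unit_sq: "i \<in> I \<Longrightarrow> fst (u i) * fst (u i) + snd (u i) * snd (u i) = 1"
proof -
  assume "i \<in> I"
  then have "inner (u i) (u i) = 1" using unit[of i] by (simp add: norm_eq_1)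
  then show ?thesis by (simp add: inner_prod_def)
qed

lemma norm_nrm [simp]: "i \<in> I \<Longrightarrow> norm (nrm i) = 1"
  by (simp add: nrm_def unit)

lemma line_iff:
  assumes "i \<in> I" shows "y \<in> line i \<longleftrightarrow> inner (y - a i) (nrm i) = 0"
proof
  assume "inner (y - a i) (nrm i) = 0"
  then have 0: "fst (y - a i) * snd (u i) = snd (y - a i) * fst (u i)"
    by (simp add: nrm_def rot_def inner_prod_def)
  define p q v w where "p = fst (y - a i)" and "q = snd (y - a i)"
    and "v = fst (u i)" and "w = snd (u i)"
  have 0: "p * w = q * v" and 1: "v * v + w * w = 1"
    using 0 unit_sq[OF assms] unfolding p_def q_def v_def w_def by auto
  have "(p * v + q * w) * v = p * (v * v) + (q * v) * w" by (simp only: distrib_right mult.assoc mult.commute[of w v])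
  also have "\<dots> = p * (v * v + w * w)" unfolding 0[symmetric] by (simp only: distrib_left mult.assoc)
  finally have pv: "p = (p * v + q * w) * v" using 1 by simp
  have "(p * v + q * w) * w = (p * w) * v + q * (w * w)" by (simp only: distrib_right mult.assoc mult.commute[of w v])
  also have "\<dots> = q * (v * v + w * w)" unfolding 0 by (simp only: distrib_left mult.assoc)
  finally have qw: "q = (p * v + q * w) * w" using 1 by simp
  have "y = par i (p * v + q * w)" using pv qw
    by (intro prod_eqI) (simp_all add: par_def p_def q_def v_def w_def)
  then show "y \<in> line i" unfolding line_def by blast
qed (auto simp: line_def par_def nrm_def inner_prod_def)

lemma line_through:
  assumes "i \<in> I" "x \<in> line i" shows "y \<in> line i \<longleftrightarrow> inner (y - x) (nrm i) = 0"
  using assms line_iff[OF assms(1)] by (simp add: inner_diff_left)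

lemma closed_line: "i \<in> I \<Longrightarrow> closed (line i)"
proof -
  assume i: "i \<in> I"
  have "line i = {y. inner (y - a i) (nrm i) = 0}" using line_iff[OF i] by auto
  then show ?thesis by (simp add: closed_Collect_eq continuous_intros)
qed

lemma lines_meet_once:
  assumes ij: "i \<in> I" "j \<in> I" "i \<noteq> j" and xy: "x \<in> line i \<inter> line j" "y \<in> line i \<inter> line j"
  shows "x = y"
proof (rule ccontr)
  assume ne: "x \<noteq> y"
  have through: "line k = range (\<lambda>s. x + s *\<^sub>R (y - x))" if "k \<in> I" "x \<in> line k" "y \<in> line k" for k
  proof -
    obtain s t where st: "x = a k + s *\<^sub>R u k" "y = a k + t *\<^sub>R u k"
      using \<open>x \<in> line k\<close> \<open>y \<in> line k\<close> by (auto simp: line_def par_def)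
    then have "s \<noteq> t" using ne by auto
    have "a k + r *\<^sub>R u k = x + ((r - s) / (t - s)) *\<^sub>R (y - x)" for r
    proof -
      have "x + ((r - s) / (t - s)) *\<^sub>R (y - x) = a k + (s + (r - s) / (t - s) * (t - s)) *\<^sub>R u k"
        unfolding st by (simp only: scaleR_add_left scaleR_scaleR[symmetric] scaleR_diff_left) simp
      then show ?thesis using \<open>s \<noteq> t\<close> by simp
    qed
    then have "line k \<subseteq> range (\<lambda>s. x + s *\<^sub>R (y - x))" unfolding line_def par_def by blast
    moreover have "x + r *\<^sub>R (y - x) = a k + (s + r * (t - s)) *\<^sub>R u k" for r
      unfolding st by (simp add: scaleR_add_left scaleR_diff_left right_diff_distrib scaleR_diff_right)
    then have "range (\<lambda>s. x + s *\<^sub>R (y - x)) \<subseteq> line k" unfolding line_def par_def by blast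
    ultimately show ?thesis by blast
  qed
  have "line i = line j" using through[of i] through[of j] ij xy by auto
  then show False using distinct_lines ij unfolding line_def par_def by blast
qed

lemma finite_vertices: "finite vertices"
proof -
  have "finite (line i \<inter> line j)" if "i \<in> I" "j \<in> I - {i}" for i j
  proof (cases "line i \<inter> line j = {}")
    case False
    then obtain x where "x \<in> line i \<inter> line j" by blast
    then have "line i \<inter> line j \<subseteq> {x}" using lines_meet_once[of i j] that by blast
    then show ?thesis using finite_subset by blast
  qed simp
  then show ?thesis using finite_I unfolding vertices_def by (intro finite_UN_I finite_Diff) auto
qed

lemma inj_par: "i \<in> I \<Longrightarrow> inj (par i)"
  using unit[of i] by (auto simp: inj_def par_def)

end

section \<open>Half-discs and outward normals\<close>

definition half_disc :: "'a::real_inner \<Rightarrow> real \<Rightarrow> 'a \<Rightarrow> 'a set" where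
  "half_disc x r n = {y \<in> ball x r. inner (y - x) n > 0}"

definition on_side :: "'a::real_inner set \<Rightarrow> 'a \<Rightarrow> 'a \<Rightarrow> bool" where
  "on_side S x n \<longleftrightarrow> (\<exists>r>0. half_disc x r n \<subseteq> S)"

definition has_normal :: "'a::real_inner set \<Rightarrow> 'a \<Rightarrow> 'a \<Rightarrow> bool" where
  "has_normal S x n \<longleftrightarrow> norm n = 1 \<and>
     (\<exists>r>0. S \<inter> ball x r = {y \<in> ball x r. inner (y - x) n \<le> 0})"

text \<open>Blowing up at \<open>x\<close> shows that the half-spaces of \<open>n\<close> and \<open>n'\<close> have the same elements. The component of
\<open>n'\<close> orthogonal to \<open>n\<close> lies in the first one, hence in the second one, and that forces it to be zero.\<close>

lemma has_normal_unique:
  assumes "has_normal S x n" "has_normal S x n'" shows "n' = n"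
proof -
  obtain r r' where r: "r > 0" "S \<inter> ball x r = {y \<in> ball x r. inner (y - x) n \<le> 0}"
    and r': "r' > 0" "S \<inter> ball x r' = {y \<in> ball x r'. inner (y - x) n' \<le> 0}"
    and n: "norm n = 1" "norm n' = 1"
    using assms unfolding has_normal_def by blast
  \<comment> \<open>Scaled by \<open>e\<close>, the vector \<open>v\<close> fits into both balls.\<close>
  have eq: "inner v n \<le> 0 \<longleftrightarrow> inner v n' \<le> 0" for v
  proof -
    define e where "e = min r r' / (2 * (norm v + 1))"
    have e: "e > 0" using r(1) r'(1) unfolding e_def by (simp add: add_nonneg_pos)
    have "norm (e *\<^sub>R v) < min r r'"
    proof -
      have "norm (e *\<^sub>R v) = min r r' * (norm v / (2 * (norm v + 1)))" using e r(1) r'(1) by (simp add: e_def)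
      also have "\<dots> < min r r' * 1"
        using r(1) r'(1) by (intro mult_strict_left_mono) (auto simp: divide_simps add_nonneg_pos)
      finally show ?thesis by simp
    qed
    then have b: "x + e *\<^sub>R v \<in> ball x r" "x + e *\<^sub>R v \<in> ball x r'" by (auto simp: dist_norm)
    have "inner v n \<le> 0 \<longleftrightarrow> x + e *\<^sub>R v \<in> {y \<in> ball x r. inner (y - x) n \<le> 0}"
      using b(1) e by (simp add: mult_le_0_iff)
    also have "\<dots> \<longleftrightarrow> x + e *\<^sub>R v \<in> {y \<in> ball x r'. inner (y - x) n' \<le> 0}"
      using b unfolding r(2)[symmetric] r'(2)[symmetric] by blast
    also have "\<dots> \<longleftrightarrow> inner v n' \<le> 0" using b(2) e by (simp add: mult_le_0_iff)
    finally show ?thesis .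
  qed
  have nn: "inner n n = 1" "inner n' n' = 1" using n by (simp_all add: norm_eq_1)
  define c where "c = inner n n'"
  have "inner (n' - c *\<^sub>R n) n \<le> 0" using nn by (simp add: c_def inner_diff_left inner_commute[of n' n])
  then have "inner (n' - c *\<^sub>R n) n' \<le> 0" using eq by blast
  then have "1 \<le> c * c" using nn by (simp add: c_def inner_diff_left)
  moreover have "c > 0" using eq[of n] nn unfolding c_def by auto
  ultimately have "c \<ge> 1" using mult_strict_mono[of c 1 c 1] by (cases "c < 1") auto
  then have "inner (n' - n) (n' - n) \<le> 0" using nn by (simp add: c_def inner_diff_left inner_diff_right inner_commute[of n' n])
  then have "inner (n' - n) (n' - n) = 0" using inner_ge_zero[of "n' - n"] by linarith
  then show ?thesis by simp
qed

lemma outward_normal_eqI: "has_normal S x n \<Longrightarrow> outward_normal S x = n"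
  unfolding outward_normal_def has_normal_def[symmetric]
  by (rule the_equality) (simp_all add: has_normal_unique)

lemma half_disc_near:
  fixes x y n :: "'a::real_inner"
  assumes "norm n = 1" "y \<in> ball x r" "inner (y - x) n \<ge> 0" "d > 0"
  shows "\<exists>z\<in>half_disc x r n. dist z y < d"
proof -
  have "open (ball x r)" by simp
  then obtain e where e: "e > 0" "ball y e \<subseteq> ball x r" using assms(2) openE by blast
  define z where "z = y + (min e d / 2) *\<^sub>R n"
  have p: "min e d > 0" using e assms by simp
  have dz: "dist z y = min e d / 2" using assms(1) p by (simp add: z_def dist_norm)
  then have "z \<in> ball y e" using e p by (simp add: dist_commute)
  then have "z \<in> ball x r" using e by blast
  moreover have "inner (z - x) n > 0"
  proof -
    have "inner (z - x) n = inner (y - x) n + min e d / 2"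
      using assms(1) by (simp add: z_def algebra_simps norm_eq_1)
    then show ?thesis using assms(3) p by linarith
  qed
  ultimately show ?thesis using dz p assms(4) by (intro bexI[of _ z]) (auto simp: half_disc_def)
qed

lemma half_disc_subset_closed:
  assumes "norm n = 1" "y \<in> ball x r" "inner (y - x) n \<ge> 0" "closed S" "half_disc x r n \<subseteq> S"
  shows "y \<in> S"
proof -
  have "y \<in> closure S" unfolding closure_approachable
    using half_disc_near[OF assms(1-3)] assms(5) by blast
  then show ?thesis using assms(4) by simp
qed

lemma open_half_disc [simp]: "open (half_disc x r n)"
proof -
  have "half_disc x r n = ball x r \<inter> {y. inner (y - x) n > 0}" by (auto simp: half_disc_def)
  then show ?thesis by (auto intro!: open_Int open_Collect_less continuous_intros)
qed

lemma convex_half_disc [simp]: "convex (half_disc x r n)"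
proof -
  have "half_disc x r n = ball x r \<inter> {y. inner n y > inner n x}"
    by (auto simp: half_disc_def inner_diff_left inner_diff_right inner_commute)
  then show ?thesis by (simp add: convex_Int convex_halfspace_gt)
qed

lemma half_disc_nonempty: "norm n = 1 \<Longrightarrow> r > 0 \<Longrightarrow> half_disc x r n \<noteq> {}"
  using half_disc_near[of n x x r 1] by auto

lemma half_disc_mono: "r \<le> r' \<Longrightarrow> half_disc x r n \<subseteq> half_disc x r' n"
  by (auto simp: half_disc_def)

lemma on_side_mono: "on_side S x n \<Longrightarrow> S \<subseteq> T \<Longrightarrow> on_side T x n"
  unfolding on_side_def by blast

lemma open_meets_half_disc:
  assumes "open O'" "O' \<inter> ball x r \<noteq> {}" "norm n = 1"
  shows "O' \<inter> half_disc x r n \<noteq> {} \<or> O' \<inter> half_disc x r (- n) \<noteq> {}"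
proof -
  obtain y where y: "y \<in> O'" "y \<in> ball x r" using assms by blast
  obtain d where d: "d > 0" "ball y d \<subseteq> O'" using assms(1) y openE by blast
  have "\<exists>z\<in>half_disc x r n \<union> half_disc x r (- n). dist z y < d"
  proof (cases "inner (y - x) n \<ge> 0")
    case True then show ?thesis using half_disc_near[OF assms(3) y(2) _ d(1)] by blast
  next
    case False then show ?thesis using half_disc_near[of "-n" y x r d] assms(3) y(2) d(1) by auto
  qed
  then show ?thesis using d by (auto simp: subset_iff dist_commute)
qed

section \<open>Regular sets at a generic point\<close>

context line_arrangement begin

lemma isolating_disc:
  assumes i: "i \<in> I" and x: "x \<in> line i" "x \<notin> vertices"
  obtains r where "r > 0" "\<And>j. j \<in> I \<Longrightarrow> j \<noteq> i \<Longrightarrow> ball x r \<inter> line j = {}"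
proof -
  have "open (- (\<Union>j\<in>I - {i}. line j))"
    using finite_I closed_line by (intro open_Compl closed_UN) auto
  moreover have "x \<in> - (\<Union>j\<in>I - {i}. line j)" using i x unfolding vertices_def by blast
  ultimately obtain r where "r > 0" "ball x r \<subseteq> - (\<Union>j\<in>I - {i}. line j)" using openE by blast
  then show ?thesis using that by blast
qed

text \<open>\<open>x\<close> is generic, that is, it lies on exactly one line, and \<open>n\<close> is one of the two unit normals of that
line.\<close>

definition normal_to :: "point \<Rightarrow> point \<Rightarrow> bool" where
  "normal_to x n \<longleftrightarrow> x \<notin> vertices \<and> (\<exists>i\<in>I. x \<in> line i \<and> (n = nrm i \<or> n = - nrm i))"

lemma normal_to_uminus: "normal_to x n \<Longrightarrow> normal_to x (- n)"
  unfolding normal_to_def by auto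

lemma normal_to_norm: "normal_to x n \<Longrightarrow> norm n = 1"
  unfolding normal_to_def by auto

lemma normal_to_ex: "x \<notin> vertices \<Longrightarrow> i \<in> I \<Longrightarrow> x \<in> line i \<Longrightarrow> normal_to x (nrm i)"
  unfolding normal_to_def by auto

lemma normal_to_exhaust:
  assumes "normal_to x n" "normal_to x n'" shows "n' = n \<or> n' = - n"
  using assms unfolding normal_to_def vertices_def by fastforce

text \<open>A small half-disc at a generic point is connected and meets no line, hence no frontier of a regular
set. The radius depends only on \<open>x\<close>, so one half-disc serves all regular sets at once.\<close>

lemma half_disc_dichotomy:
  assumes "normal_to x n"
  shows "\<exists>r>0. \<forall>S n'. regular S \<longrightarrow> n' = n \<or> n' = - n \<longrightarrow>
    half_disc x r n' \<subseteq> S \<or> half_disc x r n' \<inter> S = {}"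
proof -
  obtain i where i: "i \<in> I" "x \<in> line i" "n = nrm i \<or> n = - nrm i" and x: "x \<notin> vertices"
    using assms unfolding normal_to_def by blast
  obtain r where r: "r > 0" "\<And>j. j \<in> I \<Longrightarrow> j \<noteq> i \<Longrightarrow> ball x r \<inter> line j = {}"
    using isolating_disc[OF i(1,2) x] by blast
  have "half_disc x r n' \<subseteq> S \<or> half_disc x r n' \<inter> S = {}" if "regular S" "n' = n \<or> n' = - n" for S n'
  proof (rule connected_avoiding_frontier)
    show "connected (half_disc x r n')" by (simp add: convex_connected)
    have "half_disc x r n' \<inter> line j = {}" if "j \<in> I" for j
    proof (cases "j = i")
      case True
      then show ?thesis using i line_through[OF i(1,2)] \<open>n' = n \<or> n' = - n\<close> by (auto simp: half_disc_def)
    next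
      case False then show ?thesis using r(2)[OF that] by (auto simp: half_disc_def)
    qed
    then show "half_disc x r n' \<inter> frontier S = {}" using that unfolding regular_def by blast
  qed
  then show ?thesis using r(1) by blast
qed

lemma regular_closed: "regular S \<Longrightarrow> closed S"
  unfolding regular_def by (simp add: compact_imp_closed)

lemma not_on_side:
  assumes x: "normal_to x n" and S: "regular S" and n: "\<not> on_side S x n"
  obtains r where "r > 0" "half_disc x r n \<inter> S = {}"
proof -
  obtain r where r: "r > 0"
    "\<forall>S n'. regular S \<longrightarrow> n' = n \<or> n' = - n \<longrightarrow> half_disc x r n' \<subseteq> S \<or> half_disc x r n' \<inter> S = {}"
    using half_disc_dichotomy[OF x] by blast
  have "half_disc x r n \<inter> S = {}" using r(2)[rule_format, OF S, of n] n r(1) unfolding on_side_def by blast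
  then show ?thesis using r(1) that by blast
qed

text \<open>Being the closure of its interior, a regular set cannot contain \<open>x\<close> through a mere piece of the
line: some interior point is close to \<open>x\<close> and off the line.\<close>

lemma mem_iff_on_side:
  assumes x: "normal_to x n" and S: "regular S"
  shows "x \<in> S \<longleftrightarrow> on_side S x n \<or> on_side S x (- n)"
proof
  assume "x \<in> S"
  obtain r where r: "r > 0"
    "\<forall>S n'. regular S \<longrightarrow> n' = n \<or> n' = - n \<longrightarrow> half_disc x r n' \<subseteq> S \<or> half_disc x r n' \<inter> S = {}"
    using half_disc_dichotomy[OF x] by blast
  have "x \<in> closure (interior S)" using \<open>x \<in> S\<close> S unfolding regular_def by simp
  then obtain y where "y \<in> interior S" "dist y x < r" using r(1) unfolding closure_approachable by blast
  then have "interior S \<inter> ball x r \<noteq> {}" by (auto simp: dist_commute)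
  then have "interior S \<inter> half_disc x r n \<noteq> {} \<or> interior S \<inter> half_disc x r (- n) \<noteq> {}"
    using open_meets_half_disc normal_to_norm[OF x] by blast
  then show "on_side S x n \<or> on_side S x (- n)"
    using r(1) r(2)[rule_format, OF S, of n] r(2)[rule_format, OF S, of "- n"] interior_subset[of S] unfolding on_side_def by blast
next
  have "x \<in> S" if "normal_to x m" "on_side S x m" for m
  proof -
    obtain r where "r > 0" "half_disc x r m \<subseteq> S" using \<open>on_side S x m\<close> unfolding on_side_def by auto
    then show "x \<in> S" using half_disc_subset_closed[of m x x r S] normal_to_norm[OF that(1)] regular_closed[OF S] by simp
  qed
  then show "x \<in> S" if "on_side S x n \<or> on_side S x (- n)"
    using that x normal_to_uminus by blast
qed

lemma interior_iff_on_side: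
  assumes x: "normal_to x n" and S: "regular S"
  shows "x \<in> interior S \<longleftrightarrow> on_side S x n \<and> on_side S x (- n)"
proof
  assume "x \<in> interior S"
  then obtain r where "r > 0" "ball x r \<subseteq> S" unfolding mem_interior by auto
  then show "on_side S x n \<and> on_side S x (- n)"
    unfolding on_side_def half_disc_def by blast
next
  assume "on_side S x n \<and> on_side S x (- n)"
  then obtain r1 r2 where r: "r1 > 0" "r2 > 0" "half_disc x r1 n \<subseteq> S" "half_disc x r2 (- n) \<subseteq> S"
    unfolding on_side_def by auto
  define r where "r = min r1 r2"
  have h: "half_disc x r n \<subseteq> S" "half_disc x r (- n) \<subseteq> S"
    using r half_disc_mono[of r r1 x n] half_disc_mono[of r r2 x "- n"] unfolding r_def by auto
  have "y \<in> S" if "y \<in> ball x r" for y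
  proof (cases "inner (y - x) n \<ge> 0")
    case True
    then show ?thesis using half_disc_subset_closed[OF _ that _ regular_closed[OF S] h(1)] normal_to_norm[OF x] by simp
  next
    case False
    then show ?thesis using half_disc_subset_closed[OF _ that _ regular_closed[OF S] h(2)] normal_to_norm[OF x] by simp
  qed
  then show "x \<in> interior S" unfolding mem_interior using r by (intro exI[of _ r]) (auto simp: r_def)
qed

lemma frontier_iff_on_side:
  assumes x: "normal_to x n" and S: "regular S"
  shows "x \<in> frontier S \<longleftrightarrow> on_side S x n \<noteq> on_side S x (- n)"
  using mem_iff_on_side[OF assms] interior_iff_on_side[OF assms] regular_closed[OF S]
  by (auto simp: frontier_def)

lemma has_normal_on_side:
  assumes x: "normal_to x n" and S: "regular S" and s: "on_side S x (- n)" "\<not> on_side S x n"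
  shows "has_normal S x n"
proof -
  obtain r1 where r1: "r1 > 0" "half_disc x r1 n \<inter> S = {}" using not_on_side[OF x S s(2)] by blast
  obtain r2 where r2: "r2 > 0" "half_disc x r2 (- n) \<subseteq> S" using s(1) unfolding on_side_def by auto
  define r where "r = min r1 r2"
  have h: "half_disc x r n \<inter> S = {}" "half_disc x r (- n) \<subseteq> S"
    using r1 r2 half_disc_mono[of r r1 x n] half_disc_mono[of r r2 x "- n"] unfolding r_def by auto
  have "y \<in> S \<longleftrightarrow> inner (y - x) n \<le> 0" if "y \<in> ball x r" for y
  proof
    show "inner (y - x) n \<le> 0" if "y \<in> S" 
    proof (rule ccontr)
      assume "\<not> inner (y - x) n \<le> 0"
      then have "y \<in> half_disc x r n" using \<open>y \<in> ball x r\<close> by (simp add: half_disc_def)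
      then show False using h(1) that by blast
    qed
    show "y \<in> S" if "inner (y - x) n \<le> 0"
      using half_disc_subset_closed[OF _ \<open>y \<in> ball x r\<close> _ regular_closed[OF S] h(2)] normal_to_norm[OF x] that by simp
  qed
  then have "S \<inter> ball x r = {y \<in> ball x r. inner (y - x) n \<le> 0}" by blast
  moreover have "r > 0" using r1 r2 by (simp add: r_def)
  ultimately show ?thesis unfolding has_normal_def using normal_to_norm[OF x] by blast
qed

lemma outward_normal_on_side:
  assumes "normal_to x n" "regular S" "on_side S x (- n)" "\<not> on_side S x n"
  shows "outward_normal S x = n"
  by (rule outward_normal_eqI, rule has_normal_on_side) (use assms in auto)

lemma disjoint_interiors_on_side:
  assumes x: "normal_to x n" and ST: "interior S \<inter> interior T = {}"
  shows "\<not> (on_side S x n \<and> on_side T x n)"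
proof
  assume "on_side S x n \<and> on_side T x n"
  then obtain r1 r2 where r: "r1 > 0" "r2 > 0" "half_disc x r1 n \<subseteq> S" "half_disc x r2 n \<subseteq> T"
    unfolding on_side_def by auto
  have h: "half_disc x (min r1 r2) n \<subseteq> S" "half_disc x (min r1 r2) n \<subseteq> T"
    using r half_disc_mono[of "min r1 r2" r1 x n] half_disc_mono[of "min r1 r2" r2 x n] by auto
  have "half_disc x (min r1 r2) n \<subseteq> interior S" "half_disc x (min r1 r2) n \<subseteq> interior T"
    using h by (simp_all add: interior_maximal)
  moreover have "half_disc x (min r1 r2) n \<noteq> {}" using half_disc_nonempty[of n "min r1 r2" x] normal_to_norm[OF x] r by simp
  ultimately show False using ST by blast
qed

text \<open>A half-disc covered by the union meets one of the sets, and then lies in it by the dichotomy.\<close>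

lemma on_side_UN_iff:
  assumes x: "normal_to x n" and S: "\<And>m. m \<in> J \<Longrightarrow> regular (S m)"
  shows "on_side (\<Union>m\<in>J. S m) x n \<longleftrightarrow> (\<exists>m\<in>J. on_side (S m) x n)"
proof
  assume "on_side (\<Union>m\<in>J. S m) x n"
  then obtain r1 where r1: "r1 > 0" "half_disc x r1 n \<subseteq> (\<Union>m\<in>J. S m)" unfolding on_side_def by auto
  obtain r2 where r2: "r2 > 0"
    "\<forall>S n'. regular S \<longrightarrow> n' = n \<or> n' = - n \<longrightarrow> half_disc x r2 n' \<subseteq> S \<or> half_disc x r2 n' \<inter> S = {}"
    using half_disc_dichotomy[OF x] by blast
  have "half_disc x (min r1 r2) n \<noteq> {}"
    using half_disc_nonempty[of n "min r1 r2" x] normal_to_norm[OF x] r1 r2(1) by simp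
  then obtain z where z: "z \<in> half_disc x (min r1 r2) n" by blast
  then have "z \<in> half_disc x r1 n" "z \<in> half_disc x r2 n" by (auto simp: half_disc_def)
  then obtain m where "m \<in> J" "z \<in> S m" "z \<in> half_disc x r2 n" using r1 by blast
  then have "half_disc x r2 n \<subseteq> S m" using r2(2)[rule_format, OF S, of m n] by blast
  then show "\<exists>m\<in>J. on_side (S m) x n" using r2(1) \<open>m \<in> J\<close> unfolding on_side_def by blast
qed (auto simp: on_side_def)

end

lemma has_normal_frontier:
  assumes "has_normal S x n" shows "x \<in> frontier S"
proof -
  obtain r where r: "r > 0" "S \<inter> ball x r = {y \<in> ball x r. inner (y - x) n \<le> 0}" and n: "norm n = 1"
    using assms unfolding has_normal_def by blast
  have "x \<in> {y \<in> ball x r. inner (y - x) n \<le> 0}" using r(1) by simp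
  then have "x \<in> S" using r(2) by blast
  moreover have "x \<notin> interior S"
  proof
    assume "x \<in> interior S"
    then obtain e where e: "e > 0" "ball x e \<subseteq> S" unfolding mem_interior by auto
    define z where "z = x + (min e r / 2) *\<^sub>R n"
    have p: "min e r > 0" using e r by simp
    have "dist x z = min e r / 2" using n p by (simp add: z_def dist_norm)
    then have z: "z \<in> ball x e" "z \<in> ball x r" using p by auto
    then have "z \<in> S \<inter> ball x r" using e by blast
    then have "inner (z - x) n \<le> 0" unfolding r(2) by simp
    moreover have "inner (z - x) n > 0" using n p by (simp add: z_def norm_eq_1)
    ultimately show False by simp
  qed
  ultimately show ?thesis using closure_subset by (auto simp: frontier_def)
qed

text \<open>The frontier of \<open>S\<close> inside a ball in which \<open>S\<close> is a half-ball with normal \<open>n\<close> is flat, so all its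
points have normal \<open>n\<close>. Therefore the points with normal \<open>n\<close> form a relatively open part of the
frontier.\<close>

lemma borel_has_normal:
  fixes S :: "'a::euclidean_space set"
  assumes "closed S" shows "{x. has_normal S x n} \<in> sets borel"
proof (cases "norm n = 1")
  case True
  define W where "W = \<Union>{ball x r | x r. r > 0 \<and> S \<inter> ball x r = {y \<in> ball x r. inner (y - x) n \<le> 0}}"
  have "{x. has_normal S x n} = frontier S \<inter> W"
  proof (intro equalityI subsetI)
    fix x assume "x \<in> {x. has_normal S x n}"
    then have x: "has_normal S x n" by simp
    then obtain r where r: "r > 0" "S \<inter> ball x r = {y \<in> ball x r. inner (y - x) n \<le> 0}"
      unfolding has_normal_def by blast
    then have "ball x r \<subseteq> W" unfolding W_def by blast
    moreover have "x \<in> ball x r" using r(1) by simp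
    ultimately show "x \<in> frontier S \<inter> W" using has_normal_frontier[OF x] by blast
  next
    fix y assume "y \<in> frontier S \<inter> W"
    then obtain x r where y: "y \<in> frontier S" "y \<in> ball x r"
      and r: "r > 0" "S \<inter> ball x r = {y \<in> ball x r. inner (y - x) n \<le> 0}" unfolding W_def by blast
    have "y \<in> S" using y assms by (simp add: frontier_def)
    then have "inner (y - x) n \<le> 0" using r(2) y by blast
    moreover have "\<not> inner (y - x) n < 0"
    proof
      assume *: "inner (y - x) n < 0"
      have "half_disc x r (- n) \<subseteq> S \<inter> ball x r" unfolding r(2) by (auto simp: half_disc_def)
      then have "half_disc x r (- n) \<subseteq> interior S" by (intro interior_maximal) auto
      moreover have "y \<in> half_disc x r (- n)" using * y by (simp add: half_disc_def)
      ultimately show False using y by (auto simp: frontier_def)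
    qed
    ultimately have 0: "inner (y - x) n = 0" by simp
    obtain e where e: "e > 0" "ball y e \<subseteq> ball x r" using y(2) openE[of "ball x r" y] by auto
    have "inner (z - y) n = inner (z - x) n" for z using 0 by (simp add: inner_diff_left)
    then have "{z \<in> ball y e. inner (z - y) n \<le> 0} = ball y e \<inter> {z \<in> ball x r. inner (z - x) n \<le> 0}"
      using e(2) by auto
    then have "S \<inter> ball y e = {z \<in> ball y e. inner (z - y) n \<le> 0}" using r(2)[symmetric] e(2) by auto
    then show "y \<in> {x. has_normal S x n}" using e True unfolding has_normal_def by blast
  qed
  moreover have "open W" unfolding W_def by (rule open_Union) auto
  ultimately show ?thesis by (simp add: borel_open borel_closed)
qed (simp add: has_normal_def)

context line_arrangement begin

definition normals :: "point set" where "normals = nrm ` I \<union> (\<lambda>i. - nrm i) ` I"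

text \<open>A measurable stand-in for the outward normal, which is \<open>0\<close> off the frontier. It agrees with
\<open>outward_normal\<close> at all frontier points except possibly the vertices, where the value of
\<open>outward_normal\<close> is arbitrary.\<close>

definition bnormal :: "point set \<Rightarrow> point \<Rightarrow> point" where
  "bnormal S x = (\<Sum>n\<in>normals. indicator {x. has_normal S x n} x *\<^sub>R n)"

lemma finite_normals: "finite normals" using finite_I by (simp add: normals_def)

lemma bnormal_outside: "x \<notin> frontier S \<Longrightarrow> bnormal S x = 0"
  unfolding bnormal_def using has_normal_frontier by (intro sum.neutral) (auto simp: indicator_def)

lemma borel_bnormal [measurable]: "closed S \<Longrightarrow> bnormal S \<in> borel_measurable borel"
  unfolding bnormal_def[abs_def] using borel_has_normal[of S]
  by (intro borel_measurable_sum borel_measurable_scaleR borel_measurable_indicator) auto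

lemma bnormal_eqI:
  assumes "has_normal S x n" "n \<in> normals" shows "bnormal S x = n"
proof -
  have "bnormal S x = (\<Sum>m\<in>normals. if m = n then n else 0)"
    unfolding bnormal_def using assms(1) has_normal_unique
    by (intro sum.cong) (auto simp: indicator_def)
  then show ?thesis using assms finite_normals by simp
qed

lemma norm_bnormal_le: "norm (bnormal S x) \<le> 1"
proof (cases "\<exists>n\<in>normals. has_normal S x n")
  case True
  then obtain n where n: "n \<in> normals" "has_normal S x n" by blast
  then have "norm n = 1" by (simp add: has_normal_def)
  then show ?thesis using bnormal_eqI[OF n(2,1)] by simp
next
  case False then show ?thesis by (simp add: bnormal_def)
qed

lemma normal_to_normals: "normal_to x n \<Longrightarrow> n \<in> normals"
  unfolding normal_to_def normals_def by auto

lemma frontier_normal_to: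
  assumes "regular S" "x \<in> frontier S" "x \<notin> vertices"
  obtains n where "normal_to x n" "on_side S x (- n)" "\<not> on_side S x n"
proof -
  obtain i where "i \<in> I" "x \<in> line i" using assms unfolding regular_def by blast
  then have n: "normal_to x (nrm i)" using assms normal_to_ex by blast
  then show ?thesis
    using frontier_iff_on_side[OF n assms(1)] assms(2) that[of "nrm i"] that[of "- nrm i"] normal_to_uminus[OF n]
    by auto
qed

lemma bnormal_on_side:
  assumes "normal_to x n" "regular S" "on_side S x (- n)" "\<not> on_side S x n"
  shows "bnormal S x = n"
  using bnormal_eqI[OF has_normal_on_side[OF assms]] normal_to_normals[OF assms(1)] by simp

lemma bnormal_generic:
  assumes "regular S" "x \<notin> vertices"
  shows "bnormal S x = indicator (frontier S) x *\<^sub>R outward_normal S x"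
proof (cases "x \<in> frontier S")
  case True
  then obtain n where n: "normal_to x n" "on_side S x (- n)" "\<not> on_side S x n"
    using frontier_normal_to assms by blast
  then show ?thesis using True bnormal_on_side outward_normal_on_side assms by simp
qed (simp add: bnormal_outside)

lemma continuous_par [continuous_intros]: "continuous_on A (par i)"
  unfolding par_def by (intro continuous_intros)

lemma borel_par [measurable]: "par i \<in> borel_measurable borel"
  using continuous_par by (rule borel_measurable_continuous_onI)

section \<open>The divergence theorem\<close>

lemma integrable_along_line:
  fixes f :: "point \<Rightarrow> real"
  assumes i: "i \<in> I" and f: "f \<in> borel_measurable borel" "\<And>x. \<bar>f x\<bar> \<le> B"
    and K: "bounded K" "\<And>x. x \<notin> K \<Longrightarrow> f x = 0"
  shows "integrable lborel (\<lambda>s. f (par i s))"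
proof -
  obtain R0 where R0: "\<And>x. x \<in> K \<Longrightarrow> norm x \<le> R0" using K(1) unfolding bounded_iff by auto
  define R where "R = R0 + norm (a i)"
  have B: "B \<ge> 0" using f(2)[of 0] by linarith
  show ?thesis
  proof (rule Bochner_Integration.integrable_bound)
    show "integrable lborel (\<lambda>s. B * indicator {- R..R} s :: real)"
      using emeasure_compact_finite[of "{- R..R}"] by (intro integrable_mult_right integrable_real_indicator) auto
    show "AE s in lborel. norm (f (par i s)) \<le> norm (B * indicator {- R..R} s :: real)"
    proof (rule AE_I2)
      fix s :: real
      have "f (par i s) = 0" if "\<not> \<bar>s\<bar> \<le> R"
      proof (rule K(2))
        have "norm (s *\<^sub>R u i) \<le> norm (par i s) + norm (a i)"
          using norm_triangle_ineq4[of "par i s" "a i"] by (simp add: par_def)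
        then have "R0 < norm (par i s)" using that unit[OF i] by (simp add: R_def)
        then show "par i s \<notin> K" using R0[of "par i s"] by auto
      qed
      then show "norm (f (par i s)) \<le> norm (B * indicator {- R..R} s :: real)"
        using f(2)[of "par i s"] B by (cases "\<bar>s\<bar> \<le> R") (auto simp: indicator_def)
    qed
  qed (use f(1) in measurable)
qed

lemma right_inI:
  assumes "on_side S (x, y) n" "fst n > 0" shows "right_in {x. (x, y) \<in> S} x"
proof -
  obtain r where r: "r > 0" "half_disc (x, y) r n \<subseteq> S" using assms unfolding on_side_def by blast
  have "(x', y) \<in> half_disc (x, y) r n" if "x < x'" "x' < x + r" for x'
    using that assms(2) by (simp add: half_disc_def dist_prod_def dist_real_def inner_prod_def)
  then show ?thesis unfolding right_in_def using r by (intro exI[of _ r]) auto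
qed

lemma left_inI:
  assumes "on_side S (x, y) n" "fst n < 0" shows "left_in {x. (x, y) \<in> S} x"
proof -
  obtain r where r: "r > 0" "half_disc (x, y) r n \<subseteq> S" using assms unfolding on_side_def by blast
  have "(x', y) \<in> half_disc (x, y) r n" if "x' < x" "x - r < x'" for x'
    using that assms(2) by (simp add: half_disc_def dist_prod_def dist_real_def inner_prod_def mult_neg_neg)
  then show ?thesis unfolding left_in_def using r by (intro exI[of _ r]) auto
qed

lemma right_in_disjoint:
  assumes "right_in T x" "right_in T' x" shows "T \<inter> T' \<noteq> {}"
proof -
  obtain r r' where r: "r > 0" "{x<..<x+r} \<subseteq> T" "r' > 0" "{x<..<x+r'} \<subseteq> T'"
    using assms unfolding right_in_def by auto
  then have "x + min r r' / 2 \<in> {x<..<x+r}" "x + min r r' / 2 \<in> {x<..<x+r'}" by auto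
  then show ?thesis using r by blast
qed

lemma left_in_disjoint:
  assumes "left_in T x" "left_in T' x" shows "T \<inter> T' \<noteq> {}"
proof -
  obtain r r' where r: "r > 0" "{x-r<..<x} \<subseteq> T" "r' > 0" "{x-r'<..<x} \<subseteq> T'"
    using assms unfolding left_in_def by auto
  then have "x - min r r' / 2 \<in> {x-r<..<x}" "x - min r r' / 2 \<in> {x-r'<..<x}" by auto
  then show ?thesis using r by blast
qed

lemma right_in_iff:
  assumes n: "normal_to (x, y) n" "fst n > 0" and S: "regular S"
  shows "right_in {x. (x, y) \<in> S} x \<longleftrightarrow> on_side S (x, y) n"
proof
  assume r: "right_in {x. (x, y) \<in> S} x"
  show "on_side S (x, y) n"
  proof (rule ccontr)
    assume "\<not> on_side S (x, y) n"
    then obtain e where "e > 0" "half_disc (x, y) e n \<inter> S = {}" using not_on_side[OF n(1) S] by blast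
    then have "on_side (- S) (x, y) n" unfolding on_side_def by blast
    from right_in_disjoint[OF r right_inI[OF this n(2)]] show False by auto
  qed
qed (use n right_inI in blast)

lemma left_in_iff:
  assumes n: "normal_to (x, y) n" "fst n < 0" and S: "regular S"
  shows "left_in {x. (x, y) \<in> S} x \<longleftrightarrow> on_side S (x, y) n"
proof
  assume r: "left_in {x. (x, y) \<in> S} x"
  show "on_side S (x, y) n"
  proof (rule ccontr)
    assume "\<not> on_side S (x, y) n"
    then obtain e where "e > 0" "half_disc (x, y) e n \<inter> S = {}" using not_on_side[OF n(1) S] by blast
    then have "on_side (- S) (x, y) n" unfolding on_side_def by blast
    from left_in_disjoint[OF r left_inI[OF this n(2)]] show False by auto
  qed
qed (use n left_inI in blast)

text \<open>Crossing the line to the right, a region is left exactly where its normal points to the right.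
Dividing by \<open>fst n\<close> normalises the first component of the normal to \<open>1\<close> or \<open>- 1\<close>.\<close>

lemma jump_eq_bnormal:
  assumes n: "normal_to (x, y) n" "fst n > 0" and S: "regular S"
  shows "of_bool (left_in {x. (x, y) \<in> S} x) - of_bool (right_in {x. (x, y) \<in> S} x)
    = fst (bnormal S (x, y)) / fst n"
proof -
  let ?p = "(x, y)"
  have R: "right_in {x. (x, y) \<in> S} x \<longleftrightarrow> on_side S ?p n" using right_in_iff[OF n S] .
  have L: "left_in {x. (x, y) \<in> S} x \<longleftrightarrow> on_side S ?p (- n)"
    using left_in_iff[OF normal_to_uminus[OF n(1)] _ S] n(2) by simp
  consider "on_side S ?p n = on_side S ?p (- n)" | "on_side S ?p (- n)" "\<not> on_side S ?p n"
    | "on_side S ?p n" "\<not> on_side S ?p (- n)" by blast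
  then show ?thesis
  proof cases
    case 1
    then have "bnormal S ?p = 0" using frontier_iff_on_side[OF n(1) S] bnormal_outside by blast
    then show ?thesis using R L 1 by simp
  next
    case 2
    then show ?thesis using R L bnormal_on_side[OF n(1) S] n(2) by simp
  next
    case 3
    then show ?thesis using R L bnormal_on_side[OF normal_to_uminus[OF n(1)] S] n(2) by simp
  qed
qed

lemma frontier_slice:
  assumes "closed S" "x \<in> frontier {x. (x, y) \<in> S}"
  shows "(x, y) \<in> frontier (S :: point set)"
proof -
  have c: "continuous_on UNIV (\<lambda>x::real. (x, y))" by (intro continuous_intros)
  have "closed {x. (x, y) \<in> S}"
    using continuous_closed_vimage[OF assms(1), of "\<lambda>x. (x, y)"] by (auto simp: vimage_def intro!: continuous_intros)
  then have x: "(x, y) \<in> S" "x \<notin> interior {x. (x, y) \<in> S}" using assms(2) by (auto simp: frontier_def)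
  have "open {x. (x, y) \<in> interior S}"
    using open_vimage[OF open_interior c] by (simp add: vimage_def)
  then have "{x. (x, y) \<in> interior S} \<subseteq> interior {x. (x, y) \<in> S}"
    using interior_subset by (intro interior_maximal) auto
  then show ?thesis using x assms(1) by (auto simp: frontier_def)
qed

text \<open>The slice at height \<open>y\<close> meets each non-horizontal line in one point, and the frontier of the slice
consists of such points. Excluding the heights of vertices makes these points distinct and generic;
excluding the heights of horizontal lines removes slices that run inside a frontier.\<close>

lemma slice_integral:
  fixes g gx :: "point \<Rightarrow> real"
  assumes S: "regular S"
    and g: "\<And>x y. ((\<lambda>x. g (x, y)) has_real_derivative gx (x, y)) (at x)" and gx: "continuous_on UNIV gx"
    and y: "y \<notin> snd ` vertices" "\<And>i. i \<in> I \<Longrightarrow> snd (u i) = 0 \<Longrightarrow> y \<noteq> snd (a i)"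
  shows "(\<integral>x. indicator S (x, y) * gx (x, y) \<partial>lborel) =
    (\<Sum>i | i \<in> I \<and> snd (u i) \<noteq> 0. (g (par i ((y - snd (a i)) / snd (u i))) *
       fst (bnormal S (par i ((y - snd (a i)) / snd (u i))))) / \<bar>snd (u i)\<bar>)"
proof -
  define J where "J = {i \<in> I. snd (u i) \<noteq> 0}"
  define h where "h i = fst (par i ((y - snd (a i)) / snd (u i)))" for i
  have p: "par i ((y - snd (a i)) / snd (u i)) = (h i, y)" if "i \<in> J" for i
    using that by (intro prod_eqI) (simp_all add: h_def par_def J_def)
  have on: "(h i, y) \<in> line i" if "i \<in> J" for i
    unfolding line_def p[OF that, symmetric] by blast
  have nv: "(x, y) \<notin> vertices" for x using y(1) by force
  have inj: "inj_on h J"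
  proof (rule inj_onI, rule ccontr)
    fix i j assume "i \<in> J" "j \<in> J" "h i = h j" "i \<noteq> j"
    then have "(h i, y) \<in> vertices" using on[of i] on[of j] unfolding vertices_def J_def by force
    then show False using nv by blast
  qed
  let ?T = "{x. (x, y) \<in> S}"
  have "bounded ?T"
  proof -
    have "?T \<subseteq> fst ` S" by force
    moreover have "bounded (fst ` S)" using S unfolding regular_def
      by (intro compact_imp_bounded compact_continuous_image continuous_intros) auto
    ultimately show ?thesis using bounded_subset by blast
  qed
  moreover have "finite (h ` J)" using finite_I by (simp add: J_def)
  moreover have "frontier ?T \<subseteq> h ` J"
  proof
    fix x assume "x \<in> frontier ?T"
    then have "(x, y) \<in> frontier S" using frontier_slice regular_closed[OF S] by blast
    then obtain i where i: "i \<in> I" "(x, y) \<in> line i" using S unfolding regular_def by blast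
    then obtain s where "(x, y) = a i + s *\<^sub>R u i" by (auto simp: line_def par_def)
    then have s: "x = fst (a i) + s * fst (u i)" "y = snd (a i) + s * snd (u i)" by (auto simp: prod_eq_iff)
    then have "snd (u i) \<noteq> 0" using y(2)[OF i(1)] by auto
    then show "x \<in> h ` J" using i(1) s by (intro image_eqI[of _ _ i]) (auto simp: h_def J_def par_def)
  qed
  ultimately have "(\<integral>x. indicator ?T x * gx (x, y) \<partial>lborel) =
      (\<Sum>x\<in>h ` J. (of_bool (left_in ?T x) - of_bool (right_in ?T x)) * g (x, y))"
    using g by (intro integral_deriv_over_intervals)
      (auto intro!: continuous_on_compose2[OF gx] continuous_intros)
  also have "\<dots> = (\<Sum>i\<in>J. (of_bool (left_in ?T (h i)) - of_bool (right_in ?T (h i))) * g (h i, y))"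
    using inj by (simp add: sum.reindex)
  also have "\<dots> = (\<Sum>i\<in>J. (g (h i, y) * fst (bnormal S (h i, y))) / \<bar>snd (u i)\<bar>)"
  proof (rule sum.cong[OF refl])
    fix i assume i: "i \<in> J"
    \<comment> \<open>The unit normal of the line that points to the right.\<close>
    define n where "n = sgn (snd (u i)) *\<^sub>R nrm i"
    have "normal_to (h i, y) n"
      using i on[OF i] nv unfolding n_def normal_to_def J_def by (auto simp: sgn_if)
    moreover have "fst n = \<bar>snd (u i)\<bar>" using abs_sgn[of "snd (u i)"] by (simp add: n_def nrm_def mult.commute)
    moreover have "\<bar>snd (u i)\<bar> > 0" using i by (simp add: J_def)
    ultimately show "(of_bool (left_in ?T (h i)) - of_bool (right_in ?T (h i))) * g (h i, y)
      = (g (h i, y) * fst (bnormal S (h i, y))) / \<bar>snd (u i)\<bar>"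
      using jump_eq_bnormal[of "h i" y n S] S by simp
  qed
  finally show ?thesis
    using p by (auto simp: J_def[symmetric] indicator_def intro!: sum.cong Bochner_Integration.integral_cong)
qed

text \<open>Integrating the slices over the height \<open>y\<close> and substituting the arc length \<open>s\<close> for \<open>y\<close> on each line
cancels the factor \<open>1 / \<bar>snd (u i)\<bar>\<close>. Horizontal lines, which the slices do not see, carry a normal
with vanishing first component.\<close>

theorem divergence_fst:
  fixes g gx :: "point \<Rightarrow> real"
  assumes S: "regular S"
    and g: "\<And>x y. ((\<lambda>x. g (x, y)) has_real_derivative gx (x, y)) (at x)"
    and cont: "continuous_on UNIV g" "continuous_on UNIV gx"
  shows "(\<integral>z. indicator S z * gx z \<partial>lborel) =
    (\<Sum>i\<in>I. \<integral>s. g (par i s) * fst (bnormal S (par i s)) \<partial>lborel)"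
proof -
  define J where "J = {i \<in> I. snd (u i) \<noteq> 0}"
  define h where "h i s = g (par i s) * fst (bnormal S (par i s))" for i s
  have finJ: "finite J" using finite_I by (simp add: J_def)
  have cS: "compact S" using S by (simp add: regular_def)
  have int_h: "integrable lborel (h i)" if "i \<in> I" for i
  proof -
    have "compact (g ` S)" using cont(1) cS continuous_on_subset by (intro compact_continuous_image) auto
    then obtain B where B: "\<And>x. x \<in> S \<Longrightarrow> \<bar>g x\<bar> \<le> B"
      using compact_imp_bounded[of "g ` S"] unfolding bounded_real by auto
    have out: "bnormal S x = 0" if "x \<notin> S" for x
      using that bnormal_outside frontier_subset_closed[OF regular_closed[OF S]] by blast
    have "integrable lborel (\<lambda>s. (\<lambda>x. g x * fst (bnormal S x)) (par i s))"
    proof (rule integrable_along_line[OF that, where B = "\<bar>B\<bar>" and K = S])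
      have gm: "g \<in> borel_measurable borel" using cont(1) by (rule borel_measurable_continuous_onI)
      have [measurable]: "bnormal S \<in> borel_measurable borel" using borel_bnormal regular_closed[OF S] by simp
      have "(\<lambda>x. fst (bnormal S x)) \<in> borel_measurable borel"
        by (intro borel_measurable_continuous_on[where f=fst]) (auto intro: continuous_intros)
      then show "(\<lambda>x. g x * fst (bnormal S x)) \<in> borel_measurable borel"
        using gm by (rule borel_measurable_times[rotated])
      fix x
      show "\<bar>g x * fst (bnormal S x)\<bar> \<le> \<bar>B\<bar>"
      proof (cases "x \<in> S")
        case True
        have "\<bar>fst (bnormal S x)\<bar> \<le> 1" using norm_bnormal_le[of S x] norm_fst_le[of "fst (bnormal S x)" "snd (bnormal S x)"] by simp
        then have "\<bar>g x\<bar> * \<bar>fst (bnormal S x)\<bar> \<le> \<bar>B\<bar> * 1" using B[OF True] by (intro mult_mono) auto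
        then show ?thesis by (simp add: abs_mult)
      qed (simp add: out)
      show "g x * fst (bnormal S x) = 0" if "x \<notin> S" using out[OF that] by simp
    qed (use cS compact_imp_bounded in auto)
    then show ?thesis by (simp add: h_def[abs_def])
  qed
  have int_S: "integrable lborel (\<lambda>z. indicator S z * gx z)"
    using borel_integrable_compact[OF cS continuous_on_subset[OF cont(2)]] by (simp add: mult.commute if_distrib indicator_def cong: if_cong)
  have "(\<integral>z. indicator S z * gx z \<partial>lborel) = (\<integral>y. (\<integral>x. indicator S (x, y) * gx (x, y) \<partial>lborel) \<partial>lborel)"
    using lborel_pair.integral_snd[of "\<lambda>x y. indicator S (x, y) * gx (x, y)"] int_S
    by (simp add: lborel_prod case_prod_unfold)
  also have "\<dots> = (\<integral>y. (\<Sum>i\<in>J. h i ((y - snd (a i)) / snd (u i)) / \<bar>snd (u i)\<bar>) \<partial>lborel)"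
  proof (rule integral_discrete_difference[where X = "snd ` vertices \<union> (\<lambda>i. snd (a i)) ` I"])
    show "countable (snd ` vertices \<union> (\<lambda>i. snd (a i)) ` I)"
      using finite_vertices finite_I by (intro countable_finite) auto
    fix y assume "y \<notin> snd ` vertices \<union> (\<lambda>i. snd (a i)) ` I"
    then show "(\<integral>x. indicator S (x, y) * gx (x, y) \<partial>lborel) = (\<Sum>i\<in>J. h i ((y - snd (a i)) / snd (u i)) / \<bar>snd (u i)\<bar>)"
      unfolding J_def h_def by (intro slice_integral[OF S g cont(2)]) auto
  qed auto
  also have "\<dots> = (\<Sum>i\<in>J. \<integral>y. h i ((y - snd (a i)) / snd (u i)) / \<bar>snd (u i)\<bar> \<partial>lborel)"
  proof (rule Bochner_Integration.integral_sum)
    fix i assume i: "i \<in> J"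
    have "integrable lborel (\<lambda>y. h i (- snd (a i) / snd (u i) + (1 / snd (u i)) * y))"
      using i int_h by (intro lborel_integrable_real_affine) (auto simp: J_def)
    then show "integrable lborel (\<lambda>y. h i ((y - snd (a i)) / snd (u i)) / \<bar>snd (u i)\<bar>)"
      by (simp add: diff_divide_distrib)
  qed
  also have "\<dots> = (\<Sum>i\<in>J. \<integral>s. h i s \<partial>lborel)"
  proof (rule sum.cong[OF refl])
    fix i assume i: "i \<in> J"
    then have "1 / snd (u i) \<noteq> 0" by (simp add: J_def)
    from lborel_integral_real_affine[OF this, of "h i" "- snd (a i) / snd (u i)"]
    show "(\<integral>y. h i ((y - snd (a i)) / snd (u i)) / \<bar>snd (u i)\<bar> \<partial>lborel) = (\<integral>s. h i s \<partial>lborel)"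
      by (simp add: diff_divide_distrib)
  qed
  also have "\<dots> = (\<Sum>i\<in>I. \<integral>s. h i s \<partial>lborel)"
  proof (rule sum.mono_neutral_left)
    show "\<forall>i\<in>I - J. (\<integral>s. h i s \<partial>lborel) = 0"
    proof
      fix i assume i: "i \<in> I - J"
      then have iI: "i \<in> I" and i0: "snd (u i) = 0" by (auto simp: J_def)
      have "(\<integral>s. h i s \<partial>lborel) = (\<integral>s. 0 \<partial>(lborel :: real measure))"
      proof (rule integral_discrete_difference[where X = "par i -` vertices"])
        show "countable (par i -` vertices)"
          using finite_vertices inj_par[OF iI] by (intro countable_finite finite_vimageI)
        fix s assume "s \<notin> par i -` vertices"
        then have s: "par i s \<notin> vertices" by simp
        have n: "normal_to (par i s) (nrm i)" using normal_to_ex[OF s iI] by (simp add: line_def)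
        have "fst (bnormal S (par i s)) = 0"
        proof (cases "par i s \<in> frontier S")
          case True
          then obtain m where m: "normal_to (par i s) m" "on_side S (par i s) (- m)" "\<not> on_side S (par i s) m"
            using frontier_normal_to S s by blast
          then have "bnormal S (par i s) = nrm i \<or> bnormal S (par i s) = - nrm i"
            using bnormal_on_side[OF m(1) S m(2,3)] normal_to_exhaust[OF n m(1)] by simp
          then show ?thesis using i0 by (auto simp: nrm_def)
        qed (simp add: bnormal_outside)
        then show "h i s = 0" by (simp add: h_def)
      qed auto
      then show "(\<integral>s. h i s \<partial>lborel) = 0" by simp
    qed
  qed (use finite_I in \<open>auto simp: J_def\<close>)
  finally show ?thesis by (simp add: h_def)
qed

end

text \<open>The statement for the second component is obtained by reflecting the plane in its diagonal, which
maps regular sets of an arrangement to those of the reflected arrangement.\<close>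

abbreviation swap :: "point \<Rightarrow> point" where "swap \<equiv> prod.swap"

lemma linear_swap: "linear swap"
  by (rule linearI) (auto simp: prod_eq_iff)

lemma inner_swap [simp]: "inner (swap x) (swap y) = inner x (y::point)"
  by (simp add: inner_prod_def)

lemma norm_swap [simp]: "norm (swap x) = norm x"
  by (simp add: norm_eq_sqrt_inner)

lemma swap_diff: "swap x - swap y = swap (x - y)" for x y :: point
  by (simp add: prod_eq_iff)

lemma swap_ball: "swap ` ball x r = ball (swap x) r"
proof (intro equalityI subsetI)
  fix y assume "y \<in> ball (swap x) r"
  then have "swap y \<in> ball x r" using norm_swap[of "x - swap y"] by (simp add: dist_norm swap_diff[symmetric])
  then show "y \<in> swap ` ball x r" using imageI[of "swap y" "ball x r" swap] by simp
qed (auto simp: dist_norm swap_diff simp del: swap_simp)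

lemma image_swap_iff: "y \<in> swap ` A \<longleftrightarrow> swap y \<in> A"
  by (metis image_iff swap_swap)

lemma has_normal_swap: "has_normal (swap ` S) (swap x) (swap n) \<longleftrightarrow> has_normal S x n"
proof -
  have "swap ` S \<inter> ball (swap x) r = {y \<in> ball (swap x) r. inner (y - swap x) (swap n) \<le> 0} \<longleftrightarrow>
    S \<inter> ball x r = {y \<in> ball x r. inner (y - x) n \<le> 0}" for r
  proof -
    have "swap ` S \<inter> ball (swap x) r = swap ` (S \<inter> ball x r)"
      by (simp add: swap_ball[symmetric] image_Int[OF inj_swap])
    moreover have "{y \<in> ball (swap x) r. inner (y - swap x) (swap n) \<le> 0} =
        swap ` {y \<in> ball x r. inner (y - x) n \<le> 0}"
    proof (rule Set.set_eqI)
      fix y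
      have "inner (y - swap x) (swap n) = inner (swap y - x) n"
        using inner_swap[of "swap y - x" n] by (simp add: swap_diff[symmetric])
      moreover have "y \<in> ball (swap x) r \<longleftrightarrow> swap y \<in> ball x r"
        using image_swap_iff[of y "ball x r"] by (simp add: swap_ball)
      ultimately show "y \<in> {y \<in> ball (swap x) r. inner (y - swap x) (swap n) \<le> 0} \<longleftrightarrow>
          y \<in> swap ` {y \<in> ball x r. inner (y - x) n \<le> 0}"
        by (simp add: image_swap_iff)
    qed
    ultimately show ?thesis by (simp add: inj_image_eq_iff[OF inj_swap])
  qed
  then show ?thesis unfolding has_normal_def by simp
qed

lemma integral_swap:
  fixes f :: "point \<Rightarrow> real"
  assumes "f \<in> borel_measurable borel"
  shows "(\<integral>z. f (swap z) \<partial>lborel) = (\<integral>z. f z \<partial>lborel)"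
proof -
  have "f \<in> borel_measurable (lborel \<Otimes>\<^sub>M lborel)" using assms by (simp add: lborel_prod)
  from lborel_pair.integral_product_swap[OF this] show ?thesis
    by (simp add: lborel_prod case_prod_unfold prod.swap_def)
qed

context line_arrangement begin

theorem divergence_snd:
  fixes g gy :: "point \<Rightarrow> real"
  assumes S: "regular S"
    and g: "\<And>x y. ((\<lambda>y. g (x, y)) has_real_derivative gy (x, y)) (at y)"
    and cont: "continuous_on UNIV g" "continuous_on UNIV gy"
  shows "(\<integral>z. indicator S z * gy z \<partial>lborel) =
    (\<Sum>i\<in>I. \<integral>s. g (par i s) * snd (bnormal S (par i s)) \<partial>lborel)"
proof -
  interpret SW: line_arrangement I "\<lambda>i. swap (a i)" "\<lambda>i. swap (u i)"
  proof
    fix i j assume ij: "i \<in> I" "j \<in> I"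
      "range (\<lambda>s. swap (a i) + s *\<^sub>R swap (u i)) = range (\<lambda>s. swap (a j) + s *\<^sub>R swap (u j))"
    have *: "(\<lambda>s. a k + s *\<^sub>R u k) = swap \<circ> (\<lambda>s. swap (a k) + s *\<^sub>R swap (u k))" for k
      by (auto simp: fun_eq_iff prod_eq_iff)
    have "range (\<lambda>s. a i + s *\<^sub>R u i) = range (\<lambda>s. a j + s *\<^sub>R u j)"
      unfolding *[of i] *[of j] image_comp[symmetric] ij(3) by simp
    then show "i = j" using distinct_lines ij by blast
  qed (use finite_I unit in auto)
  have par: "SW.par i s = swap (par i s)" for i s
    by (simp add: SW.par_def par_def prod_eq_iff)
  have line: "SW.line i = swap ` line i" for i
    unfolding SW.line_def line_def by (auto simp: par image_iff)
  have S': "SW.regular (swap ` S)"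
  proof -
    have "continuous_on S swap"
      using linear_swap by (simp add: linear_continuous_on linear_conv_bounded_linear)
    then have "compact (swap ` S)" using S unfolding regular_def
      by (intro compact_continuous_image) auto
    moreover have "closure (interior (swap ` S)) = swap ` S"
      using S unfolding regular_def
      by (simp add: interior_injective_linear_image[OF linear_swap inj_swap]
        closure_injective_linear_image[OF linear_swap inj_swap, symmetric])
    moreover have "frontier (swap ` S) = swap ` frontier S"
      by (simp add: frontier_def interior_injective_linear_image[OF linear_swap inj_swap]
        closure_injective_linear_image[OF linear_swap inj_swap, symmetric] image_set_diff[OF inj_swap])
    then have "frontier (swap ` S) \<subseteq> (\<Union>i\<in>I. SW.line i)"
      using S unfolding regular_def line by blast
    ultimately show ?thesis unfolding SW.regular_def by simp
  qed
  have normals: "SW.normals = swap ` normals"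
  proof -
    have "SW.nrm i = - swap (nrm i)" for i by (simp add: SW.nrm_def nrm_def prod_eq_iff)
    moreover have "swap (- x) = - swap x" for x :: point by (simp add: prod_eq_iff)
    ultimately show ?thesis unfolding SW.normals_def normals_def image_Un image_image by auto
  qed
  have bn: "SW.bnormal (swap ` S) (swap x) = swap (bnormal S x)" for x
  proof -
    have "SW.bnormal (swap ` S) (swap x) = (\<Sum>n\<in>normals. indicator {x. has_normal S x n} x *\<^sub>R swap n)"
      unfolding SW.bnormal_def normals
      by (subst sum.reindex[OF inj_on_subset[OF inj_swap subset_UNIV]])
        (simp add: has_normal_swap indicator_def o_def)
    also have "\<dots> = swap (bnormal S x)"
      unfolding bnormal_def linear_sum[OF linear_swap] linear_scale[OF linear_swap] ..
    finally show ?thesis .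
  qed
  have cs: "continuous_on UNIV swap" by (rule linear_continuous_on[OF linear_conv_bounded_linear[THEN iffD1, OF linear_swap]])
  have "(\<integral>z. indicator (swap ` S) z * gy (swap z) \<partial>lborel) =
      (\<Sum>i\<in>I. \<integral>s. g (swap (SW.par i s)) * fst (SW.bnormal (swap ` S) (SW.par i s)) \<partial>lborel)"
  proof (rule SW.divergence_fst[OF S'])
    show "((\<lambda>x. g (swap (x, y))) has_real_derivative gy (swap (x, y))) (at x)" for x y
      using g[where x=y and y=x] by simp
  qed (auto intro!: continuous_on_compose2[OF cont(1) cs] continuous_on_compose2[OF cont(2) cs])
  also have "(\<integral>z. indicator (swap ` S) z * gy (swap z) \<partial>lborel) = (\<integral>z. indicator S z * gy z \<partial>lborel)"
  proof -
    have m: "(\<lambda>z. indicator S z * gy z) \<in> borel_measurable borel"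
      using regular_closed[OF S] borel_measurable_continuous_onI[OF cont(2)] by (auto intro!: borel_measurable_times)
    show ?thesis using integral_swap[OF m] by (simp add: indicator_def image_swap_iff)
  qed
  finally show ?thesis by (simp add: par bn)
qed

end

section \<open>Arc length\<close>

lemma affine_hull_eq_line:
  fixes K :: "'a::euclidean_space set"
  assumes "affine K" "aff_dim K = 1" "x \<in> K" "y \<in> K" "x \<noteq> y"
  shows "affine hull {x, y} = K"
proof (rule affine_dim_equal)
  show "affine hull {x, y} \<subseteq> K" using assms hull_minimal[of "{x, y}" K affine] by simp
  show "aff_dim (affine hull {x, y}) = aff_dim K" using assms by (simp add: aff_dim_affine_hull)
qed (use assms in \<open>simp_all add: affine_affine_hull\<close>)

lemma line_param_ex:
  fixes L :: "point set"
  assumes "affine L" "aff_dim L = 1"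
  shows "\<exists>a u. norm u = 1 \<and> L = range (\<lambda>s. a + s *\<^sub>R u)"
proof -
  obtain x y where xy: "x \<in> L" "y \<in> L" "x \<noteq> y"
  proof -
    have "L \<noteq> {}" using assms(2) by auto
    then obtain x where x: "x \<in> L" by blast
    have "L \<noteq> {x}" using assms(2) by auto
    then show ?thesis using x that by blast
  qed
  have "affine hull {x, y} = L" using affine_hull_eq_line assms xy by blast
  then have L: "L = range (\<lambda>s. x + s *\<^sub>R (y - x))" by (simp add: affine_hull_2_alt)
  define d where "d = norm (y - x)"
  have d: "d > 0" using xy by (simp add: d_def)
  have "L = range (\<lambda>s. x + s *\<^sub>R ((1 / d) *\<^sub>R (y - x)))"
  proof -
    have "x + s *\<^sub>R (y - x) = x + (s * d) *\<^sub>R ((1 / d) *\<^sub>R (y - x))" for s using d by simp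
    then have "L \<subseteq> range (\<lambda>s. x + s *\<^sub>R ((1 / d) *\<^sub>R (y - x)))" unfolding L by blast
    moreover have "x + s *\<^sub>R ((1 / d) *\<^sub>R (y - x)) = x + (s / d) *\<^sub>R (y - x)" for s by simp
    then have "range (\<lambda>s. x + s *\<^sub>R ((1 / d) *\<^sub>R (y - x))) \<subseteq> L" unfolding L by blast
    ultimately show ?thesis by blast
  qed
  moreover have "norm ((1 / d) *\<^sub>R (y - x)) = 1" using d by (simp add: d_def)
  ultimately show ?thesis by blast
qed

lemma lines_eqI:
  fixes L L' :: "point set"
  assumes "affine L" "aff_dim L = 1" "affine L'" "aff_dim L' = 1" "infinite (L \<inter> L')"
  shows "L = L'"
proof -
  have "L \<inter> L' \<noteq> {}" using assms(5) by auto
  then obtain x where x: "x \<in> L \<inter> L'" by blast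
  have "L \<inter> L' \<noteq> {x}" using assms(5) by auto
  then obtain y where y: "y \<in> L \<inter> L'" "x \<noteq> y" using x by blast
  have "affine hull {x, y} = L" "affine hull {x, y} = L'"
    using x y assms affine_hull_eq_line[of L x y] affine_hull_eq_line[of L' x y] by simp_all
  then show ?thesis by simp
qed

locale line_family =
  fixes \<L> :: "point set set"
  assumes finite_lines: "finite \<L>" and lines: "L \<in> \<L> \<Longrightarrow> affine L \<and> aff_dim L = 1"
begin

text \<open>The parametrisation is the very choice made in \<open>line_measure\<close>, so that this measure is an image of
Lebesgue measure by definition.\<close>

definition chosen :: "point set \<Rightarrow> point \<times> point" where
  "chosen L = (SOME (a, u). norm u = 1 \<and> L = range (\<lambda>s. a + s *\<^sub>R u))"

lemma chosen:
  assumes "L \<in> \<L>"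
  shows "norm (snd (chosen L)) = 1" "L = range (\<lambda>s. fst (chosen L) + s *\<^sub>R snd (chosen L))"
proof -
  have "\<exists>p. (case p of (a, u) \<Rightarrow> norm u = 1 \<and> L = range (\<lambda>s. a + s *\<^sub>R u))"
    using line_param_ex lines[OF assms] by auto
  from someI_ex[OF this]
  have "case chosen L of (a, u) \<Rightarrow> norm u = 1 \<and> L = range (\<lambda>s. a + s *\<^sub>R u)"
    unfolding chosen_def .
  then show "norm (snd (chosen L)) = 1" "L = range (\<lambda>s. fst (chosen L) + s *\<^sub>R snd (chosen L))"
    by (simp_all add: case_prod_unfold)
qed

sublocale line_arrangement \<L> "\<lambda>L. fst (chosen L)" "\<lambda>L. snd (chosen L)"
proof
  fix L L' assume "L \<in> \<L>" "L' \<in> \<L>"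
    "range (\<lambda>s. fst (chosen L) + s *\<^sub>R snd (chosen L)) = range (\<lambda>s. fst (chosen L') + s *\<^sub>R snd (chosen L'))"
  then show "L = L'" using chosen(2) by metis
qed (use finite_lines chosen in auto)

lemma line_eq [simp]: "L \<in> \<L> \<Longrightarrow> line L = L"
  using chosen(2) unfolding line_def par_def by blast

lemma line_measure_eq: "line_measure L = distr lborel borel (par L)"
proof -
  have "line_measure L = (let (a, u) = chosen L in distr lborel borel (\<lambda>s. a + s *\<^sub>R u))"
    unfolding line_measure_def chosen_def ..
  then show ?thesis by (simp add: case_prod_unfold par_def[abs_def] Let_def)
qed

lemma sets_line_measure [simp]: "sets (line_measure L) = sets borel"
  by (simp add: line_measure_eq)

lemma borel_measurable_line_measure: "borel_measurable (line_measure L) = borel_measurable borel"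
  by (rule measurable_cong_sets) simp_all

lemma AE_line_measure:
  assumes "L \<in> \<L>" shows "AE x in line_measure L. x \<in> L"
proof -
  have "closed L" using closed_line[OF assms] assms by simp
  moreover have "par L s \<in> L" for s using assms line_eq[OF assms] unfolding line_def by blast
  ultimately show ?thesis unfolding line_measure_eq by (subst AE_distr_iff) auto
qed

lemma emeasure_line_measure_point:
  assumes "L \<in> \<L>" shows "emeasure (line_measure L) {x} = 0"
proof -
  have "finite (par L -` {x})" using inj_par[OF assms] by (intro finite_vimageI) auto
  then show ?thesis unfolding line_measure_eq
    by (subst emeasure_distr) (auto simp: emeasure_lborel_countable countable_finite)
qed

lemma AE_line_measure_finite:
  assumes "L \<in> \<L>" "finite X" shows "AE x in line_measure L. x \<notin> X"
proof (rule AE_not_in)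
  have "X = (\<Union>x\<in>X. {x})" by blast
  moreover have "(\<Union>x\<in>X. {x}) \<in> null_sets (line_measure L)"
    using assms emeasure_line_measure_point by (intro null_sets_UN') (auto simp: null_sets_def countable_finite)
  ultimately show "X \<in> null_sets (line_measure L)" by simp
qed

text \<open>The integral over all lines of the family. Writing boundary integrals over various sets as integrals
of this kind, with an indicator in the integrand, reduces identities between them to identities
between integrands outside the vertices.\<close>

definition arc_int :: "(point \<Rightarrow> real) \<Rightarrow> real" where
  "arc_int h = (\<Sum>L\<in>\<L>. integral\<^sup>L (line_measure L) h)"

definition arc_integrable :: "(point \<Rightarrow> real) \<Rightarrow> bool" where
  "arc_integrable h \<longleftrightarrow> (\<forall>L\<in>\<L>. integrable (line_measure L) h)"

lemma arc_int_add: "arc_integrable f \<Longrightarrow> arc_integrable g \<Longrightarrow> arc_int (\<lambda>x. f x + g x) = arc_int f + arc_int g"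
  unfolding arc_int_def arc_integrable_def by (simp add: sum.distrib)
lemma arc_int_diff: "arc_integrable f \<Longrightarrow> arc_integrable g \<Longrightarrow> arc_int (\<lambda>x. f x - g x) = arc_int f - arc_int g"
  unfolding arc_int_def arc_integrable_def by (simp add: sum_subtractf)
lemma arc_int_cmult: "arc_int (\<lambda>x. c * f x) = c * arc_int f"
  unfolding arc_int_def by (simp add: sum_distrib_left)
lemma arc_int_minus: "arc_int (\<lambda>x. - f x) = - arc_int f"
  unfolding arc_int_def by (simp add: sum_negf)
lemma arc_int_sum: "(\<And>j. j \<in> J \<Longrightarrow> arc_integrable (f j)) \<Longrightarrow> arc_int (\<lambda>x. \<Sum>j\<in>J. f j x) = (\<Sum>j\<in>J. arc_int (f j))"
  unfolding arc_int_def arc_integrable_def by (subst sum.swap) (auto intro!: sum.cong)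

lemma arc_integrable_diff: "arc_integrable f \<Longrightarrow> arc_integrable g \<Longrightarrow> arc_integrable (\<lambda>x. f x - g x)"
  unfolding arc_integrable_def by simp
lemma arc_int_cong:
  assumes "\<And>x. x \<notin> vertices \<Longrightarrow> f x = g x"
  shows "arc_int f = arc_int g" "arc_integrable f \<longleftrightarrow> arc_integrable g"
proof -
  have "integral\<^sup>L (line_measure L) f = integral\<^sup>L (line_measure L) g" if "L \<in> \<L>" for L
    by (rule integral_discrete_difference[where X = vertices])
      (auto simp: countable_finite finite_vertices emeasure_line_measure_point[OF that] assms)
  then show "arc_int f = arc_int g" unfolding arc_int_def by (intro sum.cong) auto
  have "integrable (line_measure L) f \<longleftrightarrow> integrable (line_measure L) g" if "L \<in> \<L>" for L
    by (rule integrable_discrete_difference[where X = vertices])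
      (auto simp: countable_finite finite_vertices emeasure_line_measure_point[OF that] assms)
  then show "arc_integrable f \<longleftrightarrow> arc_integrable g" unfolding arc_integrable_def by auto
qed

lemma arc_integrable_bounded:
  assumes "f \<in> borel_measurable borel" "\<And>x. \<bar>f x\<bar> \<le> B" "bounded K" "\<And>x. x \<notin> K \<Longrightarrow> f x = 0"
  shows "arc_integrable f"
  unfolding arc_integrable_def line_measure_eq
proof
  fix L assume "L \<in> \<L>"
  then show "integrable (distr lborel borel (par L)) f"
    using integrable_along_line[of L f B K] assms by (subst integrable_distr_eq) auto
qed

lemma arc_integrable_mult:
  assumes "arc_integrable h" "f \<in> borel_measurable borel" "\<And>x. \<bar>f x\<bar> \<le> B"
  shows "arc_integrable (\<lambda>x. f x * h x)"
  unfolding arc_integrable_def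
proof
  fix L assume L: "L \<in> \<L>"
  have h: "integrable (line_measure L) h" using assms(1) L unfolding arc_integrable_def by blast
  show "integrable (line_measure L) (\<lambda>x. f x * h x)"
  proof (rule Bochner_Integration.integrable_bound)
    show "integrable (line_measure L) (\<lambda>x. B * h x)" using h by simp
    show "(\<lambda>x. f x * h x) \<in> borel_measurable (line_measure L)"
      using borel_measurable_integrable[OF h] assms(2) unfolding borel_measurable_line_measure by simp
    have "\<bar>f x * h x\<bar> \<le> \<bar>B * h x\<bar>" for x
      using assms(3)[of x] abs_ge_self[of B] by (simp add: abs_mult mult_right_mono)
    then show "AE x in line_measure L. norm (f x * h x) \<le> norm (B * h x)" by simp
  qed
qed

lemma lines_of_subset:
  assumes "E \<subseteq> \<Union>\<L>" shows "lines_of E \<subseteq> \<L>"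
proof
  fix L assume "L \<in> lines_of E"
  then have L: "affine L" "aff_dim L = 1" "infinite (E \<inter> L)" by (auto simp: lines_of_def)
  have "E \<inter> L \<subseteq> (\<Union>L'\<in>\<L>. L \<inter> L')" using assms by blast
  then have "infinite (\<Union>L'\<in>\<L>. L \<inter> L')" using L(3) finite_subset by blast
  then obtain L' where "L' \<in> \<L>" "infinite (L \<inter> L')" using finite_lines by blast
  then show "L \<in> \<L>" using lines_eqI[of L L'] L lines by blast
qed

lemma AE_off_lines_of:
  assumes "L \<in> \<L>" "L \<notin> lines_of E" shows "AE x in line_measure L. indicator E x * g x = (0::real)"
proof -
  have "finite (E \<inter> L)" using assms lines[OF assms(1)] unfolding lines_of_def by blast
  from AE_line_measure_finite[OF assms(1) this] AE_line_measure[OF assms(1)]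
  show ?thesis by eventually_elim (auto simp: indicator_def)
qed

text \<open>Only lines that meet \<open>E\<close> in infinitely many points enter \<open>bd_integral\<close>; on the remaining lines of the
family the integrand vanishes almost everywhere.\<close>

lemma bd_integral_eq_arc_int:
  assumes "E \<subseteq> \<Union>\<L>"
  shows "bd_integral E g = arc_int (\<lambda>x. indicator E x * g x)"
  unfolding bd_integral_def arc_int_def set_lebesgue_integral_def real_scaleR_def
  using AE_off_lines_of finite_lines lines_of_subset[OF assms]
  by (intro sum.mono_neutral_left) (auto intro!: integral_eq_zero_AE)

text \<open>A line of \<open>lines_of E\<close> is needed to obtain measurability of the integrand on the whole plane from
\<open>bd_integrable\<close>, which says nothing if there is no such line.\<close>

lemma bd_integrable_arc_integrable:
  assumes "E \<subseteq> \<Union>\<L>" "lines_of E \<noteq> {}" "bd_integrable E g"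
  shows "arc_integrable (\<lambda>x. indicator E x * g x)"
proof -
  have int: "integrable (line_measure L) (\<lambda>x. indicator E x * g x)" if "L \<in> lines_of E" for L
    using assms(3) that unfolding bd_integrable_def set_integrable_def by simp
  obtain L0 where "L0 \<in> lines_of E" using assms(2) by blast
  from borel_measurable_integrable[OF int[OF this]]
  have m: "(\<lambda>x. indicator E x * g x) \<in> borel_measurable (line_measure L)" for L
    unfolding borel_measurable_line_measure .
  have "integrable (line_measure L) (\<lambda>x. indicator E x * g x)" if "L \<in> \<L>" for L
  proof (cases "L \<in> lines_of E")
    case False
    show ?thesis using AE_off_lines_of[OF that False] m
      by (subst integrable_cong_AE[where g = "\<lambda>_. 0"]) auto
  qed (rule int)
  then show ?thesis unfolding arc_integrable_def by blast
qed

lemma arc_integrable_bnormal: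
  fixes g :: "point \<Rightarrow> real" and q :: "point \<Rightarrow> point"
  assumes S: "regular S" and q: "continuous_on UNIV q"
  shows "arc_integrable (\<lambda>x. inner (q x) (bnormal S x))"
    and "(\<lambda>x. inner (q x) (bnormal S x)) \<in> borel_measurable borel"
proof -
  have [measurable]: "bnormal S \<in> borel_measurable borel" "q \<in> borel_measurable borel"
    using borel_bnormal regular_closed[OF S] q borel_measurable_continuous_onI by auto
  show m: "(\<lambda>x. inner (q x) (bnormal S x)) \<in> borel_measurable borel" by measurable
  have cS: "compact S" using S by (simp add: regular_def)
  have "bounded (q ` S)"
    using compact_continuous_image[of S q] continuous_on_subset[OF q] cS compact_imp_bounded by blast
  then obtain B where B: "\<And>x. x \<in> S \<Longrightarrow> norm (q x) \<le> B" unfolding bounded_iff by blast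
  have out: "bnormal S x = 0" if "x \<notin> S" for x
    using that bnormal_outside frontier_subset_closed[OF regular_closed[OF S]] by blast
  show "arc_integrable (\<lambda>x. inner (q x) (bnormal S x))"
  proof (rule arc_integrable_bounded[OF m, where B = "\<bar>B\<bar>" and K = S])
    show "\<bar>inner (q x) (bnormal S x)\<bar> \<le> \<bar>B\<bar>" for x
    proof (cases "x \<in> S")
      case True
      have "\<bar>inner (q x) (bnormal S x)\<bar> \<le> norm (q x) * norm (bnormal S x)" by (rule Cauchy_Schwarz_ineq2)
      also have "\<dots> \<le> \<bar>B\<bar> * 1" using B[OF True] norm_bnormal_le[of S x] by (intro mult_mono) auto
      finally show ?thesis by simp
    qed (simp add: out)
    show "inner (q x) (bnormal S x) = 0" if "x \<notin> S" for x using out[OF that] by simp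
  qed (use cS compact_imp_bounded in auto)
qed

theorem divergence_theorem:
  fixes q :: "point \<Rightarrow> point" and d1 d2 :: "point \<Rightarrow> real"
  assumes S: "regular S"
    and d1: "\<And>x y. ((\<lambda>x. fst (q (x, y))) has_real_derivative d1 (x, y)) (at x)"
    and d2: "\<And>x y. ((\<lambda>y. snd (q (x, y))) has_real_derivative d2 (x, y)) (at y)"
    and cont: "continuous_on UNIV q" "continuous_on UNIV d1" "continuous_on UNIV d2"
  shows "(\<integral>z. indicator S z * (d1 z + d2 z) \<partial>lborel) = arc_int (\<lambda>x. inner (q x) (bnormal S x))"
proof -
  have int: "integrable lborel (\<lambda>z. indicator S z * f z)" if "continuous_on UNIV f" for f :: "point \<Rightarrow> real"
    using borel_integrable_compact[of S f] continuous_on_subset[OF that] S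
    by (simp add: regular_def mult.commute if_distrib indicator_def cong: if_cong)
  have comp: "(\<Sum>L\<in>\<L>. \<integral>s. f (par L s) * p (bnormal S (par L s)) \<partial>lborel) = arc_int (\<lambda>x. f x * p (bnormal S x))"
    "arc_integrable (\<lambda>x. f x * p (bnormal S x))"
    if f: "continuous_on UNIV f" and p: "p = (\<lambda>v. inner (e::point) v)" for f p e
  proof -
    have c: "continuous_on UNIV (\<lambda>x. f x *\<^sub>R e)" by (intro continuous_intros f)
    have e: "(\<lambda>x. inner (f x *\<^sub>R e) (bnormal S x)) = (\<lambda>x. f x * p (bnormal S x))" using p by auto
    show "arc_integrable (\<lambda>x. f x * p (bnormal S x))"
      using arc_integrable_bnormal(1)[OF S c] unfolding e .
    have m: "(\<lambda>x. f x * p (bnormal S x)) \<in> borel_measurable borel"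
      using arc_integrable_bnormal(2)[OF S c] unfolding e .
    show "(\<Sum>L\<in>\<L>. \<integral>s. f (par L s) * p (bnormal S (par L s)) \<partial>lborel) = arc_int (\<lambda>x. f x * p (bnormal S x))"
      unfolding arc_int_def line_measure_eq by (subst integral_distr[OF _ m]) auto
  qed
  have fs: "fst = (\<lambda>v. inner ((1, 0)::point) v)" "snd = (\<lambda>v. inner ((0, 1)::point) v)"
    by (auto simp: inner_prod_def)
  have c1: "continuous_on UNIV (\<lambda>x. fst (q x))" and c2: "continuous_on UNIV (\<lambda>x. snd (q x))"
    using cont(1) by (auto intro: continuous_intros)
  have "(\<integral>z. indicator S z * (d1 z + d2 z) \<partial>lborel) =
      (\<integral>z. indicator S z * d1 z \<partial>lborel) + (\<integral>z. indicator S z * d2 z \<partial>lborel)"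
    using int cont by (simp add: distrib_left)
  also have "(\<integral>z. indicator S z * d1 z \<partial>lborel) = arc_int (\<lambda>x. fst (q x) * fst (bnormal S x))"
    unfolding comp(1)[OF c1 fs(1), symmetric] using d1 by (intro divergence_fst[OF S] c1 cont) auto
  also have "(\<integral>z. indicator S z * d2 z \<partial>lborel) = arc_int (\<lambda>x. snd (q x) * snd (bnormal S x))"
    unfolding comp(1)[OF c2 fs(2), symmetric] using d2 by (intro divergence_snd[OF S] c2 cont) auto
  also have "arc_int (\<lambda>x. fst (q x) * fst (bnormal S x)) + arc_int (\<lambda>x. snd (q x) * snd (bnormal S x)) =
      arc_int (\<lambda>x. inner (q x) (bnormal S x))"
    by (simp add: arc_int_add[OF comp(2)[OF c1 fs(1)] comp(2)[OF c2 fs(2)], symmetric] inner_prod_def)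
  finally show ?thesis .
qed

text \<open>If the frontier met every line in a finite set, the divergence theorem for the field \<open>(x, 0)\<close> would
show that \<open>S\<close> has area zero.\<close>

lemma lines_of_frontier_nonempty:
  assumes S: "regular S" and pos: "measure lborel S > 0"
  shows "lines_of (frontier S) \<noteq> {}"
proof
  assume *: "lines_of (frontier S) = {}"
  have sub: "frontier S \<subseteq> \<Union>\<L>" using S unfolding regular_def by auto
  have "(\<integral>z. indicator S z * (1 + 0) \<partial>lborel) = arc_int (\<lambda>x. inner (fst x, 0) (bnormal S x))"
    by (rule divergence_theorem[OF S]) (auto intro!: derivative_eq_intros continuous_intros)
  also have "\<dots> = arc_int (\<lambda>x. indicator (frontier S) x * inner (fst x, 0) (bnormal S x))"
    by (rule arg_cong[where f = arc_int]) (auto simp: fun_eq_iff indicator_def bnormal_outside)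
  also have "\<dots> = bd_integral (frontier S) (\<lambda>x. inner (fst x, 0) (bnormal S x))"
    by (simp add: bd_integral_eq_arc_int[OF sub])
  also have "\<dots> = 0" unfolding bd_integral_def * by simp
  finally have "measure lborel S = 0" by simp
  then show False using pos by simp
qed

end

section \<open>Polynomials in two variables\<close>

lemma Pk_iff: "f \<in> Pk k \<longleftrightarrow> (\<exists>a. f = (\<lambda>z. \<Sum>i\<le>k. \<Sum>j\<le>k - i. a i j * (fst z ^ i * snd z ^ j)))"
  by (simp add: Pk_def fun_eq_iff mult.assoc)

lemma Pk_add:
  assumes "f \<in> Pk k" "g \<in> Pk k" shows "(\<lambda>z. f z + g z) \<in> Pk k"
proof -
  obtain a b where "f = (\<lambda>z. \<Sum>i\<le>k. \<Sum>j\<le>k - i. a i j * (fst z ^ i * snd z ^ j))"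
    "g = (\<lambda>z. \<Sum>i\<le>k. \<Sum>j\<le>k - i. b i j * (fst z ^ i * snd z ^ j))"
    using assms unfolding Pk_iff by auto
  then have "(\<lambda>z. f z + g z) = (\<lambda>z. \<Sum>i\<le>k. \<Sum>j\<le>k - i. (a i j + b i j) * (fst z ^ i * snd z ^ j))"
    by (simp add: sum.distrib distrib_right)
  then show ?thesis unfolding Pk_iff by (intro exI[of _ "\<lambda>i j. a i j + b i j"]) simp
qed

lemma Pk_cmult:
  assumes "f \<in> Pk k" shows "(\<lambda>z. c * f z) \<in> Pk k"
proof -
  obtain a where "f = (\<lambda>z. \<Sum>i\<le>k. \<Sum>j\<le>k - i. a i j * (fst z ^ i * snd z ^ j))"
    using assms unfolding Pk_iff by auto
  then have "(\<lambda>z. c * f z) = (\<lambda>z. \<Sum>i\<le>k. \<Sum>j\<le>k - i. (c * a i j) * (fst z ^ i * snd z ^ j))"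
    by (simp add: sum_distrib_left mult.assoc)
  then show ?thesis unfolding Pk_iff by (intro exI[of _ "\<lambda>i j. c * a i j"]) simp
qed

lemma Pk_zero: "(\<lambda>z. 0) \<in> Pk k"
  unfolding Pk_iff by (intro exI[of _ "\<lambda>i j. 0"]) simp

lemma Pk_diff: "f \<in> Pk k \<Longrightarrow> g \<in> Pk k \<Longrightarrow> (\<lambda>z. f z - g z) \<in> Pk k"
  using Pk_add[of f k "\<lambda>z. (- 1) * g z"] Pk_cmult[of g k "- 1"] by simp

lemma Pk_sum: "(\<And>i. i \<in> A \<Longrightarrow> f i \<in> Pk k) \<Longrightarrow> (\<lambda>z. \<Sum>i\<in>A. f i z) \<in> Pk k"
  by (induction A rule: infinite_finite_induct) (auto simp: Pk_zero Pk_add)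

lemma Pk_monomial:
  assumes "i + j \<le> k" shows "(\<lambda>z. fst z ^ i * snd z ^ j) \<in> Pk k"
proof -
  have "(\<Sum>i'\<le>k. \<Sum>j'\<le>k - i'. (if i' = i then if j' = j then 1 else 0 else 0) * (x ^ i' * y ^ j')) = x ^ i * y ^ j"
    for x y :: real
  proof -
    have inner: "(\<Sum>j'\<le>k - i'. (if i' = i then if j' = j then 1 else 0 else 0) * (x ^ i' * y ^ j')) =
      (if i' = i then x ^ i * y ^ j else 0)" for i'
    proof (cases "i' = i")
      case True
      have "(\<Sum>j'\<le>k - i. (if j' = j then 1 else 0) * (x ^ i * y ^ j')) =
          (\<Sum>j'\<le>k - i. if j' = j then x ^ i * y ^ j else 0)"
        by (rule sum.cong) auto
      then show ?thesis using True assms by simp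
    qed simp
    have "(\<Sum>i'\<le>k. \<Sum>j'\<le>k - i'. (if i' = i then if j' = j then 1 else 0 else 0) * (x ^ i' * y ^ j')) =
      x ^ i * y ^ j" unfolding inner using assms by simp
    then show ?thesis .
  qed
  then show ?thesis unfolding Pk_iff
    by (intro exI[of _ "\<lambda>i' j'. if i' = i then if j' = j then 1 else 0 else 0"]) (simp add: fun_eq_iff)
qed

lemma Pk_const: "(\<lambda>z. c) \<in> Pk k"
  using Pk_cmult[OF Pk_monomial[of 0 0 k], of c] by simp

lemma Pk_mono:
  assumes "f \<in> Pk k" "k \<le> l" shows "f \<in> Pk l"
proof -
  obtain a where a: "f = (\<lambda>z. \<Sum>i\<le>k. \<Sum>j\<le>k - i. a i j * (fst z ^ i * snd z ^ j))"
    using assms unfolding Pk_iff by auto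
  show ?thesis unfolding a using assms(2) by (intro Pk_sum Pk_cmult Pk_monomial) auto
qed

lemma Pk_continuous:
  assumes "f \<in> Pk k" shows "continuous_on A f"
proof -
  obtain a where a: "f = (\<lambda>z. \<Sum>i\<le>k. \<Sum>j\<le>k - i. a i j * (fst z ^ i * snd z ^ j))"
    using assms unfolding Pk_iff by auto
  show ?thesis unfolding a by (intro continuous_intros)
qed

lemma Pk_deriv_fst:
  assumes "f \<in> Pk k"
  obtains d where "d \<in> Pk (k - 1)" "\<And>x y. ((\<lambda>x. f (x, y)) has_real_derivative d (x, y)) (at x)"
proof -
  obtain a where a: "f = (\<lambda>z. \<Sum>i\<le>k. \<Sum>j\<le>k - i. a i j * (fst z ^ i * snd z ^ j))"
    using assms unfolding Pk_iff by auto
  define d where "d = (\<lambda>z::point. \<Sum>i\<le>k. \<Sum>j\<le>k - i. a i j * (real i * (fst z ^ (i - 1) * snd z ^ j)))"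
  have m: "(\<lambda>z. real i * (fst z ^ (i - 1) * snd z ^ j)) \<in> Pk (k - 1)" if "i \<le> k" "j \<le> k - i" for i j
    using that by (cases "i = 0") (auto intro!: Pk_cmult Pk_monomial Pk_zero)
  have "d \<in> Pk (k - 1)" unfolding d_def by (intro Pk_sum, rule Pk_cmult, rule m) auto
  moreover have "((\<lambda>x. f (x, y)) has_real_derivative d (x, y)) (at x)" for x y
    unfolding a d_def by (auto intro!: derivative_eq_intros sum.cong)
  ultimately show ?thesis using that by blast
qed

lemma Pk_deriv_snd:
  assumes "f \<in> Pk k"
  obtains d where "d \<in> Pk (k - 1)" "\<And>x y. ((\<lambda>y. f (x, y)) has_real_derivative d (x, y)) (at y)"
proof -
  obtain a where a: "f = (\<lambda>z. \<Sum>i\<le>k. \<Sum>j\<le>k - i. a i j * (fst z ^ i * snd z ^ j))"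
    using assms unfolding Pk_iff by auto
  define d where "d = (\<lambda>z::point. \<Sum>i\<le>k. \<Sum>j\<le>k - i. a i j * (real j * (fst z ^ i * snd z ^ (j - 1))))"
  have m: "(\<lambda>z. real j * (fst z ^ i * snd z ^ (j - 1))) \<in> Pk (k - 1)" if "i \<le> k" "j \<le> k - i" for i j
    using that by (cases "j = 0") (auto intro!: Pk_cmult Pk_monomial Pk_zero)
  have "d \<in> Pk (k - 1)" unfolding d_def by (intro Pk_sum, rule Pk_cmult, rule m) auto
  moreover have "((\<lambda>y. f (x, y)) has_real_derivative d (x, y)) (at y)" for x y
    unfolding a d_def by (auto intro!: derivative_eq_intros sum.cong)
  ultimately show ?thesis using that by blast
qed

lemma Pk_vec_continuous: "q \<in> Pk_vec k \<Longrightarrow> continuous_on A q"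
  using continuous_on_Pair[of A "\<lambda>x. fst (q x)" "\<lambda>x. snd (q x)"] Pk_continuous unfolding Pk_vec_def by auto

lemma Pk_grad:
  assumes "f \<in> Pk k"
  shows "grad f \<in> Pk_vec (k - 1)"
    and "((\<lambda>x. f (x, y)) has_real_derivative fst (grad f (x, y))) (at x)"
    and "((\<lambda>y. f (x, y)) has_real_derivative snd (grad f (x, y))) (at y)"
proof -
  obtain d1 where d1: "d1 \<in> Pk (k - 1)" "\<And>x y. ((\<lambda>x. f (x, y)) has_real_derivative d1 (x, y)) (at x)"
    using Pk_deriv_fst[OF assms] by blast
  obtain d2 where d2: "d2 \<in> Pk (k - 1)" "\<And>x y. ((\<lambda>y. f (x, y)) has_real_derivative d2 (x, y)) (at y)"
    using Pk_deriv_snd[OF assms] by blast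
  have g: "grad f = (\<lambda>z. (d1 z, d2 z))"
    using DERIV_imp_deriv[OF d1(2)] DERIV_imp_deriv[OF d2(2)] by (simp add: grad_def fun_eq_iff)
  show "grad f \<in> Pk_vec (k - 1)" unfolding g Pk_vec_def using d1 d2 by simp
  show "((\<lambda>x. f (x, y)) has_real_derivative fst (grad f (x, y))) (at x)"
    "((\<lambda>y. f (x, y)) has_real_derivative snd (grad f (x, y))) (at y)" unfolding g using d1 d2 by simp_all
qed

lemma grad_add:
  assumes "f \<in> Pk k" "g \<in> Pk k" shows "grad (\<lambda>x. f x + g x) z = grad f z + grad g z"
proof (cases z)
  case (Pair x y)
  show ?thesis unfolding Pair
    using DERIV_unique[OF Pk_grad(2)[OF Pk_add[OF assms]] DERIV_add[OF Pk_grad(2)[OF assms(1)] Pk_grad(2)[OF assms(2)]]]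
      DERIV_unique[OF Pk_grad(3)[OF Pk_add[OF assms]] DERIV_add[OF Pk_grad(3)[OF assms(1)] Pk_grad(3)[OF assms(2)]]]
    by (intro prod_eqI) simp_all
qed

lemma grad_cmult:
  assumes "f \<in> Pk k" shows "grad (\<lambda>x. c * f x) z = c *\<^sub>R grad f z"
proof (cases z)
  case (Pair x y)
  show ?thesis unfolding Pair
    using DERIV_unique[OF Pk_grad(2)[OF Pk_cmult[OF assms]] DERIV_cmult[OF Pk_grad(2)[OF assms]]]
      DERIV_unique[OF Pk_grad(3)[OF Pk_cmult[OF assms]] DERIV_cmult[OF Pk_grad(3)[OF assms]]]
    by (intro prod_eqI) simp_all
qed

lemma Pk_vec_mono: "q \<in> Pk_vec k \<Longrightarrow> k \<le> l \<Longrightarrow> q \<in> Pk_vec l"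
  unfolding Pk_vec_def using Pk_mono by blast

lemma Pk_real_polynomial_function:
  assumes "f \<in> Pk k" shows "real_polynomial_function f"
proof -
  obtain a where a: "f = (\<lambda>z. \<Sum>i\<le>k. \<Sum>j\<le>k - i. a i j * (fst z ^ i * snd z ^ j))"
    using assms unfolding Pk_iff by auto
  have "real_polynomial_function (\<lambda>z::point. a i j * (fst z ^ i * snd z ^ j))" for i j
    by (intro real_polynomial_function.intros(2,4) real_polynomial_function_power
        real_polynomial_function.intros(1)[OF bounded_linear_fst] real_polynomial_function.intros(1)[OF bounded_linear_snd])
  then show ?thesis unfolding a by (intro real_polynomial_function_sum finite_atMost)
qed

text \<open>Restricted to the line from a point of \<open>U\<close> to \<open>x\<close>, the function is a polynomial in one variable with
infinitely many zeros.\<close>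

lemma real_polynomial_function_eq_0:
  fixes f :: "'a::euclidean_space \<Rightarrow> real"
  assumes f: "real_polynomial_function f" and U: "open U" "U \<noteq> {}" "\<And>x. x \<in> U \<Longrightarrow> f x = 0"
  shows "f x = 0"
proof -
  obtain p where p: "p \<in> U" using U by blast
  have "polynomial_function (\<lambda>s. p + s *\<^sub>R (x - p))"
    by (rule polynomial_function_add[OF polynomial_function_const
          polynomial_function_bounded_linear[OF bounded_linear_scaleR_left]])
  then have "real_polynomial_function (f \<circ> (\<lambda>s. p + s *\<^sub>R (x - p)))"
    using f by (rule real_polynomial_function_compose)
  then obtain c n where c: "\<And>s. f (p + s *\<^sub>R (x - p)) = (\<Sum>i\<le>n. c i * s ^ i)"
    unfolding real_polynomial_function_iff_sum by (auto simp: fun_eq_iff o_def)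
  have "open ((\<lambda>s. p + s *\<^sub>R (x - p)) -` U)"
    using U(1) by (intro open_vimage) (auto intro!: continuous_intros)
  moreover have "0 \<in> (\<lambda>s. p + s *\<^sub>R (x - p)) -` U" using p by simp
  ultimately obtain e where e: "e > 0" "ball 0 e \<subseteq> (\<lambda>s. p + s *\<^sub>R (x - p)) -` U" using openE by blast
  have "infinite (ball (0::real) e)"
    using e(1) uncountable_ball[of e 0] countable_finite by blast
  moreover have "ball 0 e \<subseteq> {s. (\<Sum>i\<le>n. c i * s ^ i) = 0}"
  proof
    fix s :: real assume "s \<in> ball 0 e"
    then have "p + s *\<^sub>R (x - p) \<in> U" using e(2) by blast
    then show "s \<in> {s. (\<Sum>i\<le>n. c i * s ^ i) = 0}" using U(3) c[of s] by simp
  qed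
  ultimately have "infinite {s. (\<Sum>i\<le>n. c i * s ^ i) = 0}" using finite_subset by blast
  then have "\<forall>i\<le>n. c i = 0" using polyfun_finite_roots[of c n] by auto
  then have "f (p + 1 *\<^sub>R (x - p)) = 0" unfolding c by simp
  then show ?thesis by simp
qed

lemma set_integrable_continuous:
  fixes f :: "'a::euclidean_space \<Rightarrow> real"
  assumes "compact D" "continuous_on D f" shows "set_integrable lborel D f"
  using borel_integrable_compact[OF assms] by (simp add: set_integrable_def indicator_def if_distrib cong: if_cong)

section \<open>Riesz representation and the \<open>L\<^sup>2\<close> projection\<close>

text \<open>With \<open>real_polynomial_function_eq_0\<close> this makes the \<open>L\<^sup>2\<close> product positive definite on polynomials.\<close>

lemma continuous_square_integral_eq_0:
  fixes f :: "'a::euclidean_space \<Rightarrow> real"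
  assumes D: "compact D" and f: "continuous_on UNIV f" and z: "(LINT x:D|lborel. f x * f x) = 0"
    and x: "x \<in> interior D"
  shows "f x = 0"
proof (rule ccontr)
  assume "f x \<noteq> 0"
  have "set_integrable lborel D (\<lambda>x. f x * f x)"
    using D continuous_on_subset[OF f] by (intro set_integrable_continuous continuous_intros) auto
  then have AE: "AE y in lborel. indicator D y *\<^sub>R (f y * f y) = 0"
    using z unfolding set_lebesgue_integral_def set_integrable_def
    by (subst (asm) integral_nonneg_eq_0_iff_AE) auto
  have "open ({y. f y \<noteq> 0} \<inter> interior D)"
    using f by (intro open_Int open_interior) (auto intro!: open_Collect_neq continuous_intros)
  moreover have "x \<in> {y. f y \<noteq> 0} \<inter> interior D" using \<open>f x \<noteq> 0\<close> x by simp
  ultimately obtain e where e: "e > 0" "ball x e \<subseteq> {y. f y \<noteq> 0} \<inter> interior D" using openE by blast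
  have "AE y in lborel. y \<notin> ball x e"
    using AE by eventually_elim (use e(2) interior_subset[of D] in \<open>auto simp: indicator_def subset_iff split: if_splits\<close>)
  then have "ball x e \<in> null_sets lborel" using AE_iff_null_sets[of "ball x e" lborel] by simp
  then have "negligible (ball x e)" using null_sets_completionI by (auto simp: negligible_iff_null_sets)
  then show False using e(1) open_not_negligible[of "ball x e"] by simp
qed

lemma Pk_square_integral_eq_0:
  assumes "compact D" "interior D \<noteq> {}" "f \<in> Pk k" "(LINT x:D|lborel. f x * f x) = 0"
  shows "f = (\<lambda>x. 0)"
proof
  fix x
  have "f y = 0" if "y \<in> interior D" for y
    using continuous_square_integral_eq_0[OF assms(1) Pk_continuous[OF assms(3)] assms(4) that] .
  then show "f x = 0"
    by (rule real_polynomial_function_eq_0[OF Pk_real_polynomial_function[OF assms(3)] open_interior assms(2)])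
qed

definition linear_fnl :: "('a \<Rightarrow> real) set \<Rightarrow> (('a \<Rightarrow> real) \<Rightarrow> real) \<Rightarrow> bool" where
  "linear_fnl W l \<longleftrightarrow> (\<forall>f\<in>W. \<forall>g\<in>W. l (\<lambda>x. f x + g x) = l f + l g) \<and> (\<forall>c. \<forall>f\<in>W. l (\<lambda>x. c * f x) = c * l f)"

lemma linear_fnl_add: "linear_fnl W l \<Longrightarrow> f \<in> W \<Longrightarrow> g \<in> W \<Longrightarrow> l (\<lambda>x. f x + g x) = l f + l g"
  unfolding linear_fnl_def by blast

lemma linear_fnl_cmult: "linear_fnl W l \<Longrightarrow> f \<in> W \<Longrightarrow> l (\<lambda>x. c * f x) = c * l f"
  unfolding linear_fnl_def by blast

lemma linear_fnl_0: "linear_fnl W l \<Longrightarrow> (\<lambda>x. 0) \<in> W \<Longrightarrow> l (\<lambda>x. 0) = 0"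
  using linear_fnl_cmult[of W l "\<lambda>x. 0" 0] by simp

lemma linear_fnl_sum:
  assumes l: "linear_fnl (Pk k) l" and b: "\<And>i. i \<in> A \<Longrightarrow> b i \<in> Pk k"
  shows "l (\<lambda>x. \<Sum>i\<in>A. c i * b i x) = (\<Sum>i\<in>A. c i * l (b i))"
  using b
proof (induction A rule: infinite_finite_induct)
  case (insert n A)
  have b: "b i \<in> Pk k" if "i \<in> insert n A" for i using insert.prems that by blast
  have "(\<lambda>x. \<Sum>i\<in>A. c i * b i x) \<in> Pk k" by (intro Pk_sum Pk_cmult b) simp
  moreover have "b n \<in> Pk k" using b by simp
  ultimately have "l (\<lambda>x. c n * b n x + (\<Sum>i\<in>A. c i * b i x)) = c n * l (b n) + l (\<lambda>x. \<Sum>i\<in>A. c i * b i x)"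
    using linear_fnl_add[OF l Pk_cmult] linear_fnl_cmult[OF l] by simp
  moreover have "l (\<lambda>x. \<Sum>i\<in>A. c i * b i x) = (\<Sum>i\<in>A. c i * l (b i))"
    using insert.IH b by simp
  ultimately show ?case using insert.hyps by simp
qed (use linear_fnl_0[OF l Pk_zero] in auto)

lemma linear_fnl_set_integral:
  assumes D: "\<And>f. f \<in> Pk k \<Longrightarrow> set_integrable lborel D (\<lambda>x. h x * f x)"
  shows "linear_fnl (Pk k) (\<lambda>f. LINT x:D|lborel. h x * f x)"
  unfolding linear_fnl_def
proof (intro conjI ballI allI)
  fix f g assume "f \<in> Pk k" "g \<in> Pk k"
  then show "(LINT x:D|lborel. h x * (f x + g x)) = (LINT x:D|lborel. h x * f x) + (LINT x:D|lborel. h x * g x)"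
    using D by (simp add: distrib_left set_integral_add)
next
  fix c f assume "f \<in> Pk k"
  have "(\<lambda>x. h x * (c * f x)) = (\<lambda>x. c * (h x * f x))" by (auto simp: mult_ac)
  then show "(LINT x:D|lborel. h x * (c * f x)) = c * (LINT x:D|lborel. h x * f x)"
    by (simp add: set_integral_mult_right)
qed

lemma linear_fnl_L2:
  assumes "compact D" "f \<in> Pk k" shows "linear_fnl (Pk k) (\<lambda>g. LINT x:D|lborel. f x * g x)"
  using assms by (intro linear_fnl_set_integral set_integrable_continuous continuous_intros Pk_continuous)

text \<open>The Gram-Schmidt process. Let \<open>r\<close> be the new function minus its projection to the span of the earlier
ones. If \<open>r = 0\<close>, the representer found so far takes the right value at the new function by
linearity. Otherwise adding a multiple of \<open>r\<close> corrects the value at \<open>r\<close> without changing the products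
with the earlier functions.\<close>

lemma riesz_family:
  assumes D: "compact D" "interior D \<noteq> {}" and A: "finite A"
    and b: "\<And>i. i \<in> A \<Longrightarrow> b i \<in> Pk k" and l: "linear_fnl (Pk k) l"
  shows "\<exists>c. \<forall>i\<in>A. (LINT x:D|lborel. (\<Sum>j\<in>A. c j * b j x) * b i x) = l (b i)"
  using A b l
proof (induction A arbitrary: l rule: finite_induct)
  case (insert n A)
  define ip where "ip f g = (LINT x:D|lborel. f x * g x)" for f g :: "point \<Rightarrow> real"
  have sym: "ip f g = ip g f" for f g by (simp add: ip_def mult.commute)
  have lin: "linear_fnl (Pk k) (ip f)" if "f \<in> Pk k" for f
    unfolding ip_def using linear_fnl_L2[OF D(1) that] .
  have add: "ip f (\<lambda>x. g x + h x) = ip f g + ip f h" and cm: "ip f (\<lambda>x. c * g x) = c * ip f g"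
    if "f \<in> Pk k" "g \<in> Pk k" "h \<in> Pk k" for f g h c
    using linear_fnl_add[OF lin] linear_fnl_cmult[OF lin] that by auto
  define S where "S c = (\<lambda>x. \<Sum>j\<in>A. c j * b j x)" for c
  have bA: "b i \<in> Pk k" if "i \<in> A" for i using insert.prems that by simp
  have bn: "b n \<in> Pk k" using insert.prems by simp
  have S: "S c \<in> Pk k" for c unfolding S_def by (intro Pk_sum Pk_cmult bA)
  have lS: "m (S c) = (\<Sum>j\<in>A. c j * m (b j))" if "linear_fnl (Pk k) m" for m c
    unfolding S_def using linear_fnl_sum[OF that bA] .
  obtain c where c: "\<And>i. i \<in> A \<Longrightarrow> ip (S c) (b i) = l (b i)"
    using insert.IH[OF bA insert.prems(2)] unfolding ip_def S_def by auto
  obtain d where d: "\<And>i. i \<in> A \<Longrightarrow> ip (S d) (b i) = ip (b n) (b i)"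
    using insert.IH[OF bA lin[OF bn]] unfolding ip_def S_def by auto
  define r where "r = (\<lambda>x. b n x + (- 1) * S d x)"
  have r: "r \<in> Pk k" unfolding r_def by (intro Pk_add Pk_cmult bn S)
  have ip_r: "ip g r = ip g (b n) - ip g (S d)" if "g \<in> Pk k" for g
    using add[OF that bn Pk_cmult[OF S], of "-1"] cm[OF that S S, of "- 1"] unfolding r_def by simp
  have rA: "ip r (b i) = 0" if "i \<in> A" for i
    using ip_r[OF bA[OF that]] d[OF that] sym[of "b i"] by simp
  have rS: "ip r (S e) = 0" for e using lS[OF lin[OF r]] rA by simp
  have bn_eq: "m (b n) = m r + m (S d)" if m: "linear_fnl (Pk k) m" for m
  proof -
    have "m r = m (b n) + (- 1) * m (S d)" unfolding r_def
      using linear_fnl_add[OF m bn Pk_cmult[OF S, where c = "- 1"], of d]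
        linear_fnl_cmult[OF m S, where c = "- 1", of d] by simp
    then show ?thesis by simp
  qed
  show ?case
  proof (cases "ip r r = 0")
    case True
    then have r0: "r = (\<lambda>x. 0)" using Pk_square_integral_eq_0[OF D r] unfolding ip_def by simp
    have m0: "m r = 0" if "linear_fnl (Pk k) m" for m using linear_fnl_0[OF that Pk_zero] r0 by simp
    have "ip (S c) (b n) = l (b n)"
      using bn_eq[OF lin[OF S]] bn_eq[OF insert.prems(2)] m0[OF lin[OF S]] m0[OF insert.prems(2)]
        lS[OF lin[OF S]] lS[OF insert.prems(2)] c by simp
    moreover have "(\<Sum>j\<in>insert n A. (c(n := 0)) j * b j x) = S c x" for x
      using insert(1,2) unfolding S_def by (simp, intro sum.cong) auto
    ultimately show ?thesis using c unfolding ip_def by (intro exI[of _ "c(n := 0)"]) auto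
  next
    case False
    define t where "t = l r / ip r r"
    define e where "e = (\<lambda>x. S c x + t * r x)"
    have ePk: "e \<in> Pk k" unfolding e_def by (intro Pk_add Pk_cmult r S)
    have e: "ip e g = ip (S c) g + t * ip r g" if "g \<in> Pk k" for g
      using add[OF that S Pk_cmult[OF r]] cm[OF that r r, of t] sym[of g] unfolding e_def by simp
    have eA: "ip e (b i) = l (b i)" if "i \<in> A" for i using that e[OF bA[OF that]] c rA by simp
    have "ip e r = l r" using e[OF r] rS[of c] sym[of "S c" r] False by (simp add: t_def)
    then have en: "ip e (b n) = l (b n)"
      using bn_eq[OF lin[OF ePk]] bn_eq[OF insert.prems(2)] lS[OF lin[OF ePk]] lS[OF insert.prems(2)] eA by simp
    define c' where "c' = (\<lambda>j. if j = n then t else c j - t * d j)"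
    have "(\<Sum>j\<in>insert n A. c' j * b j x) = e x" for x
    proof -
      have "(\<Sum>j\<in>A. c' j * b j x) = (\<Sum>j\<in>A. c j * b j x - t * (d j * b j x))"
        using insert(2) unfolding c'_def by (intro sum.cong) (auto simp: algebra_simps)
      also have "\<dots> = S c x - t * S d x" by (simp add: S_def sum_subtractf sum_distrib_left)
      finally have "(\<Sum>j\<in>A. c' j * b j x) = S c x - t * S d x" .
      moreover have "c' n = t" by (simp add: c'_def)
      ultimately show ?thesis using insert(1,2) by (simp add: e_def r_def right_diff_distrib)
    qed
    then show ?thesis using eA en unfolding ip_def by (intro exI[of _ c']) auto
  qed
qed simp

theorem riesz_Pk:
  assumes D: "compact D" "interior D \<noteq> {}" and l: "linear_fnl (Pk k) l"
  shows "\<exists>!e. e \<in> Pk k \<and> (\<forall>\<psi>\<in>Pk k. (LINT x:D|lborel. e x * \<psi> x) = l \<psi>)"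
proof (rule ex_ex1I)
  define A where "A = Sigma {..k} (\<lambda>i. {..k - i})"
  define b where "b = (\<lambda>(i, j) z. fst z ^ i * snd z ^ j :: real)"
  have b: "b p \<in> Pk k" if "p \<in> A" for p
    using that Pk_monomial unfolding A_def b_def by (auto split: prod.splits)
  have "finite A" unfolding A_def by auto
  from riesz_family[of D A b, OF D this b l] obtain c where
    c: "\<And>i. i \<in> A \<Longrightarrow> (LINT x:D|lborel. (\<Sum>j\<in>A. c j * b j x) * b i x) = l (b i)" by blast
  define e where "e = (\<lambda>x. \<Sum>j\<in>A. c j * b j x)"
  have e: "e \<in> Pk k" unfolding e_def by (intro Pk_sum Pk_cmult b)
  have "(LINT x:D|lborel. e x * \<psi> x) = l \<psi>" if \<psi>: "\<psi> \<in> Pk k" for \<psi>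
  proof -
    obtain a where a: "\<psi> = (\<lambda>z. \<Sum>i\<le>k. \<Sum>j\<le>k - i. a i j * (fst z ^ i * snd z ^ j))"
      using \<psi> unfolding Pk_iff by auto
    have \<psi>_eq: "\<psi> = (\<lambda>x. \<Sum>p\<in>A. (case p of (i, j) \<Rightarrow> a i j) * b p x)"
      unfolding a A_def b_def by (subst sum.Sigma) (auto simp: case_prod_unfold intro!: sum.cong)
    have "(LINT x:D|lborel. e x * \<psi> x) = (\<Sum>p\<in>A. (case p of (i, j) \<Rightarrow> a i j) * (LINT x:D|lborel. e x * b p x))"
      unfolding \<psi>_eq by (rule linear_fnl_sum[OF linear_fnl_L2[OF D(1) e] b])
    also have "\<dots> = (\<Sum>p\<in>A. (case p of (i, j) \<Rightarrow> a i j) * l (b p))"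
      using c by (intro sum.cong refl) (simp add: e_def)
    also have "\<dots> = l \<psi>" unfolding \<psi>_eq by (rule linear_fnl_sum[OF l b, symmetric])
    finally show ?thesis .
  qed
  then show "\<exists>e. e \<in> Pk k \<and> (\<forall>\<psi>\<in>Pk k. (LINT x:D|lborel. e x * \<psi> x) = l \<psi>)" using e by blast
next
  fix e e' assume *: "e \<in> Pk k \<and> (\<forall>\<psi>\<in>Pk k. (LINT x:D|lborel. e x * \<psi> x) = l \<psi>)"
    "e' \<in> Pk k \<and> (\<forall>\<psi>\<in>Pk k. (LINT x:D|lborel. e' x * \<psi> x) = l \<psi>)"
  define d where "d = (\<lambda>x. e x - e' x)"
  have d: "d \<in> Pk k" using * unfolding d_def by (auto intro: Pk_diff)
  have "(LINT x:D|lborel. d x * d x) = (LINT x:D|lborel. e x * d x - e' x * d x)"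
    by (simp add: d_def left_diff_distrib)
  also have "\<dots> = (LINT x:D|lborel. e x * d x) - (LINT x:D|lborel. e' x * d x)"
    using * d D(1) by (intro set_integral_diff set_integrable_continuous continuous_intros Pk_continuous) auto
  also have "\<dots> = 0" using * d by simp
  finally have "d = (\<lambda>x. 0)" using Pk_square_integral_eq_0[OF D d] by simp
  then show "e = e'" by (auto simp: d_def fun_eq_iff)
qed

text \<open>Riesz representation in each component. This also shows that the definite description in \<open>L2_proj\<close>
denotes, and its defining property is stated in the form in which the weak form needs it.\<close>

lemma L2_proj:
  fixes f :: "point \<Rightarrow> point"
  assumes D: "compact D" "interior D \<noteq> {}" and f: "square_integrable_on D f"
  shows "L2_proj k D f \<in> Pk_vec k"
    and "\<And>r. r \<in> Pk_vec k \<Longrightarrow> (LINT x:D|lborel. inner (f x) (r x)) = (LINT x:D|lborel. inner (L2_proj k D f x) (r x))"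
proof -
  have Dm: "D \<in> sets lborel" using D(1) by (simp add: compact_imp_closed)
  have fm: "set_borel_measurable lborel D f" and f2: "set_integrable lborel D (\<lambda>x. (norm (f x))\<^sup>2)"
    using f unfolding square_integrable_on_def by auto
  have int: "set_integrable lborel D (\<lambda>x. inner (f x) (g x))" if g: "continuous_on UNIV g" for g
  proof -
    have "compact (g ` D)" using continuous_on_subset[OF g] D(1) by (intro compact_continuous_image) auto
    then obtain B where B: "\<And>x. x \<in> D \<Longrightarrow> norm (g x) \<le> B" using compact_imp_bounded[of "g ` D"] unfolding bounded_iff by blast
    have gm: "g \<in> borel_measurable borel" using g by (rule borel_measurable_continuous_onI)
    \<comment> \<open>The bound \<open>norm (f x) \<le> 1 + (norm (f x))\<^sup>2\<close> reduces integrability to square integrability.\<close>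
    have "set_integrable lborel D (\<lambda>x. (1 + (norm (f x))\<^sup>2) * B)"
      using f2 set_integrable_continuous[OF D(1), of "\<lambda>_. 1"] by (intro set_integrable_mult_left set_integral_add(1)) auto
    then show ?thesis unfolding set_integrable_def
    proof (rule Bochner_Integration.integrable_bound)
      have "(\<lambda>x. inner (indicator D x *\<^sub>R f x) (g x)) \<in> borel_measurable lborel"
        using fm gm unfolding set_borel_measurable_def by (intro borel_measurable_inner) auto
      then show "(\<lambda>x. indicator D x *\<^sub>R inner (f x) (g x)) \<in> borel_measurable lborel" by simp
      show "AE x in lborel. norm (indicator D x *\<^sub>R inner (f x) (g x)) \<le> norm (indicator D x *\<^sub>R ((1 + (norm (f x))\<^sup>2) * B))"
      proof (rule AE_I2)
        fix x
        show "norm (indicator D x *\<^sub>R inner (f x) (g x)) \<le> norm (indicator D x *\<^sub>R ((1 + (norm (f x))\<^sup>2) * B))"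
        proof (cases "x \<in> D")
          case True
          have "\<bar>inner (f x) (g x)\<bar> \<le> norm (f x) * norm (g x)" by (rule Cauchy_Schwarz_ineq2)
          also have "\<dots> \<le> (1 + (norm (f x))\<^sup>2) * B"
          proof (rule mult_mono)
            have "0 \<le> (norm (f x) - 1)\<^sup>2" by simp
            then show "norm (f x) \<le> 1 + (norm (f x))\<^sup>2" by (simp add: power2_diff) (smt (verit) norm_ge_zero)
          qed (use B[OF True] in auto)
          finally show ?thesis using True by simp
        qed simp
      qed
    qed
  qed
  have int2: "set_integrable lborel D (\<lambda>x. inner (f x) e * g x)" if "g \<in> Pk k" for g e
  proof -
    have "continuous_on UNIV (\<lambda>x. g x *\<^sub>R e)" using that by (intro continuous_intros Pk_continuous)
    from int[OF this] show ?thesis by (simp add: mult.commute)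
  qed
  then have l: "linear_fnl (Pk k) (\<lambda>g. LINT x:D|lborel. inner (f x) e * g x)" for e
    by (rule linear_fnl_set_integral)
  have ex: "\<exists>p. p \<in> Pk k \<and> (\<forall>\<psi>\<in>Pk k. (LINT x:D|lborel. p x * \<psi> x) = (LINT x:D|lborel. inner (f x) e * \<psi> x))" for e
    using ex1_implies_ex[OF riesz_Pk[OF D l[of e]]] .
  obtain p1 where p1: "p1 \<in> Pk k" "\<And>\<psi>. \<psi> \<in> Pk k \<Longrightarrow> (LINT x:D|lborel. p1 x * \<psi> x) = (LINT x:D|lborel. inner (f x) (1, 0) * \<psi> x)"
    using ex[of "(1, 0)"] by blast
  obtain p2 where p2: "p2 \<in> Pk k" "\<And>\<psi>. \<psi> \<in> Pk k \<Longrightarrow> (LINT x:D|lborel. p2 x * \<psi> x) = (LINT x:D|lborel. inner (f x) (0, 1) * \<psi> x)"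
    using ex[of "(0, 1)"] by blast
  define p where "p = (\<lambda>x. (p1 x, p2 x))"
  have cont: "continuous_on UNIV r" if "r \<in> Pk_vec k" for r
    using continuous_on_Pair[of UNIV "\<lambda>x. fst (r x)" "\<lambda>x. snd (r x)"] that Pk_continuous unfolding Pk_vec_def by auto
  have p: "p \<in> Pk_vec k" using p1 p2 unfolding Pk_vec_def p_def by simp
  have intc: "set_integrable lborel D (\<lambda>x. inner (q x) (r x))" if "q \<in> Pk_vec k" "r \<in> Pk_vec k" for q r
    using cont[OF that(1)] cont[OF that(2)] D(1)
    by (intro set_integrable_continuous) (auto intro!: continuous_intros intro: continuous_on_subset)
  have eq: "(LINT x:D|lborel. inner (f x) (r x)) = (LINT x:D|lborel. inner (p x) (r x))" if r: "r \<in> Pk_vec k" for r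
  proof -
    have r12: "(\<lambda>x. fst (r x)) \<in> Pk k" "(\<lambda>x. snd (r x)) \<in> Pk k" using r unfolding Pk_vec_def by auto
    have e1: "set_integrable lborel D (\<lambda>x. inner (f x) (1, 0) * fst (r x))" and e2: "set_integrable lborel D (\<lambda>x. inner (f x) (0, 1) * snd (r x))"
      using int2 r12 by blast+
    have "(LINT x:D|lborel. inner (f x) (r x)) = (LINT x:D|lborel. inner (f x) (1, 0) * fst (r x) + inner (f x) (0, 1) * snd (r x))"
      by (simp add: inner_prod_def)
    also have "\<dots> = (LINT x:D|lborel. p1 x * fst (r x)) + (LINT x:D|lborel. p2 x * snd (r x))"
      using p1(2)[OF r12(1)] p2(2)[OF r12(2)] e1 e2 by (simp add: set_integral_add(2))
    also have "\<dots> = (LINT x:D|lborel. p1 x * fst (r x) + p2 x * snd (r x))"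
      using D(1) p1(1) p2(1) r12 by (intro set_integral_add(2)[symmetric] set_integrable_continuous continuous_intros Pk_continuous)
    also have "\<dots> = (LINT x:D|lborel. inner (p x) (r x))" by (simp add: inner_prod_def p_def)
    finally show ?thesis .
  qed
  have orth: "(LINT x:D|lborel. inner (f x - q x) (r x)) = (LINT x:D|lborel. inner (f x) (r x)) - (LINT x:D|lborel. inner (q x) (r x))"
    if "q \<in> Pk_vec k" "r \<in> Pk_vec k" for q r
    using int[OF cont[OF that(2)]] intc[OF that] by (simp add: inner_diff_left set_integral_diff(2))
  have "L2_proj k D f = p" unfolding L2_proj_def
  proof (rule the_equality)
    show "p \<in> Pk_vec k \<and> (\<forall>r\<in>Pk_vec k. (LINT x:D|lborel. inner (f x - p x) (r x)) = 0)"
      using p orth[OF p] eq by simp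
    fix q assume q: "q \<in> Pk_vec k \<and> (\<forall>r\<in>Pk_vec k. (LINT x:D|lborel. inner (f x - q x) (r x)) = 0)"
    have qr: "(LINT x:D|lborel. inner (q x) (r x)) = (LINT x:D|lborel. inner (p x) (r x))" if "r \<in> Pk_vec k" for r
      using q orth[of q r] eq[OF that] that by simp
    have comp: "(\<lambda>x. fst (q x)) = p1" "(\<lambda>x. snd (q x)) = p2"
    proof -
      have "(LINT x:D|lborel. fst (q x) * \<psi> x) = (LINT x:D|lborel. p1 x * \<psi> x)" if "\<psi> \<in> Pk k" for \<psi>
        using qr[of "\<lambda>x. (\<psi> x, 0)"] that Pk_zero by (simp add: Pk_vec_def inner_prod_def p_def)
      then show "(\<lambda>x. fst (q x)) = p1"
        using riesz_Pk[OF D l[of "(1, 0)"]] p1 q by (auto simp: Pk_vec_def)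
      have "(LINT x:D|lborel. snd (q x) * \<psi> x) = (LINT x:D|lborel. p2 x * \<psi> x)" if "\<psi> \<in> Pk k" for \<psi>
        using qr[of "\<lambda>x. (0, \<psi> x)"] that Pk_zero by (simp add: Pk_vec_def inner_prod_def p_def)
      then show "(\<lambda>x. snd (q x)) = p2"
        using riesz_Pk[OF D l[of "(0, 1)"]] p2 q by (auto simp: Pk_vec_def)
    qed
    show "q = p" unfolding p_def comp[symmetric] by simp
  qed
  then show "L2_proj k D f \<in> Pk_vec k"
    and "\<And>r. r \<in> Pk_vec k \<Longrightarrow> (LINT x:D|lborel. inner (f x) (r x)) = (LINT x:D|lborel. inner (L2_proj k D f x) (r x))"
    using p eq by auto
qed

unbundle no vec_syntax

section \<open>The graph Laplacian\<close>

definition ones :: "nat \<Rightarrow> real vec" where "ones n = vec n (\<lambda>_. 1)"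
text \<open>The scalar product with \<open>ones\<close>; its zeros are the orthogonal complement of the constants.\<close>

definition total :: "real vec \<Rightarrow> real" where "total v = (\<Sum>i<dim_vec v. v $ i)"
definition avg_mat :: "nat \<Rightarrow> real mat" where "avg_mat n = mat n n (\<lambda>_. 1 / real n)"

lemma ones_carrier [simp]: "ones n \<in> carrier_vec n" by (simp add: ones_def)
lemma avg_mat_carrier [simp]: "avg_mat n \<in> carrier_mat n n" by (simp add: avg_mat_def)

lemma total_add: "v \<in> carrier_vec n \<Longrightarrow> w \<in> carrier_vec n \<Longrightarrow> total (v + w) = total v + total w"
  by (simp add: total_def sum.distrib)
lemma total_diff: "v \<in> carrier_vec n \<Longrightarrow> w \<in> carrier_vec n \<Longrightarrow> total (v - w) = total v - total w"
  by (simp add: total_def sum_subtractf)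
lemma total_smult_ones: "total (c \<cdot>\<^sub>v ones n) = real n * c"
  by (simp add: total_def ones_def)
lemma total_eq_scalar_prod: "v \<in> carrier_vec n \<Longrightarrow> total v = scalar_prod v (ones n)"
  by (simp add: total_def ones_def scalar_prod_def atLeast0LessThan)

lemma avg_mat_mult:
  assumes "v \<in> carrier_vec n" shows "avg_mat n *\<^sub>v v = (total v / real n) \<cdot>\<^sub>v ones n"
  using assms by (intro eq_vecI)
    (auto simp: avg_mat_def ones_def total_def scalar_prod_def atLeast0LessThan sum_divide_distrib)

lemma mat_eqI_mult_vec:
  assumes "A \<in> carrier_mat n m" "B \<in> carrier_mat n m"
    and "\<And>v. v \<in> carrier_vec m \<Longrightarrow> A *\<^sub>v v = B *\<^sub>v (v :: real vec)"
  shows "A = B"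
proof (rule eq_matI)
  fix i j assume ij: "i < dim_row B" "j < dim_col B"
  have *: "(X *\<^sub>v unit_vec m j) $ i = X $$ (i, j)" if "X \<in> carrier_mat n m" for X :: "real mat"
    using that assms(2) ij by (simp add: scalar_prod_right_unit)
  have "(A *\<^sub>v unit_vec m j) $ i = (B *\<^sub>v unit_vec m j) $ i" using assms(3) by simp
  then show "A $$ (i, j) = B $$ (i, j)" using *[OF assms(1)] *[OF assms(2)] by simp
qed (use assms in auto)

locale laplacian =
  fixes n :: nat and L :: "real mat"
  assumes n: "n > 0" and L: "L \<in> carrier_mat n n" and sym: "transpose_mat L = L"
    and kernel: "w \<in> carrier_vec n \<Longrightarrow> L *\<^sub>v w = 0\<^sub>v n \<longleftrightarrow> (\<exists>c. w = c \<cdot>\<^sub>v ones n)"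
begin

lemma total_L: assumes "v \<in> carrier_vec n" shows "total (L *\<^sub>v v) = 0"
proof -
  have "ones n = 1 \<cdot>\<^sub>v ones n" by simp
  then have "L *\<^sub>v ones n = 0\<^sub>v n" using kernel[OF ones_carrier] by blast
  then have "scalar_prod (transpose_mat L *\<^sub>v ones n) v = 0" using assms sym by simp
  then have "scalar_prod (ones n) (L *\<^sub>v v) = 0"
    using transpose_vec_mult_scalar[OF L assms ones_carrier] by simp
  moreover have Lv: "L *\<^sub>v v \<in> carrier_vec n" using L assms by simp
  ultimately show ?thesis using total_eq_scalar_prod[OF Lv] comm_scalar_prod[OF Lv ones_carrier] by simp
qed

lemma ker_orth_iff: "v \<in> ker_orth L \<longleftrightarrow> v \<in> carrier_vec n \<and> total v = 0"
proof -
  have "(\<forall>w\<in>carrier_vec n. L *\<^sub>v w = 0\<^sub>v n \<longrightarrow> scalar_prod v w = 0) \<longleftrightarrow> total v = 0" if v: "v \<in> carrier_vec n"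
  proof
    assume *: "\<forall>w\<in>carrier_vec n. L *\<^sub>v w = 0\<^sub>v n \<longrightarrow> scalar_prod v w = 0"
    have "ones n = 1 \<cdot>\<^sub>v ones n" by simp
    then have "L *\<^sub>v ones n = 0\<^sub>v n" using kernel[OF ones_carrier] by blast
    then show "total v = 0" using * total_eq_scalar_prod[OF v] by simp
  next
    assume "total v = 0"
    then have "scalar_prod v (c \<cdot>\<^sub>v ones n) = 0" for c
      using v total_eq_scalar_prod[OF v] by simp
    then show "\<forall>w\<in>carrier_vec n. L *\<^sub>v w = 0\<^sub>v n \<longrightarrow> scalar_prod v w = 0" using kernel by blast
  qed
  then show ?thesis using L unfolding ker_orth_def by auto
qed

lemma kernel_orth_eq_0:
  assumes "w \<in> carrier_vec n" "L *\<^sub>v w = 0\<^sub>v n" "total w = 0" shows "w = 0\<^sub>v n"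
proof -
  obtain c where c: "w = c \<cdot>\<^sub>v ones n" using kernel assms by blast
  then have "c = 0" using assms(3) n by (simp add: total_smult_ones)
  then show ?thesis using c by (intro eq_vecI) (auto simp: ones_def)
qed

text \<open>\<open>L + \<Pi>\<close> with the orthogonal projection \<open>\<Pi>\<close> to the constants. It acts as \<open>L\<close> on the vectors of total
zero and as the identity on the constants, hence is invertible.\<close>

definition K :: "real mat" where "K = L + avg_mat n"

lemma K [simp]: "K \<in> carrier_mat n n" using L by (simp add: K_def)

lemma K_mult: "v \<in> carrier_vec n \<Longrightarrow> K *\<^sub>v v = L *\<^sub>v v + (total v / real n) \<cdot>\<^sub>v ones n"
  unfolding K_def using L by (simp add: add_mult_distrib_mat_vec[of _ n n] avg_mat_mult)

lemma total_K: "v \<in> carrier_vec n \<Longrightarrow> total (K *\<^sub>v v) = total v"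
  using n L by (simp add: K_mult total_add[of _ n] total_L total_smult_ones)

lemma K_eq_L: assumes "v \<in> carrier_vec n" "total v = 0" shows "K *\<^sub>v v = L *\<^sub>v v"
proof -
  have "(0::real) \<cdot>\<^sub>v ones n = 0\<^sub>v n" by (intro eq_vecI) (auto simp: ones_def)
  then show ?thesis using assms L by (simp add: K_mult)
qed

lemma K_inverse: "\<exists>C\<in>carrier_mat n n. \<forall>v\<in>carrier_vec n. C *\<^sub>v (K *\<^sub>v v) = v \<and> K *\<^sub>v (C *\<^sub>v v) = v"
proof -
  have "v = 0\<^sub>v n" if v: "v \<in> carrier_vec n" "K *\<^sub>v v = 0\<^sub>v n" for v
  proof -
    have "total v = 0" using total_K[OF v(1)] v(2) by (simp add: total_def)
    then show ?thesis using kernel_orth_eq_0 K_eq_L v by simp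
  qed
  then have "Determinant.det K \<noteq> 0" using det_0_iff_vec_prod_zero[OF K] by blast
  from det_non_zero_imp_unit[OF K this, of undefined]
  obtain C where C: "C \<in> carrier_mat n n" "C * K = 1\<^sub>m n" "K * C = 1\<^sub>m n"
    unfolding Units_def by (auto simp: ring_mat_simps)
  show ?thesis
  proof (intro bexI[OF _ C(1)] ballI conjI)
    fix v :: "real vec" assume v: "v \<in> carrier_vec n"
    show "C *\<^sub>v (K *\<^sub>v v) = v" using assoc_mult_mat_vec[OF C(1) K v] C(2) v by simp
    show "K *\<^sub>v (C *\<^sub>v v) = v" using assoc_mult_mat_vec[OF K C(1) v] C(3) v by simp
  qed
qed

text \<open>\<open>(L + \<Pi>)\<^sup>-\<^sup>1 - \<Pi>\<close> has the properties demanded in the definition of \<open>inv_on_ker_orth\<close>. They determine the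
matrix, because every vector is a constant plus a vector of total zero.\<close>

lemma inv_on_ker_orth:
  shows "inv_on_ker_orth L \<in> carrier_mat n n"
    and "\<And>v. v \<in> carrier_vec n \<Longrightarrow> total v = 0 \<Longrightarrow> L *\<^sub>v (inv_on_ker_orth L *\<^sub>v v) = v"
proof -
  define P where "P B \<longleftrightarrow> B \<in> carrier_mat n n \<and> (\<forall>w\<in>carrier_vec n. L *\<^sub>v w = 0\<^sub>v n \<longrightarrow> B *\<^sub>v w = 0\<^sub>v n) \<and>
     (\<forall>v\<in>ker_orth L. B *\<^sub>v v \<in> ker_orth L \<and> L *\<^sub>v (B *\<^sub>v v) = v \<and> B *\<^sub>v (L *\<^sub>v v) = v)" for B
  have inv_eq: "inv_on_ker_orth L = (THE B. P B)"
    using L unfolding inv_on_ker_orth_def P_def by auto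
  obtain C where C: "C \<in> carrier_mat n n" "\<And>v. v \<in> carrier_vec n \<Longrightarrow> C *\<^sub>v (K *\<^sub>v v) = v"
    "\<And>v. v \<in> carrier_vec n \<Longrightarrow> K *\<^sub>v (C *\<^sub>v v) = v" using K_inverse by blast
  define B where "B = C - avg_mat n"
  have B: "B \<in> carrier_mat n n" unfolding B_def by (simp add: minus_carrier_mat)
  have B_mult: "B *\<^sub>v v = C *\<^sub>v v - (total v / real n) \<cdot>\<^sub>v ones n" if "v \<in> carrier_vec n" for v
    unfolding B_def using C that by (simp add: minus_mult_distrib_mat_vec[of _ n n] avg_mat_mult)
  have z: "(0::real) \<cdot>\<^sub>v ones n = 0\<^sub>v n" by (intro eq_vecI) (auto simp: ones_def)
  have B_orth: "B *\<^sub>v v = C *\<^sub>v v" if "v \<in> carrier_vec n" "total v = 0" for v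
    using that C(1) by (simp add: B_mult z)
  have Cc: "C *\<^sub>v v \<in> carrier_vec n" if "v \<in> carrier_vec n" for v using that C by simp
  have "P B" unfolding P_def
  proof (intro conjI B ballI impI)
    fix w assume w: "w \<in> carrier_vec n" "L *\<^sub>v w = 0\<^sub>v n"
    then obtain c where c: "w = c \<cdot>\<^sub>v ones n" using kernel by blast
    have "K *\<^sub>v w = w" using w n by (simp add: K_mult) (simp add: c total_smult_ones)
    then have "C *\<^sub>v w = w" using C(2)[OF w(1)] by simp
    then show "B *\<^sub>v w = 0\<^sub>v n" using B_mult[OF w(1)] n by (simp add: c total_smult_ones)
  next
    fix v assume "v \<in> ker_orth L"
    then have v: "v \<in> carrier_vec n" "total v = 0" using ker_orth_iff by auto
    have t: "total (C *\<^sub>v v) = 0" using total_K[OF Cc[OF v(1)]] C(3)[OF v(1)] v(2) by simp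
    show "B *\<^sub>v v \<in> ker_orth L" using t v Cc by (simp add: ker_orth_iff B_orth)
    show "L *\<^sub>v (B *\<^sub>v v) = v" using K_eq_L[OF Cc[OF v(1)] t] C(3)[OF v(1)] v by (simp add: B_orth)
    have "L *\<^sub>v v \<in> carrier_vec n" using L v by simp
    then show "B *\<^sub>v (L *\<^sub>v v) = v"
      using B_orth[of "L *\<^sub>v v"] total_L[OF v(1)] K_eq_L[OF v] C(2)[OF v(1)] by simp
  qed
  moreover have "B' = B" if "P B'" for B'
  proof (rule mat_eqI_mult_vec[OF _ B])
    show B': "B' \<in> carrier_mat n n" using that by (simp add: P_def)
    fix v :: "real vec" assume v: "v \<in> carrier_vec n"
    define m where "m = (total v / real n) \<cdot>\<^sub>v ones n"
    define w where "w = v - m"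
    have m: "m \<in> carrier_vec n" by (simp add: m_def)
    have w: "w \<in> carrier_vec n" "total w = 0" using v m n
      by (simp_all add: w_def total_diff[of _ n]) (simp add: m_def total_smult_ones)
    have vw: "v = w + m" using v m unfolding w_def by (intro eq_vecI) auto
    have Lm: "L *\<^sub>v m = 0\<^sub>v n" using kernel[OF m] by (auto simp: m_def)
    have eq: "B'' *\<^sub>v v = B'' *\<^sub>v w" if "P B''" for B''
    proof -
      have B'': "B'' \<in> carrier_mat n n" "B'' *\<^sub>v m = 0\<^sub>v n" using that Lm m unfolding P_def by auto
      then show ?thesis unfolding vw using w m by (simp add: mult_add_distrib_mat_vec[of _ n n])
    qed
    have wo: "w \<in> ker_orth L" using w ker_orth_iff by simp
    have b: "B' *\<^sub>v w \<in> carrier_vec n" "total (B' *\<^sub>v w) = 0" "L *\<^sub>v (B' *\<^sub>v w) = w"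
      "B *\<^sub>v w \<in> carrier_vec n" "total (B *\<^sub>v w) = 0" "L *\<^sub>v (B *\<^sub>v w) = w"
      using \<open>P B'\<close> \<open>P B\<close> wo ker_orth_iff unfolding P_def by auto
    define x y where "x = B' *\<^sub>v w" and "y = B *\<^sub>v w"
    have xy: "x \<in> carrier_vec n" "y \<in> carrier_vec n" using b by (simp_all add: x_def y_def)
    have "L *\<^sub>v (x - y) = 0\<^sub>v n"
      using mult_minus_distrib_mat_vec[OF L xy] b(3,6) w(1) by (simp add: x_def y_def)
    moreover have "total (x - y) = 0" using total_diff[OF xy] b(2,5) by (simp add: x_def y_def)
    ultimately have d: "x - y = 0\<^sub>v n" using kernel_orth_eq_0[of "x - y"] xy by simp
    have "x = y"
    proof (rule eq_vecI)
      fix i assume i: "i < dim_vec y"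
      have "(x - y) $ i = 0" using d xy i by simp
      then show "x $ i = y $ i" using xy i by simp
    qed (use xy in simp)
    then have "B' *\<^sub>v w = B *\<^sub>v w" by (simp add: x_def y_def)
    then show "B' *\<^sub>v v = B *\<^sub>v v" using eq \<open>P B'\<close> \<open>P B\<close> by simp
  qed
  ultimately have "P (THE B. P B)" by (intro theI[of P B])
  then have *: "P (inv_on_ker_orth L)" unfolding inv_eq .
  then show "inv_on_ker_orth L \<in> carrier_mat n n" unfolding P_def by blast
  show "L *\<^sub>v (inv_on_ker_orth L *\<^sub>v v) = v" if "v \<in> carrier_vec n" "total v = 0" for v
    using * that ker_orth_iff unfolding P_def by blast
qed

end

section \<open>The adjacency matrix of a subdivided cell\<close>

locale subgrid =
  fixes M :: "'c mesh" and c :: 'c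
  assumes orient: "m < N_sub M \<Longrightarrow> p < N_sub M \<Longrightarrow> (c, p) \<in> nbrs M c m \<Longrightarrow> direct M c p m \<longleftrightarrow> \<not> direct M c m p"
    and c: "c \<in> cells M"
begin

definition inner_nbrs :: "nat \<Rightarrow> nat set" where "inner_nbrs m = {p. (c, p) \<in> nbrs M c m}"

lemma inner_nbrs_sub: "p \<in> inner_nbrs m \<Longrightarrow> p < N_sub M" "p \<in> inner_nbrs m \<Longrightarrow> p \<noteq> m"
  by (auto simp: inner_nbrs_def nbrs_def)

lemma inner_nbrs_sym: "m < N_sub M \<Longrightarrow> p \<in> inner_nbrs m \<Longrightarrow> m \<in> inner_nbrs p"
  using c by (auto simp: inner_nbrs_def nbrs_def face_def Int_commute)

lemma finite_inner_nbrs: "finite (inner_nbrs m)"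
  using inner_nbrs_sub(1) by (intro finite_subset[of "inner_nbrs m" "{..<N_sub M}"]) auto

lemma face_sign_flip: "m < N_sub M \<Longrightarrow> p \<in> inner_nbrs m \<Longrightarrow> face_sign M c p c m = - face_sign M c m c p"
  using orient[of m p] inner_nbrs_sub(1)[of p m] by (auto simp: inner_nbrs_def face_sign_def)

lemma face_sign_nonzero: "face_sign M c m v p \<noteq> 0"
  by (simp add: face_sign_def)

lemma int_faces_iff: "(m, p) \<in> set (int_faces M c) \<longleftrightarrow> m < N_sub M \<and> m < p \<and> p \<in> inner_nbrs m"
  using inner_nbrs_sub(1)[of p m] by (auto simp: int_faces_def inner_nbrs_def)

lemma distinct_int_faces: "distinct (int_faces M c)"
  by (simp add: int_faces_def distinct_product)

lemma face_index:
  assumes m: "m < N_sub M" and p: "p \<in> inner_nbrs m"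
  shows "face_index M c m p < length (int_faces M c)"
    "int_faces M c ! face_index M c m p = (min m p, max m p)"
proof -
  have "(min m p, max m p) \<in> set (int_faces M c)"
    using m p inner_nbrs_sub[OF p] inner_nbrs_sym[OF m p] by (cases "m < p") (auto simp: int_faces_iff min_def max_def)
  then have "\<exists>!j. j < length (int_faces M c) \<and> int_faces M c ! j = (min m p, max m p)"
    using distinct_Ex1[OF distinct_int_faces] by blast
  from theI'[OF this] show "face_index M c m p < length (int_faces M c)"
    "int_faces M c ! face_index M c m p = (min m p, max m p)" unfolding face_index_def by auto
qed

lemma face_index_sym: "face_index M c m p = face_index M c p m"
  by (simp add: face_index_def min.commute max.commute)

lemma adj_mat_carrier: "Defs.adj_mat M c \<in> carrier_mat (N_sub M) (length (int_faces M c))"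
  by (simp add: Defs.adj_mat_def)

lemma adj_mat_entry:
  assumes "i < N_sub M" "j < length (int_faces M c)" "int_faces M c ! j = (m, p)"
  shows "Defs.adj_mat M c $$ (i, j) = (if i = m then face_sign M c m c p else if i = p then face_sign M c p c m else 0)"
  using assms by (simp add: Defs.adj_mat_def)

lemma adj_mat_face_index:
  assumes "m < N_sub M" "p \<in> inner_nbrs m"
  shows "Defs.adj_mat M c $$ (m, face_index M c m p) = face_sign M c m c p"
  using adj_mat_entry[OF assms(1) face_index[OF assms]] inner_nbrs_sub[OF assms(2)]
  by (auto simp: min_def max_def split: if_splits)

text \<open>Row \<open>m\<close> of the adjacency matrix is supported on the columns of the faces of \<open>m\<close>, which correspond
bijectively to the interior neighbours of \<open>m\<close>.\<close>

lemma adj_mat_mult: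
  assumes m: "m < N_sub M" and v: "v \<in> carrier_vec (length (int_faces M c))"
  shows "(Defs.adj_mat M c *\<^sub>v v) $ m = (\<Sum>p\<in>inner_nbrs m. face_sign M c m c p * v $ face_index M c m p)"
proof -
  let ?E = "length (int_faces M c)"
  have "(Defs.adj_mat M c *\<^sub>v v) $ m = (\<Sum>j<?E. Defs.adj_mat M c $$ (m, j) * v $ j)"
    using m v adj_mat_carrier by (auto simp: scalar_prod_def atLeast0LessThan intro!: sum.cong)
  also have "\<dots> = (\<Sum>j\<in>face_index M c m ` inner_nbrs m. Defs.adj_mat M c $$ (m, j) * v $ j)"
  proof (rule sum.mono_neutral_right)
    show "\<forall>j\<in>{..<?E} - face_index M c m ` inner_nbrs m. Defs.adj_mat M c $$ (m, j) * v $ j = 0"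
    proof
      fix j assume j: "j \<in> {..<?E} - face_index M c m ` inner_nbrs m"
      obtain a b where ab: "int_faces M c ! j = (a, b)" by fastforce
      then have "(a, b) \<in> set (int_faces M c)" using j by (metis DiffD1 lessThan_iff nth_mem)
      then have ab': "a < N_sub M" "a < b" "b \<in> inner_nbrs a" using int_faces_iff by auto
      have jfi: "face_index M c a b = j"
        using face_index[OF ab'(1,3)] ab j ab'(2)
          nth_eq_iff_index_eq[OF distinct_int_faces, of "face_index M c a b" j] by (simp add: min_def max_def)
      have "m \<noteq> a" using jfi j ab' by blast
      moreover have "m \<noteq> b" using jfi j face_index_sym inner_nbrs_sym[OF ab'(1,3)] by (metis DiffD2 image_eqI)
      ultimately show "Defs.adj_mat M c $$ (m, j) * v $ j = 0" using adj_mat_entry[OF m _ ab] j by simp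
    qed
  qed (use face_index[OF m] in auto)
  also have "\<dots> = (\<Sum>p\<in>inner_nbrs m. Defs.adj_mat M c $$ (m, face_index M c m p) * v $ face_index M c m p)"
  proof (rule sum.reindex[unfolded o_def])
    show "inj_on (face_index M c m) (inner_nbrs m)"
    proof (rule inj_onI)
      fix p q assume pq: "p \<in> inner_nbrs m" "q \<in> inner_nbrs m" "face_index M c m p = face_index M c m q"
      then have "min m p = min m q" "max m p = max m q"
        using face_index(2)[OF m pq(1)] face_index(2)[OF m pq(2)] by auto
      then show "p = q" by (auto simp: min_def max_def split: if_splits)
    qed
  qed
  also have "\<dots> = (\<Sum>p\<in>inner_nbrs m. face_sign M c m c p * v $ face_index M c m p)"
    by (intro sum.cong refl) (simp add: adj_mat_face_index[OF m])
  finally show ?thesis .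
qed

lemma adj_mat_transpose_mult:
  assumes j: "j < length (int_faces M c)" "int_faces M c ! j = (m, p)" and w: "w \<in> carrier_vec (N_sub M)"
  shows "(transpose_mat (Defs.adj_mat M c) *\<^sub>v w) $ j = face_sign M c m c p * (w $ m - w $ p)"
proof -
  have mp: "m < N_sub M" "m < p" "p \<in> inner_nbrs m" using int_faces_iff j by (metis nth_mem)+
  then have p: "p < N_sub M" using inner_nbrs_sub by auto
  have "(transpose_mat (Defs.adj_mat M c) *\<^sub>v w) $ j = (\<Sum>i<N_sub M. Defs.adj_mat M c $$ (i, j) * w $ i)"
    using j w adj_mat_carrier by (auto simp: scalar_prod_def atLeast0LessThan intro!: sum.cong)
  also have "\<dots> = (\<Sum>i<N_sub M. (if i = m then face_sign M c m c p * w $ m else 0) + (if i = p then face_sign M c p c m * w $ p else 0))"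
    using mp by (intro sum.cong refl) (auto simp: adj_mat_entry[OF _ j])
  also have "\<dots> = face_sign M c m c p * w $ m + face_sign M c p c m * w $ p"
    using mp p by (simp add: sum.distrib)
  finally show ?thesis using face_sign_flip[OF mp(1,3)] by (simp add: algebra_simps)
qed

text \<open>If \<open>A A\<^sup>T w = 0\<close>, then \<open>A\<^sup>T w\<close> has norm zero, so \<open>w\<close> takes equal values on neighbours; connectedness
makes it constant.\<close>

lemma laplacian_lap_mat:
  assumes conn: "subgrid_connected M c" and N: "N_sub M > 0"
  shows "laplacian (N_sub M) (lap_mat M c)"
proof
  let ?A = "Defs.adj_mat M c" and ?n = "N_sub M"
  have A: "?A \<in> carrier_mat ?n (length (int_faces M c))" by (rule adj_mat_carrier)
  then have AT: "transpose_mat ?A \<in> carrier_mat (length (int_faces M c)) ?n" by simp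
  show "lap_mat M c \<in> carrier_mat ?n ?n" using A by (simp add: lap_mat_def)
  show "transpose_mat (lap_mat M c) = lap_mat M c"
    unfolding lap_mat_def using transpose_mult[OF A AT] by simp
  fix w :: "real vec" assume w: "w \<in> carrier_vec ?n"
  have Lw: "lap_mat M c *\<^sub>v w = ?A *\<^sub>v (transpose_mat ?A *\<^sub>v w)"
    unfolding lap_mat_def using assoc_mult_mat_vec[OF A AT w] .
  have ATw: "transpose_mat ?A *\<^sub>v w \<in> carrier_vec (length (int_faces M c))" using AT w by simp
  show "lap_mat M c *\<^sub>v w = 0\<^sub>v ?n \<longleftrightarrow> (\<exists>d. w = d \<cdot>\<^sub>v ones ?n)"
  proof
    assume "lap_mat M c *\<^sub>v w = 0\<^sub>v ?n"
    then have "scalar_prod w (?A *\<^sub>v (transpose_mat ?A *\<^sub>v w)) = 0" using w unfolding Lw by simp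
    then have "scalar_prod (transpose_mat ?A *\<^sub>v w) (transpose_mat ?A *\<^sub>v w) = 0"
      using transpose_vec_mult_scalar[OF A ATw w] by simp
    then have z: "(\<Sum>j<length (int_faces M c). ((transpose_mat ?A *\<^sub>v w) $ j)\<^sup>2) = 0"
      using ATw A by (simp add: scalar_prod_def atLeast0LessThan power2_eq_square)
    have eq: "w $ m = w $ p" if "m < ?n" "m < p" "p \<in> inner_nbrs m" for m p
    proof -
      have j: "face_index M c m p < length (int_faces M c)" "int_faces M c ! face_index M c m p = (m, p)"
        using face_index[OF that(1,3)] that(2) by (auto simp: min_def max_def)
      have "(transpose_mat ?A *\<^sub>v w) $ face_index M c m p = 0"
        using z j(1) by (subst (asm) sum_nonneg_eq_0_iff) auto
      then show ?thesis using adj_mat_transpose_mult[OF j w] face_sign_nonzero by simp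
    qed
    have eq2: "w $ m = w $ p" if "m < ?n" "p \<in> inner_nbrs m" for m p
      using eq[of m p] eq[of p m] that inner_nbrs_sub[OF that(2)] inner_nbrs_sym[OF that] by (cases "m < p") auto
    have "w $ m = w $ 0" if "m < ?n" for m
    proof -
      have "(0, m) \<in> {(i, j). i < ?n \<and> (c, j) \<in> nbrs M c i}\<^sup>*"
        using conn that N unfolding subgrid_connected_def by blast
      then show ?thesis
      proof (induction rule: rtrancl_induct)
        case (step y z)
        then show ?case using eq2[of y z] by (auto simp: inner_nbrs_def)
      qed simp
    qed
    then have w0: "\<And>m. m < ?n \<Longrightarrow> w $ m = w $ 0" .
    have "w = (w $ 0) \<cdot>\<^sub>v ones ?n"
    proof (rule eq_vecI)
      fix i assume "i < dim_vec ((w $ 0) \<cdot>\<^sub>v ones ?n)"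
      then have i: "i < ?n" by (simp add: ones_def)
      show "w $ i = ((w $ 0) \<cdot>\<^sub>v ones ?n) $ i" unfolding w0[OF i] using i by (simp add: ones_def)
    qed (use w in \<open>simp add: ones_def\<close>)
    then show "\<exists>d. w = d \<cdot>\<^sub>v ones ?n" ..
  next
    assume "\<exists>d. w = d \<cdot>\<^sub>v ones ?n"
    then obtain d where d: "w = d \<cdot>\<^sub>v ones ?n" by blast
    have w_eq: "vec_index w i = d" if "i < ?n" for i using that unfolding d by (simp add: ones_def)
    have "transpose_mat ?A *\<^sub>v w = 0\<^sub>v (length (int_faces M c))"
    proof (rule eq_vecI)
      fix j assume "j < dim_vec (0\<^sub>v (length (int_faces M c)) :: real vec)"
      then have j: "j < length (int_faces M c)" by simp
      obtain m p where mp: "int_faces M c ! j = (m, p)" by fastforce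
      then have "(m, p) \<in> set (int_faces M c)" using j by (metis nth_mem)
      then have "m < ?n" "p < ?n" using int_faces_iff inner_nbrs_sub by auto
      then show "(transpose_mat ?A *\<^sub>v w) $ j = 0\<^sub>v (length (int_faces M c)) $ j"
        using adj_mat_transpose_mult[OF j mp w] j w_eq by simp
    qed (use A in simp)
    moreover have "?A *\<^sub>v 0\<^sub>v (length (int_faces M c)) = 0\<^sub>v ?n"
      using A by (intro eq_vecI) (auto simp: scalar_prod_def intro!: sum.neutral)
    ultimately show "lap_mat M c *\<^sub>v w = 0\<^sub>v ?n" unfolding Lw by simp
  qed
qed (rule N)

lemma adj_mat_correction:
  assumes conn: "subgrid_connected M c" and N: "N_sub M > 0"
    and F: "F \<in> carrier_vec (length (int_faces M c))"
    and G: "G \<in> carrier_vec (N_sub M)" "total G = 0"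
  shows "F - transpose_mat (Defs.adj_mat M c) *\<^sub>v (inv_on_ker_orth (lap_mat M c) *\<^sub>v G) \<in> carrier_vec (length (int_faces M c))"
    and "Defs.adj_mat M c *\<^sub>v (F - transpose_mat (Defs.adj_mat M c) *\<^sub>v (inv_on_ker_orth (lap_mat M c) *\<^sub>v G))
      = Defs.adj_mat M c *\<^sub>v F - G"
proof -
  interpret laplacian "N_sub M" "lap_mat M c" using laplacian_lap_mat[OF conn N] .
  let ?A = "Defs.adj_mat M c" and ?x = "inv_on_ker_orth (lap_mat M c) *\<^sub>v G"
  have x: "?x \<in> carrier_vec (N_sub M)" using inv_on_ker_orth(1) G by simp
  have AT: "transpose_mat ?A \<in> carrier_mat (length (int_faces M c)) (N_sub M)" using adj_mat_carrier by simp
  have y: "transpose_mat ?A *\<^sub>v ?x \<in> carrier_vec (length (int_faces M c))" using AT x by simp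
  show "F - transpose_mat ?A *\<^sub>v ?x \<in> carrier_vec (length (int_faces M c))" using F y by simp
  have "?A *\<^sub>v (transpose_mat ?A *\<^sub>v z) = lap_mat M c *\<^sub>v z" if "z \<in> carrier_vec (N_sub M)" for z
    unfolding lap_mat_def using assoc_mult_mat_vec[OF adj_mat_carrier AT that] by simp
  from this[OF x] show "?A *\<^sub>v (F - transpose_mat ?A *\<^sub>v ?x) = ?A *\<^sub>v F - G"
    using mult_minus_distrib_mat_vec[OF adj_mat_carrier F y] inv_on_ker_orth(2)[OF G] by simp
qed

end

section \<open>Geometry of the subdivision\<close>

lemma segment_on_line:
  fixes a b :: point
  shows "\<exists>L. affine L \<and> aff_dim L = 1 \<and> closed_segment a b \<subseteq> L"
proof -
  \<comment> \<open>A degenerate segment is put on a horizontal line.\<close>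
  define d where "d = (if a = b then a + (1, 0) else b)"
  have "a \<noteq> d" by (auto simp: d_def prod_eq_iff)
  then have "aff_dim (affine hull {a, d}) = 1" by (simp add: aff_dim_affine_hull)
  moreover have "closed_segment a b \<subseteq> affine hull {a, d}"
  proof (cases "a = b")
    case True then show ?thesis by (simp add: hull_inc)
  next
    case False
    then show ?thesis using convex_hull_subset_affine_hull[of "{a, b}"] by (simp add: segment_convex_hull d_def)
  qed
  ultimately show ?thesis using affine_affine_hull by blast
qed

lemma polygonal_lines:
  assumes "finite \<S>" "\<And>S. S \<in> \<S> \<Longrightarrow> polygonal S"
  shows "\<exists>\<L>. line_family \<L> \<and> (\<forall>S\<in>\<S>. frontier S \<subseteq> \<Union>\<L>)"
proof -
  have "\<exists>A. finite A \<and> frontier S \<subseteq> (\<Union>(a, b)\<in>A. closed_segment a b)" if "S \<in> \<S>" for S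
    using assms(2)[OF that] unfolding polygonal_def by blast
  then obtain A where A: "\<And>S. S \<in> \<S> \<Longrightarrow> finite (A S)"
    "\<And>S. S \<in> \<S> \<Longrightarrow> frontier S \<subseteq> (\<Union>(a, b)\<in>A S. closed_segment a b)" by metis
  define l where "l a b = (SOME L. affine L \<and> aff_dim L = 1 \<and> closed_segment a b \<subseteq> L)" for a b :: point
  have l: "affine (l a b) \<and> aff_dim (l a b) = 1 \<and> closed_segment a b \<subseteq> l a b" for a b
    unfolding l_def by (rule someI_ex[OF segment_on_line])
  define \<L> where "\<L> = (\<Union>S\<in>\<S>. (\<lambda>(a, b). l a b) ` A S)"
  have "line_family \<L>"
  proof
    show "finite \<L>" unfolding \<L>_def using A assms(1) by (intro finite_UN_I) auto
    show "affine L \<and> aff_dim L = 1" if "L \<in> \<L>" for L using that l unfolding \<L>_def by auto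
  qed
  moreover have "frontier S \<subseteq> \<Union>\<L>" if S: "S \<in> \<S>" for S
  proof
    fix x assume "x \<in> frontier S"
    then have "x \<in> (\<Union>(a, b)\<in>A S. closed_segment a b)" using A(2)[OF S] by blast
    then obtain p where p: "p \<in> A S" "x \<in> closed_segment (fst p) (snd p)" by (auto simp: case_prod_unfold)
    have "x \<in> l (fst p) (snd p)" using p(2) l by blast
    moreover have "l (fst p) (snd p) \<in> \<L>" using p(1) S unfolding \<L>_def by (force simp: case_prod_unfold)
    ultimately show "x \<in> \<Union>\<L>" by blast
  qed
  ultimately show ?thesis by blast
qed

context line_family begin

lemma regularI: "polygonal S \<Longrightarrow> frontier S \<subseteq> \<Union>\<L> \<Longrightarrow> regular S"
  unfolding regular_def polygonal_def by auto

lemma regular_frontier_sub: "regular S \<Longrightarrow> frontier S \<subseteq> \<Union>\<L>"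
  unfolding regular_def by auto

lemma null_frontier: assumes "regular S" shows "frontier S \<in> null_sets lborel"
proof -
  have "negligible L" if L: "L \<in> \<L>" for L
  proof -
    have "nrm L \<noteq> 0" using norm_nrm[OF L] by auto
    then have "negligible {x. inner (nrm L) x = inner (nrm L) (fst (chosen L))}"
      by (intro negligible_hyperplane) simp
    moreover have "L \<subseteq> {x. inner (nrm L) x = inner (nrm L) (fst (chosen L))}"
      using line_iff[OF L] L by (auto simp: inner_diff_left inner_commute)
    ultimately show ?thesis by (rule negligible_subset)
  qed
  then have "negligible (\<Union>\<L>)" using finite_lines by (intro negligible_Union) auto
  then have "negligible (frontier S)" using regular_frontier_sub[OF assms] negligible_subset by blast
  then show ?thesis
    using null_sets_completion_iff[of "frontier S" lborel] by (simp add: negligible_iff_null_sets borel_closed)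
qed

lemma arc_integrable_mult_continuous:
  assumes h: "arc_integrable h" and K: "compact K" "\<And>x. x \<notin> K \<Longrightarrow> h x = 0" and f: "continuous_on UNIV f"
  shows "arc_integrable (\<lambda>x. f x * h x)"
proof -
  have "compact (f ` K)" using continuous_on_subset[OF f] K(1) by (intro compact_continuous_image) auto
  then obtain B where B: "\<And>x. x \<in> K \<Longrightarrow> \<bar>f x\<bar> \<le> B" using compact_imp_bounded[of "f ` K"] unfolding bounded_real by auto
  have "closed K" using K(1) by (rule compact_imp_closed)
  then have "(\<lambda>x. indicator K x * f x) \<in> borel_measurable borel"
    using borel_measurable_continuous_onI[OF f] by (intro borel_measurable_times borel_measurable_indicator borel_closed)
  moreover have "\<bar>indicator K x * f x\<bar> \<le> \<bar>B\<bar>" for x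
    using B[of x] by (cases "x \<in> K") auto
  ultimately have "arc_integrable (\<lambda>x. (indicator K x * f x) * h x)" by (rule arc_integrable_mult[OF h])
  moreover have "(\<lambda>x. (indicator K x * f x) * h x) = (\<lambda>x. f x * h x)"
    using K(2) by (auto simp: indicator_def fun_eq_iff)
  ultimately show ?thesis by simp
qed

end

lemma interior_disjoint_closure:
  assumes "interior S \<inter> interior T = {}" "T = closure (interior T)" shows "interior S \<inter> T = {}"
  using open_Int_closure_eq_empty[OF open_interior, of S "interior T"] assms by simp

text \<open>A family of lines carrying the boundaries of all cells and subcells of the mesh, so that the local
picture at a generic point is available for all of them simultaneously.\<close>

locale mesh_lines = line_family \<L> for \<L> +
  fixes M :: "'c mesh" and c :: 'c
  assumes valid: "valid_mesh M" and c: "c \<in> cells M" and cover: "faces_cover M c"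
    and frontiers: "\<And>v. v \<in> cells M \<Longrightarrow> frontier (cell M v) \<subseteq> \<Union>\<L>"
      "\<And>v p. v \<in> cells M \<Longrightarrow> p < N_sub M \<Longrightarrow> frontier (subcell M v p) \<subseteq> \<Union>\<L>"
begin

abbreviation D :: "point set" where "D \<equiv> cell M c"
abbreviation S :: "nat \<Rightarrow> point set" where "S \<equiv> subcell M c"
abbreviation N :: nat where "N \<equiv> N_sub M"

lemmas valid_cells = valid[unfolded valid_mesh_def, THEN conjunct2, THEN conjunct1, rule_format]
lemmas valid_disjoint = valid[unfolded valid_mesh_def, THEN conjunct2, THEN conjunct2, THEN conjunct1, rule_format]
lemmas valid_subcells = bspec[OF valid[unfolded valid_mesh_def, THEN conjunct2, THEN conjunct2, THEN conjunct2]]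

lemma cell_UN: "v \<in> cells M \<Longrightarrow> cell M v = (\<Union>p<N. subcell M v p)"
  by (rule conjunct1[OF valid_subcells])

lemma subcell_sub_cell: "v \<in> cells M \<Longrightarrow> p < N \<Longrightarrow> subcell M v p \<subseteq> cell M v"
  unfolding cell_UN by blast

lemma polygonal_subcell: "v \<in> cells M \<Longrightarrow> p < N \<Longrightarrow> polygonal (subcell M v p)"
  using conjunct1[OF conjunct2[OF valid_subcells]] by blast

lemma regular_cell: "v \<in> cells M \<Longrightarrow> regular (cell M v)"
  by (intro regularI valid_cells frontiers)

lemma regular_subcell: "v \<in> cells M \<Longrightarrow> p < N \<Longrightarrow> regular (subcell M v p)"
  by (intro regularI polygonal_subcell frontiers)

lemmas regular_D = regular_cell[OF c]
lemmas regular_S = regular_subcell[OF c]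

lemma compact_D: "compact D" using regular_D unfolding regular_def by blast
lemma compact_S: "m < N \<Longrightarrow> compact (S m)" using regular_S unfolding regular_def by blast

lemma S_pos: "m < N \<Longrightarrow> measure lborel (S m) > 0"
  using conjunct1[OF conjunct2[OF valid_subcells[OF c]]] by blast

lemma N_pos: "N > 0" by (simp add: dim_Pk_def)

lemma D_interior: "interior D \<noteq> {}"
proof
  assume "interior D = {}"
  then have "D = {}" using regular_D unfolding regular_def by simp
  then have "S 0 = {}" using subcell_sub_cell[OF c N_pos] by simp
  then show False using S_pos[OF N_pos] by simp
qed

lemma subcells_disjoint:
  assumes "v \<in> cells M" "v' \<in> cells M" "p < N" "p' < N" "(v, p) \<noteq> (v', p')"
  shows "interior (subcell M v p) \<inter> interior (subcell M v' p') = {}"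
proof (cases "v = v'")
  case True
  then show ?thesis
    using conjunct1[OF conjunct2[OF conjunct2[OF valid_subcells[OF assms(1)]]]] assms by blast
next
  case False
  have "interior (cell M v) \<inter> interior (cell M v') = {}"
    using valid_disjoint assms False by blast
  then show ?thesis
    using interior_mono[OF subcell_sub_cell[OF assms(1,3)]] interior_mono[OF subcell_sub_cell[OF assms(2,4)]] by blast
qed

lemma subcell_cell_disjoint:
  assumes "v \<in> cells M" "p < N" "v \<noteq> c"
  shows "interior (subcell M v p) \<inter> interior D = {}"
proof -
  have "interior (cell M v) \<inter> interior D = {}"
    using valid_disjoint assms c by blast
  then show ?thesis using interior_mono[OF subcell_sub_cell[OF assms(1,2)]] by blast
qed

lemma nbrsD:
  assumes "(v, p) \<in> nbrs M c m" shows "v \<in> cells M" "p < N" "(v, p) \<noteq> (c, m)"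
  using assms by (auto simp: nbrs_def)

lemma finite_nbrs: "finite (nbrs M c m)"
proof (rule finite_subset)
  show "nbrs M c m \<subseteq> cells M \<times> {..<N}" by (auto simp: nbrs_def)
  show "finite (cells M \<times> {..<N})" using valid by (simp add: valid_mesh_def)
qed

lemma face_sub_frontier:
  assumes m: "m < N" and vp: "(v, p) \<in> nbrs M c m" shows "face M c m v p \<subseteq> frontier (S m)"
proof -
  have cl: "subcell M v p = closure (interior (subcell M v p))"
    using regular_subcell[OF nbrsD(1,2)[OF vp]] unfolding regular_def by blast
  have "interior (S m) \<inter> interior (subcell M v p) = {}"
    by (rule subcells_disjoint[OF c nbrsD(1)[OF vp] m nbrsD(2)[OF vp] nbrsD(3)[OF vp, THEN not_sym]])
  then have "interior (S m) \<inter> subcell M v p = {}" by (rule interior_disjoint_closure[OF _ cl])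
  then have "face M c m v p \<subseteq> S m - interior (S m)" unfolding face_def by blast
  moreover have "frontier (S m) = S m - interior (S m)"
    using regular_closed[OF regular_S[OF m]] by (simp add: frontier_def)
  ultimately show ?thesis by simp
qed

lemma face_sub_lines: "m < N \<Longrightarrow> (v, p) \<in> nbrs M c m \<Longrightarrow> face M c m v p \<subseteq> \<Union>\<L>"
  using face_sub_frontier frontiers(2)[OF c] by blast

lemma closed_face:
  assumes m: "m < N" and vp: "(v, p) \<in> nbrs M c m" shows "closed (face M c m v p)"
  unfolding face_def
  by (intro closed_Int regular_closed regular_S[OF m] regular_subcell nbrsD(1)[OF vp] nbrsD(2)[OF vp])

text \<open>At a generic point of a face the two subcells occupy opposite sides, since their interiors are
disjoint.\<close>

lemma face_sides:
  assumes m: "m < N" and vp: "(v, p) \<in> nbrs M c m" and x: "x \<notin> vertices" "x \<in> face M c m v p"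
  obtains n where "normal_to x n" "on_side (S m) x (- n)" "\<not> on_side (S m) x n"
    "on_side (subcell M v p) x n" "\<not> on_side (subcell M v p) x (- n)"
proof -
  have "x \<in> frontier (S m)" using face_sub_frontier[OF m vp] x by blast
  then obtain n where n: "normal_to x n" "on_side (S m) x (- n)" "\<not> on_side (S m) x n"
    using frontier_normal_to[OF regular_S[OF m]] x by blast
  have "interior (S m) \<inter> interior (subcell M v p) = {}"
    by (rule subcells_disjoint[OF c nbrsD(1)[OF vp] m nbrsD(2)[OF vp] nbrsD(3)[OF vp, THEN not_sym]])
  then have "\<not> on_side (subcell M v p) x (- n)"
    using disjoint_interiors_on_side[OF normal_to_uminus[OF n(1)]] n(2) by blast
  moreover have "x \<in> subcell M v p" using x by (simp add: face_def)
  ultimately show ?thesis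
    using mem_iff_on_side[OF n(1) regular_subcell[OF nbrsD(1,2)[OF vp]]] n that by blast
qed

text \<open>Two different neighbours meeting \<open>S m\<close> at a generic point would both occupy the side that \<open>S m\<close>
leaves free.\<close>

lemma faces_partition_frontier:
  assumes m: "m < N" and x: "x \<notin> vertices"
  shows "indicator (frontier (S m)) x = (\<Sum>(v, p)\<in>nbrs M c m. indicator (face M c m v p) x :: real)"
proof (cases "x \<in> frontier (S m)")
  case False
  then have "(\<Sum>(v, p)\<in>nbrs M c m. indicator (face M c m v p) x :: real) = 0"
  proof (intro sum.neutral ballI)
    fix vp assume "vp \<in> nbrs M c m"
    then have "face M c m (fst vp) (snd vp) \<subseteq> frontier (S m)" using face_sub_frontier[OF m] by simp
    then show "(case vp of (v, p) \<Rightarrow> indicator (face M c m v p) x) = (0::real)"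
      using False by (auto simp: indicator_def case_prod_unfold)
  qed
  then show ?thesis using False by simp
next
  case True
  then have "x \<in> (\<Union>(v, p)\<in>nbrs M c m. face M c m v p)" using cover m unfolding faces_cover_def by blast
  then obtain v0 p0 where vp0: "(v0, p0) \<in> nbrs M c m" "x \<in> face M c m v0 p0" by auto
  have uniq: "(v, p) = (v0, p0)" if vp: "(v, p) \<in> nbrs M c m" "x \<in> face M c m v p" for v p
  proof (rule ccontr)
    assume ne: "(v, p) \<noteq> (v0, p0)"
    obtain n where n: "normal_to x n" "on_side (S m) x (- n)" "\<not> on_side (S m) x n" "on_side (subcell M v p) x n"
      using face_sides[OF m vp(1) x vp(2)] by blast
    obtain n0 where n0: "normal_to x n0" "on_side (S m) x (- n0)" "\<not> on_side (S m) x n0" "on_side (subcell M v0 p0) x n0"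
      using face_sides[OF m vp0(1) x vp0(2)] by blast
    have "n0 = n" using normal_to_exhaust[OF n(1) n0(1)] n n0 by auto
    then show False
      using disjoint_interiors_on_side[OF n(1) subcells_disjoint[OF nbrsD(1)[OF vp(1)] nbrsD(1)[OF vp0(1)]
        nbrsD(2)[OF vp(1)] nbrsD(2)[OF vp0(1)] ne]] n(4) n0(4) by simp
  qed
  have "(\<Sum>(v, p)\<in>nbrs M c m. indicator (face M c m v p) x :: real) = (\<Sum>vp\<in>nbrs M c m. if vp = (v0, p0) then 1 else 0)"
  proof (rule sum.cong[OF refl])
    fix vp assume vp: "vp \<in> nbrs M c m"
    have "x \<in> face M c m (fst vp) (snd vp) \<longleftrightarrow> vp = (v0, p0)"
      using uniq[of "fst vp" "snd vp"] vp vp0(2) by (cases vp) auto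
    then show "(case vp of (v, p) \<Rightarrow> indicator (face M c m v p) x) = (if vp = (v0, p0) then 1 else (0::real))"
      by (simp add: indicator_def case_prod_unfold)
  qed
  then show ?thesis using True vp0(1) finite_nbrs by simp
qed

text \<open>Across a face inside the cell both sides belong to the cell.\<close>

lemma interior_face:
  assumes m: "m < N" and p: "(c, p) \<in> nbrs M c m" and x: "x \<notin> vertices" "x \<in> face M c m c p"
  shows "x \<notin> frontier D" "bnormal (S p) x = - bnormal (S m) x"
proof -
  obtain n where n: "normal_to x n" "on_side (S m) x (- n)" "\<not> on_side (S m) x n"
    "on_side (S p) x n" "\<not> on_side (S p) x (- n)" using face_sides[OF m p x] by blast
  have "on_side D x n" "on_side D x (- n)"
    using n on_side_mono[OF _ subcell_sub_cell[OF c m]] on_side_mono[OF _ subcell_sub_cell[OF c nbrsD(2)[OF p]]] by simp_all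
  then show "x \<notin> frontier D" using frontier_iff_on_side[OF n(1) regular_D] by blast
  have "bnormal (S m) x = n" using bnormal_on_side[OF n(1) regular_S[OF m] n(2,3)] .
  moreover have "bnormal (S p) x = - n"
    using bnormal_on_side[OF normal_to_uminus[OF n(1)] regular_S[OF nbrsD(2)[OF p]]] n by simp
  ultimately show "bnormal (S p) x = - bnormal (S m) x" by simp
qed

text \<open>The neighbour on the far side belongs to another cell, which shares no interior point with \<open>D\<close>; so
\<open>D\<close> and \<open>S m\<close> occupy the same single side.\<close>

lemma boundary_face:
  assumes m: "m < N" and vp: "(v, p) \<in> nbrs M c m" "v \<noteq> c" and x: "x \<notin> vertices" "x \<in> face M c m v p"
  shows "x \<in> frontier D" "bnormal D x = bnormal (S m) x"
proof -
  obtain n where n: "normal_to x n" "on_side (S m) x (- n)" "\<not> on_side (S m) x n"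
    "on_side (subcell M v p) x n" "\<not> on_side (subcell M v p) x (- n)" using face_sides[OF m vp(1) x] by blast
  have D: "on_side D x (- n)" using on_side_mono[OF n(2) subcell_sub_cell[OF c m]] .
  have D': "\<not> on_side D x n"
    using disjoint_interiors_on_side[OF n(1) subcell_cell_disjoint[OF nbrsD(1,2)[OF vp(1)] vp(2)]] n(4) by blast
  show "x \<in> frontier D" using frontier_iff_on_side[OF n(1) regular_D] D D' by blast
  show "bnormal D x = bnormal (S m) x"
    using bnormal_on_side[OF n(1) regular_D D D'] bnormal_on_side[OF n(1) regular_S[OF m] n(2,3)] by simp
qed

definition outer :: "nat \<Rightarrow> ('c \<times> nat) set" where "outer m = {(v, p) \<in> nbrs M c m. v \<noteq> c}"

lemma finite_outer: "finite (outer m)"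
  using finite_nbrs by (rule finite_subset[rotated]) (auto simp: outer_def)

lemma outer_faces_partition:
  assumes m: "m < N" and x: "x \<notin> vertices"
  shows "indicator (frontier D) x * indicator (frontier (S m)) x = (\<Sum>(v, p)\<in>outer m. indicator (face M c m v p) x :: real)"
proof -
  have "indicator (frontier D) x * indicator (frontier (S m)) x =
      (\<Sum>(v, p)\<in>nbrs M c m. indicator (frontier D) x * indicator (face M c m v p) x :: real)"
    unfolding faces_partition_frontier[OF m x] by (simp add: sum_distrib_left case_prod_unfold)
  also have "\<dots> = (\<Sum>vp\<in>nbrs M c m. if fst vp \<noteq> c then indicator (face M c m (fst vp) (snd vp)) x else 0)"
  proof (rule sum.cong[OF refl])
    fix vp assume vp: "vp \<in> nbrs M c m"
    obtain v p where [simp]: "vp = (v, p)" by (cases vp)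
    show "(case vp of (v, p) \<Rightarrow> indicator (frontier D) x * indicator (face M c m v p) x) =
        (if fst vp \<noteq> c then indicator (face M c m (fst vp) (snd vp)) x else (0::real))"
    proof (cases "x \<in> face M c m v p")
      case True
      show ?thesis
      proof (cases "v = c")
        case True
        then show ?thesis using interior_face(1)[OF m _ x, of p] vp \<open>x \<in> face M c m v p\<close> by simp
      next
        case False
        then show ?thesis using boundary_face(1)[OF m _ False x, of p] vp True by simp
      qed
    qed simp
  qed
  also have "\<dots> = (\<Sum>vp\<in>outer m. indicator (face M c m (fst vp) (snd vp)) x)"
    unfolding sum.inter_filter[OF finite_nbrs, symmetric] outer_def by (simp add: case_prod_unfold)
  finally show ?thesis by (simp add: case_prod_unfold)
qed

text \<open>Just inside \<open>D\<close> exactly one subcell is present, and none is present outside.\<close>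

lemma subcell_frontiers_partition:
  assumes x: "x \<notin> vertices" "x \<in> frontier D"
  shows "(\<Sum>m<N. indicator (frontier (S m)) x) = (1::real)"
proof -
  obtain n where n: "normal_to x n" "on_side D x (- n)" "\<not> on_side D x n"
    using frontier_normal_to[OF regular_D x(2,1)] by blast
  have UN: "on_side D x k \<longleftrightarrow> (\<exists>m\<in>{..<N}. on_side (S m) x k)" if "normal_to x k" for k
    unfolding cell_UN[OF c] using on_side_UN_iff[OF that, of "{..<N}" S] regular_S by simp
  obtain m0 where m0: "m0 < N" "on_side (S m0) x (- n)" using UN[OF normal_to_uminus[OF n(1)]] n(2) by auto
  have "x \<in> frontier (S m) \<longleftrightarrow> m = m0" if m: "m < N" for m
  proof -
    have "\<not> on_side (S m) x n" using UN[OF n(1)] n(3) m by auto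
    then have "x \<in> frontier (S m) \<longleftrightarrow> on_side (S m) x (- n)" using frontier_iff_on_side[OF n(1) regular_S[OF m]] by blast
    also have "\<dots> \<longleftrightarrow> m = m0"
      using disjoint_interiors_on_side[OF normal_to_uminus[OF n(1)] subcells_disjoint[OF c c m m0(1)]] m0(2) by auto
    finally show ?thesis .
  qed
  then have "(\<Sum>m<N. indicator (frontier (S m)) x) = (\<Sum>m<N. if m = m0 then 1 else (0::real))"
    by (intro sum.cong) (auto simp: indicator_def)
  then show ?thesis using m0(1) by simp
qed

lemma integral_subcells:
  fixes f :: "point \<Rightarrow> real"
  assumes f: "continuous_on UNIV f"
  shows "(LINT x:D|lborel. f x) = (\<Sum>m<N. LINT x:S m|lborel. f x)"
proof -
  have int: "integrable lborel (\<lambda>x. indicator (S m) x *\<^sub>R f x)" if "m < N" for m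
    using set_integrable_continuous[OF compact_S[OF that] continuous_on_subset[OF f]] unfolding set_integrable_def by simp
  have intD: "integrable lborel (\<lambda>x. indicator D x *\<^sub>R f x)"
    using set_integrable_continuous[OF compact_D continuous_on_subset[OF f]] unfolding set_integrable_def by simp
  have "(\<Union>m<N. frontier (S m)) \<in> null_sets lborel"
    using null_frontier regular_S by (intro null_sets_UN') auto
  then have "AE x in lborel. x \<notin> (\<Union>m<N. frontier (S m))" by (rule AE_not_in)
  then have AE: "AE x in lborel. indicator D x *\<^sub>R f x = (\<Sum>m<N. indicator (S m) x *\<^sub>R f x)"
  proof eventually_elim
    fix x assume x: "x \<notin> (\<Union>m<N. frontier (S m))"
    have int: "x \<in> interior (S m)" if "m < N" "x \<in> S m" for m
      using x that closure_subset[of "S m"] by (auto simp: frontier_def)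
    have "indicator D x = (\<Sum>m<N. indicator (S m) x :: real)"
    proof (cases "x \<in> D")
      case False
      then show ?thesis unfolding cell_UN[OF c] by (auto simp: indicator_def intro!: sum.neutral[symmetric])
    next
      case True
      then obtain m0 where m0: "m0 < N" "x \<in> S m0" unfolding cell_UN[OF c] by blast
      have "x \<notin> S m" if "m < N" "m \<noteq> m0" for m
        using int[OF that(1)] int[OF m0] subcells_disjoint[OF c c that(1) m0(1)] that(2) by blast
      then have "(\<Sum>m<N. indicator (S m) x :: real) = (\<Sum>m<N. if m = m0 then 1 else 0)"
        using m0 by (intro sum.cong) (auto simp: indicator_def)
      then show ?thesis using m0 True by simp
    qed
    then show "indicator D x *\<^sub>R f x = (\<Sum>m<N. indicator (S m) x *\<^sub>R f x)"
      by (simp add: sum_distrib_right)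
  qed
  have "(LINT x:D|lborel. f x) = (\<integral>x. (\<Sum>m<N. indicator (S m) x *\<^sub>R f x) \<partial>lborel)"
    unfolding set_lebesgue_integral_def using intD int AE
    by (intro integral_cong_AE borel_measurable_integrable Bochner_Integration.integrable_sum) auto
  also have "\<dots> = (\<Sum>m<N. LINT x:S m|lborel. f x)"
    unfolding set_lebesgue_integral_def using int by (intro Bochner_Integration.integral_sum) auto
  finally show ?thesis .
qed

abbreviation k :: nat where "k \<equiv> deg M"
abbreviation \<phi> :: "nat \<Rightarrow> point \<Rightarrow> real" where "\<phi> \<equiv> subres_basis M c"

text \<open>The definite description in \<open>subres_basis\<close> denotes because integration over \<open>S m\<close> is a linear
functional.\<close>

lemma subres_basis:
  assumes m: "m < N"
  shows "\<phi> m \<in> Pk k" "\<And>\<psi>. \<psi> \<in> Pk k \<Longrightarrow> (LINT x:D|lborel. \<phi> m x * \<psi> x) = (LINT x:S m|lborel. \<psi> x)"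
proof -
  have "linear_fnl (Pk k) (\<lambda>\<psi>. LINT x:S m|lborel. 1 * \<psi> x)"
    by (rule linear_fnl_L2[OF compact_S[OF m] Pk_const])
  then have "linear_fnl (Pk k) (\<lambda>\<psi>. LINT x:S m|lborel. \<psi> x)" by simp
  from theI'[OF riesz_Pk[OF compact_D D_interior this]]
  show "\<phi> m \<in> Pk k" "\<And>\<psi>. \<psi> \<in> Pk k \<Longrightarrow> (LINT x:D|lborel. \<phi> m x * \<psi> x) = (LINT x:S m|lborel. \<psi> x)"
    unfolding subres_basis_def[symmetric] by auto
qed

text \<open>Both sides represent the functional of integration over \<open>D\<close>, as the subcells overlap only in null
sets.\<close>

lemma sum_subres_basis: "(\<Sum>m<N. \<phi> m x) = 1"
proof -
  define d where "d = (\<lambda>x. (\<Sum>m<N. \<phi> m x) - 1)"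
  have s: "(\<lambda>x. \<Sum>m<N. \<phi> m x) \<in> Pk k" using subres_basis(1) by (intro Pk_sum) auto
  have d: "d \<in> Pk k" unfolding d_def by (rule Pk_diff[OF s Pk_const])
  have cont: "continuous_on A d" for A using Pk_continuous[OF d] .
  have int: "set_integrable lborel D (\<lambda>x. \<phi> m x * d x)" if "m < N" for m
    using subres_basis(1)[OF that] by (intro set_integrable_continuous compact_D continuous_intros Pk_continuous[of "\<phi> m" k] cont)
  have "(LINT x:D|lborel. d x * d x) = (LINT x:D|lborel. (\<Sum>m<N. \<phi> m x * d x) - d x)"
    by (simp add: d_def left_diff_distrib sum_distrib_right)
  also have "\<dots> = (LINT x:D|lborel. \<Sum>m<N. \<phi> m x * d x) - (LINT x:D|lborel. d x)"
    using subres_basis(1)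
    by (intro set_integral_diff(2) set_integrable_continuous compact_D continuous_intros Pk_continuous[of "\<phi> m" k for m] cont) auto
  also have "(LINT x:D|lborel. \<Sum>m<N. \<phi> m x * d x) = (\<Sum>m<N. LINT x:D|lborel. \<phi> m x * d x)"
    using int unfolding set_lebesgue_integral_def set_integrable_def scaleR_sum_right
    by (intro Bochner_Integration.integral_sum) simp
  also have "\<dots> = (\<Sum>m<N. LINT x:S m|lborel. d x)" using subres_basis(2)[OF _ d] by simp
  also have "\<dots> = (LINT x:D|lborel. d x)" using integral_subcells[OF cont] by simp
  finally have "d = (\<lambda>x. 0)" using Pk_square_integral_eq_0[OF compact_D D_interior d] by simp
  then have "d x = 0" by simp
  then show ?thesis by (simp add: d_def)
qed

end

context mesh_lines begin

sublocale subgrid M c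
proof
  fix m p assume "m < N" "p < N" "(c, p) \<in> nbrs M c m"
  then show "direct M c p m \<longleftrightarrow> \<not> direct M c m p"
    using conjunct2[OF conjunct2[OF conjunct2[OF valid_subcells[OF c]]]] by blast
qed (rule c)

lemma arc_integrable_indicator:
  assumes "closed E" "arc_integrable f" shows "arc_integrable (\<lambda>x. indicator E x * f x)"
proof (rule arc_integrable_mult[OF assms(2), where B = 1])
  show "(indicator E :: point \<Rightarrow> real) \<in> borel_measurable borel"
    using assms(1) by (intro borel_measurable_indicator borel_closed)
qed (simp add: indicator_def)

lemma measure_D_pos: "measure lborel D > 0"
proof -
  have "measure lborel (S 0) \<le> measure lborel D"
    using compact_D compact_S[OF N_pos] subcell_sub_cell[OF c N_pos]
    by (intro measure_mono_fmeasurable fmeasurable_compact) (auto simp: compact_imp_closed borel_closed)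
  then show ?thesis using S_pos[OF N_pos] by linarith
qed

lemma sum_nbrs_split:
  "(\<Sum>(v, p)\<in>nbrs M c m. f v p) = (\<Sum>p\<in>inner_nbrs m. f c p) + (\<Sum>(v, p)\<in>outer m. f v p :: real)"
proof -
  have "nbrs M c m = Pair c ` inner_nbrs m \<union> outer m" by (auto simp: inner_nbrs_def outer_def)
  then have "(\<Sum>(v, p)\<in>nbrs M c m. f v p) = (\<Sum>(v, p)\<in>Pair c ` inner_nbrs m \<union> outer m. f v p)" by (rule arg_cong)
  also have "\<dots> = (\<Sum>(v, p)\<in>Pair c ` inner_nbrs m. f v p) + (\<Sum>(v, p)\<in>outer m. f v p)"
    by (rule sum.union_disjoint[OF finite_imageI[OF finite_inner_nbrs] finite_outer]) (auto simp: outer_def)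
  also have "(\<Sum>(v, p)\<in>Pair c ` inner_nbrs m. f v p) = (\<Sum>p\<in>inner_nbrs m. f c p)"
    by (subst sum.reindex) (auto simp: inj_on_def)
  finally show ?thesis .
qed

lemma inner_nbrs_iff: "p \<in> inner_nbrs m \<longleftrightarrow> (c, p) \<in> nbrs M c m" by (simp add: inner_nbrs_def)

end

section \<open>Fluxes of a cell\<close>

text \<open>\<open>q\<close> stands for the projected flux and \<open>g\<close> for the numerical flux on the boundary of the cell.\<close>

locale cell_fluxes = mesh_lines +
  fixes q :: "point \<Rightarrow> point" and g :: "point \<Rightarrow> real"
  assumes q: "q \<in> Pk_vec (deg M + 1)" and g: "bd_integrable (frontier (cell M c)) g"
begin

definition g_bd :: "point \<Rightarrow> real" where "g_bd x = indicator (frontier D) x * g x"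
text \<open>The integrand that the correction vector weights with the modified sub-resolution functions.\<close>

definition flux_gap :: "point \<Rightarrow> real" where "flux_gap x = inner (q x) (bnormal D x) - g_bd x"
definition face_flux :: "nat \<Rightarrow> 'a \<Rightarrow> nat \<Rightarrow> real" where
  "face_flux m v p = bd_integral (face M c m v p) (\<lambda>x. inner (q x) (outward_normal (S m) x))"
definition face_g :: "nat \<Rightarrow> 'a \<Rightarrow> nat \<Rightarrow> real" where
  "face_g m v p = bd_integral (face M c m v p) g"
definition bd_corr :: "nat \<Rightarrow> real" where
  "bd_corr m = bd_integral (frontier D) (\<lambda>x. subres_basis_mod M c m x * (inner (q x) (outward_normal D x) - g x))"

lemma q_cont: "continuous_on A q" using Pk_vec_continuous[OF q] .

lemma frontier_D_sub: "frontier D \<subseteq> \<Union>\<L>" using regular_frontier_sub[OF regular_D] .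

lemma g_bd: "arc_integrable g_bd"
  using bd_integrable_arc_integrable[OF frontier_D_sub lines_of_frontier_nonempty[OF regular_D measure_D_pos] g]
  by (simp add: g_bd_def[abs_def])

lemma flux_gap: "arc_integrable flux_gap"
  unfolding flux_gap_def[abs_def] by (intro arc_integrable_diff arc_integrable_bnormal(1) regular_D q_cont g_bd)

lemma flux_gap_outside: "x \<notin> frontier D \<Longrightarrow> flux_gap x = 0"
  by (simp add: flux_gap_def g_bd_def bnormal_outside)

lemma compact_frontier_D: "compact (frontier D)" using compact_D by (rule compact_frontier)

lemma arc_integrable_times_gap: "continuous_on UNIV f \<Longrightarrow> arc_integrable (\<lambda>x. f x * flux_gap x)"
  using arc_integrable_mult_continuous[OF flux_gap compact_frontier_D flux_gap_outside] .

lemma arc_integrable_times_g_bd: "continuous_on UNIV f \<Longrightarrow> arc_integrable (\<lambda>x. f x * g_bd x)"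
  using arc_integrable_mult_continuous[OF g_bd compact_frontier_D] by (simp add: g_bd_def)

lemma face_flux_eq:
  assumes m: "m < N" and vp: "(v, p) \<in> nbrs M c m"
  shows "face_flux m v p = arc_int (\<lambda>x. indicator (face M c m v p) x * inner (q x) (bnormal (S m) x))"
  unfolding face_flux_def bd_integral_eq_arc_int[OF face_sub_lines[OF m vp]]
proof (rule arc_int_cong(1))
  fix x assume x: "x \<notin> vertices"
  show "indicator (face M c m v p) x * inner (q x) (outward_normal (S m) x)
      = indicator (face M c m v p) x * inner (q x) (bnormal (S m) x)"
  proof (cases "x \<in> face M c m v p")
    case True
    then have "x \<in> frontier (S m)" using face_sub_frontier[OF m vp] by blast
    then show ?thesis using bnormal_generic[OF regular_S[OF m] x] by simp
  qed simp
qed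

text \<open>Seen from the other side, the normal of an interior face is reversed. This makes the flux vector,
which stores each interior face once, consistent with the signs of the adjacency matrix.\<close>

lemma face_flux_swap:
  assumes m: "m < N" and p: "p \<in> inner_nbrs m"
  shows "face_flux p c m = - face_flux m c p"
proof -
  have p': "(c, p) \<in> nbrs M c m" "p < N" "(c, m) \<in> nbrs M c p"
    using p inner_nbrs_sub(1)[OF p] inner_nbrs_sym[OF m p] by (simp_all add: inner_nbrs_iff)
  have f: "face M c p c m = face M c m c p" by (auto simp: face_def)
  show ?thesis
    unfolding face_flux_eq[OF m p'(1)] face_flux_eq[OF p'(2,3)] f arc_int_minus[symmetric]
  proof (rule arc_int_cong(1))
    fix x assume x: "x \<notin> vertices"
    show "indicator (face M c m c p) x * inner (q x) (bnormal (S p) x) =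
      - (indicator (face M c m c p) x * inner (q x) (bnormal (S m) x))"
      using interior_face(2)[OF m p'(1) x] by (cases "x \<in> face M c m c p") simp_all
  qed
qed

lemma face_g_eq:
  assumes m: "m < N" and vp: "(v, p) \<in> outer m"
  shows "face_g m v p = arc_int (\<lambda>x. indicator (face M c m v p) x * g_bd x)"
proof -
  have vp': "(v, p) \<in> nbrs M c m" "v \<noteq> c" using vp by (auto simp: outer_def)
  show ?thesis unfolding face_g_def bd_integral_eq_arc_int[OF face_sub_lines[OF m vp'(1)]]
  proof (rule arc_int_cong(1))
    fix x assume x: "x \<notin> vertices"
    show "indicator (face M c m v p) x * g x = indicator (face M c m v p) x * g_bd x"
      using boundary_face(1)[OF m vp' x] by (cases "x \<in> face M c m v p") (simp_all add: g_bd_def)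
  qed
qed

lemma subcell_flux:
  assumes m: "m < N"
  shows "arc_int (\<lambda>x. inner (q x) (bnormal (S m) x)) = (\<Sum>(v, p)\<in>nbrs M c m. face_flux m v p)"
proof -
  have int: "arc_integrable (\<lambda>x. inner (q x) (bnormal (S m) x))"
    by (rule arc_integrable_bnormal(1)[OF regular_S[OF m] q_cont])
  have "arc_int (\<lambda>x. inner (q x) (bnormal (S m) x)) =
      arc_int (\<lambda>x. \<Sum>vp\<in>nbrs M c m. indicator (face M c m (fst vp) (snd vp)) x * inner (q x) (bnormal (S m) x))"
  proof (rule arc_int_cong(1))
    fix x assume x: "x \<notin> vertices"
    have "inner (q x) (bnormal (S m) x) = indicator (frontier (S m)) x * inner (q x) (bnormal (S m) x)"
      by (cases "x \<in> frontier (S m)") (simp_all add: bnormal_outside)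
    then show "inner (q x) (bnormal (S m) x) =
        (\<Sum>vp\<in>nbrs M c m. indicator (face M c m (fst vp) (snd vp)) x * inner (q x) (bnormal (S m) x))"
      unfolding faces_partition_frontier[OF m x] by (simp add: sum_distrib_right case_prod_unfold)
  qed
  also have "\<dots> = (\<Sum>vp\<in>nbrs M c m. arc_int (\<lambda>x. indicator (face M c m (fst vp) (snd vp)) x * inner (q x) (bnormal (S m) x)))"
    using closed_face[OF m] by (intro arc_int_sum arc_integrable_indicator int) simp
  also have "\<dots> = (\<Sum>vp\<in>nbrs M c m. face_flux m (fst vp) (snd vp))"
    by (intro sum.cong refl) (simp add: face_flux_eq[OF m])
  finally show ?thesis by (simp add: case_prod_unfold)
qed

text \<open>On the boundary of \<open>D\<close> the boundary of \<open>S m\<close> consists of the outer faces of \<open>S m\<close>, where the normals of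
\<open>D\<close> and \<open>S m\<close> agree.\<close>

lemma flux_gap_on_subcell:
  assumes m: "m < N"
  shows "arc_int (\<lambda>x. indicator (frontier (S m)) x * flux_gap x) = (\<Sum>(v, p)\<in>outer m. face_flux m v p - face_g m v p)"
proof -
  have int: "arc_integrable (\<lambda>x. inner (q x) (bnormal (S m) x))"
    by (rule arc_integrable_bnormal(1)[OF regular_S[OF m] q_cont])
  have cl: "closed (face M c m (fst vp) (snd vp))" if "vp \<in> outer m" for vp
    using closed_face[OF m, of "fst vp" "snd vp"] that by (auto simp: outer_def)
  let ?f = "\<lambda>vp x. indicator (face M c m (fst vp) (snd vp)) x * inner (q x) (bnormal (S m) x)"
  let ?h = "\<lambda>vp x. indicator (face M c m (fst vp) (snd vp)) x * g_bd x"
  have f: "arc_integrable (?f vp)" and h: "arc_integrable (?h vp)" if "vp \<in> outer m" for vp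
    using cl[OF that] by (intro arc_integrable_indicator int g_bd; assumption)+
  have "arc_int (\<lambda>x. indicator (frontier (S m)) x * flux_gap x) = arc_int (\<lambda>x. \<Sum>vp\<in>outer m. ?f vp x - ?h vp x)"
  proof (rule arc_int_cong(1))
    fix x assume x: "x \<notin> vertices"
    have "indicator (frontier (S m)) x * flux_gap x = (indicator (frontier D) x * indicator (frontier (S m)) x) * flux_gap x"
      by (cases "x \<in> frontier D") (simp_all add: flux_gap_outside)
    also have "\<dots> = (\<Sum>vp\<in>outer m. indicator (face M c m (fst vp) (snd vp)) x * flux_gap x)"
      unfolding outer_faces_partition[OF m x] by (simp add: sum_distrib_right case_prod_unfold)
    also have "\<dots> = (\<Sum>vp\<in>outer m. ?f vp x - ?h vp x)"
    proof (rule sum.cong[OF refl])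
      fix vp assume "vp \<in> outer m"
      then have vp: "(fst vp, snd vp) \<in> nbrs M c m" "fst vp \<noteq> c" by (auto simp: outer_def)
      show "indicator (face M c m (fst vp) (snd vp)) x * flux_gap x = ?f vp x - ?h vp x"
        using boundary_face(2)[OF m vp x] by (cases "x \<in> face M c m (fst vp) (snd vp)") (simp_all add: flux_gap_def)
    qed
    finally show "indicator (frontier (S m)) x * flux_gap x = (\<Sum>vp\<in>outer m. ?f vp x - ?h vp x)" .
  qed
  also have "\<dots> = (\<Sum>vp\<in>outer m. arc_int (?f vp) - arc_int (?h vp))"
    using f h by (simp add: arc_int_sum arc_integrable_diff arc_int_diff)
  also have "\<dots> = (\<Sum>vp\<in>outer m. face_flux m (fst vp) (snd vp) - face_g m (fst vp) (snd vp))"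
  proof (rule sum.cong[OF refl])
    fix vp assume vp: "vp \<in> outer m"
    then have "(fst vp, snd vp) \<in> nbrs M c m" "(fst vp, snd vp) \<in> outer m" by (auto simp: outer_def)
    then show "arc_int (?f vp) - arc_int (?h vp) = face_flux m (fst vp) (snd vp) - face_g m (fst vp) (snd vp)"
      using face_flux_eq[OF m] face_g_eq[OF m] by simp
  qed
  finally show ?thesis by (simp add: case_prod_unfold)
qed

lemma \<phi>_cont: "m < N \<Longrightarrow> continuous_on A (\<phi> m)"
  using Pk_continuous[OF subres_basis(1)] .

text \<open>The correction splits into a part with the polynomial \<open>\<phi> m\<close> and a part that only sees the outer faces of
\<open>S m\<close>.\<close>

lemma bd_corr_eq_arc_int:
  assumes m: "m < N"
  shows "bd_corr m = arc_int (\<lambda>x. \<phi> m x * flux_gap x) - arc_int (\<lambda>x. indicator (frontier (S m)) x * flux_gap x)"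
proof -
  have int: "arc_integrable (\<lambda>x. \<phi> m x * flux_gap x)" "arc_integrable (\<lambda>x. indicator (frontier (S m)) x * flux_gap x)"
    by (intro arc_integrable_times_gap \<phi>_cont m arc_integrable_indicator flux_gap frontier_closed)+
  show ?thesis
    unfolding bd_corr_def bd_integral_eq_arc_int[OF frontier_D_sub] arc_int_diff[OF int, symmetric]
  proof (rule arc_int_cong(1))
    fix x assume x: "x \<notin> vertices"
    show "indicator (frontier D) x * (subres_basis_mod M c m x * (inner (q x) (outward_normal D x) - g x)) =
        \<phi> m x * flux_gap x - indicator (frontier (S m)) x * flux_gap x"
    proof (cases "x \<in> frontier D")
      case True
      then have "flux_gap x = inner (q x) (outward_normal D x) - g x"
        using bnormal_generic[OF regular_D x] by (simp add: flux_gap_def g_bd_def)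
      then show ?thesis using True by (simp add: subres_basis_mod_def left_diff_distrib)
    qed (simp add: flux_gap_outside)
  qed
qed

text \<open>The modified sub-resolution functions have sum \<open>1 - 1 = 0\<close> at almost every boundary point.\<close>

lemma sum_bd_corr: "(\<Sum>m<N. bd_corr m) = 0"
proof -
  have int: "arc_integrable (\<lambda>x. \<phi> m x * flux_gap x)" "arc_integrable (\<lambda>x. indicator (frontier (S m)) x * flux_gap x)" if "m < N" for m
    by (intro arc_integrable_times_gap \<phi>_cont that arc_integrable_indicator flux_gap frontier_closed)+
  have "(\<Sum>m<N. bd_corr m) = (\<Sum>m<N. arc_int (\<lambda>x. \<phi> m x * flux_gap x)) - (\<Sum>m<N. arc_int (\<lambda>x. indicator (frontier (S m)) x * flux_gap x))"
    by (simp add: bd_corr_eq_arc_int sum_subtractf)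
  also have "(\<Sum>m<N. arc_int (\<lambda>x. \<phi> m x * flux_gap x)) = arc_int (\<lambda>x. \<Sum>m<N. \<phi> m x * flux_gap x)"
    using int(1) by (intro arc_int_sum[symmetric]) simp
  also have "(\<lambda>x. \<Sum>m<N. \<phi> m x * flux_gap x) = flux_gap"
    by (simp add: sum_distrib_right[symmetric] sum_subres_basis)
  also have "(\<Sum>m<N. arc_int (\<lambda>x. indicator (frontier (S m)) x * flux_gap x)) = arc_int (\<lambda>x. \<Sum>m<N. indicator (frontier (S m)) x * flux_gap x)"
    using int(2) by (intro arc_int_sum[symmetric]) simp
  also have "\<dots> = arc_int flux_gap"
  proof (rule arc_int_cong(1))
    fix x assume x: "x \<notin> vertices"
    show "(\<Sum>m<N. indicator (frontier (S m)) x * flux_gap x) = flux_gap x"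
      using subcell_frontiers_partition[OF x] flux_gap_outside
      by (cases "x \<in> frontier D") (simp_all add: sum_distrib_right[symmetric])
  qed
  finally show ?thesis by simp
qed

text \<open>The difference of the two sides of the weak form with test function \<open>\<psi>\<close>, where \<open>w\<close> is the time
derivative of the solution and \<open>q\<close> replaces the physical flux.\<close>

definition residual :: "(point \<Rightarrow> real) \<Rightarrow> (point \<Rightarrow> real) \<Rightarrow> real" where
  "residual w \<psi> = (LINT x:D|lborel. w x * \<psi> x) - (LINT x:D|lborel. inner (q x) (grad \<psi> x))
     + arc_int (\<lambda>x. \<psi> x * g_bd x)"

lemma grad_cont: "\<psi> \<in> Pk k \<Longrightarrow> continuous_on A (grad \<psi>)"
  using Pk_vec_continuous[OF Pk_grad(1)] .

lemma residual_linear: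
  assumes w: "w \<in> Pk k" shows "linear_fnl (Pk k) (residual w)"
  unfolding linear_fnl_def
proof (intro conjI ballI allI)
  have lin: "linear_fnl (Pk k) (\<lambda>\<psi>. LINT x:D|lborel. w x * \<psi> x)" by (rule linear_fnl_L2[OF compact_D w])
  have int: "set_integrable lborel D (\<lambda>x. inner (q x) (grad \<psi> x))" if "\<psi> \<in> Pk k" for \<psi>
    by (intro set_integrable_continuous compact_D continuous_intros q_cont grad_cont that)
  {
    fix f h assume fh: "f \<in> Pk k" "h \<in> Pk k"
    have "(LINT x:D|lborel. inner (q x) (grad (\<lambda>x. f x + h x) x)) =
        (LINT x:D|lborel. inner (q x) (grad f x)) + (LINT x:D|lborel. inner (q x) (grad h x))"
      using int fh by (simp add: grad_add inner_add_right set_integral_add(2))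
    moreover have "arc_int (\<lambda>x. (f x + h x) * g_bd x) = arc_int (\<lambda>x. f x * g_bd x) + arc_int (\<lambda>x. h x * g_bd x)"
      using arc_int_add[OF arc_integrable_times_g_bd arc_integrable_times_g_bd] Pk_continuous fh
      by (simp add: distrib_right)
    ultimately show "residual w (\<lambda>x. f x + h x) = residual w f + residual w h"
      unfolding residual_def using linear_fnl_add[OF lin fh] by simp
  }
  fix a f assume f: "f \<in> Pk k"
  have "(LINT x:D|lborel. inner (q x) (grad (\<lambda>x. a * f x) x)) = a * (LINT x:D|lborel. inner (q x) (grad f x))"
    using f by (simp add: grad_cmult)
  moreover have "arc_int (\<lambda>x. a * f x * g_bd x) = a * arc_int (\<lambda>x. f x * g_bd x)"
    using arc_int_cmult[of a "\<lambda>x. f x * g_bd x"] by (simp add: mult.assoc)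
  ultimately show "residual w (\<lambda>x. a * f x) = a * residual w f"
    unfolding residual_def using linear_fnl_cmult[OF lin f, of a] by (simp add: algebra_simps)
qed

text \<open>The divergence theorem is applied to \<open>\<phi> m q\<close> on \<open>D\<close> and to \<open>q\<close> on \<open>S m\<close>. The volume terms cancel since
\<open>\<phi> m\<close> tested against \<open>div q\<close> is integration over \<open>S m\<close>. In the boundary terms the flux of \<open>q\<close> through
the outer faces of \<open>S m\<close> cancels against the part of \<open>flux_gap\<close> on these faces.\<close>

lemma residual_subres_basis:
  assumes w: "w \<in> Pk k" and m: "m < N"
  shows "residual w (\<phi> m) = (LINT x:S m|lborel. w x)
    + ((\<Sum>p\<in>inner_nbrs m. face_flux m c p) - bd_corr m + (\<Sum>(v, p)\<in>outer m. face_g m v p))"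
proof -
  have q12: "(\<lambda>x. fst (q x)) \<in> Pk (k + 1)" "(\<lambda>x. snd (q x)) \<in> Pk (k + 1)" using q by (auto simp: Pk_vec_def)
  obtain d1 where d1: "d1 \<in> Pk k" "\<And>x y. ((\<lambda>x. fst (q (x, y))) has_real_derivative d1 (x, y)) (at x)"
    using Pk_deriv_fst[OF q12(1)] by auto
  obtain d2 where d2: "d2 \<in> Pk k" "\<And>x y. ((\<lambda>y. snd (q (x, y))) has_real_derivative d2 (x, y)) (at y)"
    using Pk_deriv_snd[OF q12(2)] by auto
  have \<phi>: "\<phi> m \<in> Pk k" by (rule subres_basis(1)[OF m])
  have d12: "(\<lambda>x. d1 x + d2 x) \<in> Pk k" using d1 d2 by (intro Pk_add)
  have cont: "continuous_on A d1" "continuous_on A d2" "continuous_on A (\<phi> m)" "continuous_on A (grad (\<phi> m))" for A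
    using d1 d2 \<phi> Pk_continuous grad_cont by blast+
  have flux: "(LINT x:S m|lborel. d1 x + d2 x) = (\<Sum>(v, p)\<in>nbrs M c m. face_flux m v p)"
    unfolding subcell_flux[OF m, symmetric] set_lebesgue_integral_def real_scaleR_def
    using divergence_theorem[OF regular_S[OF m] d1(2) d2(2) q_cont cont(1,2)] .
  have div_D: "(LINT x:D|lborel. inner (q x) (grad (\<phi> m) x) + \<phi> m x * (d1 x + d2 x)) =
      arc_int (\<lambda>x. inner (\<phi> m x *\<^sub>R q x) (bnormal D x))"
  proof -
    have "(\<integral>z. indicator D z * ((fst (grad (\<phi> m) z) * fst (q z) + d1 z * \<phi> m z) + (snd (grad (\<phi> m) z) * snd (q z) + d2 z * \<phi> m z)) \<partial>lborel) =
        arc_int (\<lambda>x. inner (\<phi> m x *\<^sub>R q x) (bnormal D x))"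
    proof (rule divergence_theorem[OF regular_D])
      show "((\<lambda>x. fst (\<phi> m (x, y) *\<^sub>R q (x, y))) has_real_derivative
          fst (grad (\<phi> m) (x, y)) * fst (q (x, y)) + d1 (x, y) * \<phi> m (x, y)) (at x)" for x y
        using DERIV_mult[OF Pk_grad(2)[OF \<phi>] d1(2)] by simp
      show "((\<lambda>y. snd (\<phi> m (x, y) *\<^sub>R q (x, y))) has_real_derivative
          snd (grad (\<phi> m) (x, y)) * snd (q (x, y)) + d2 (x, y) * \<phi> m (x, y)) (at y)" for x y
        using DERIV_mult[OF Pk_grad(3)[OF \<phi>] d2(2)] by simp
    qed (intro continuous_intros cont q_cont)+
    moreover have "inner (q z) (grad (\<phi> m) z) + \<phi> m z * (d1 z + d2 z) =
        (fst (grad (\<phi> m) z) * fst (q z) + d1 z * \<phi> m z) + (snd (grad (\<phi> m) z) * snd (q z) + d2 z * \<phi> m z)" for z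
      by (simp add: inner_prod_def algebra_simps)
    ultimately show ?thesis unfolding set_lebesgue_integral_def real_scaleR_def by simp
  qed
  have "(LINT x:D|lborel. inner (q x) (grad (\<phi> m) x) + \<phi> m x * (d1 x + d2 x)) =
      (LINT x:D|lborel. inner (q x) (grad (\<phi> m) x)) + (LINT x:D|lborel. \<phi> m x * (d1 x + d2 x))"
    by (intro set_integral_add(2) set_integrable_continuous compact_D continuous_intros q_cont cont)
  then have green: "(LINT x:D|lborel. inner (q x) (grad (\<phi> m) x)) =
      arc_int (\<lambda>x. \<phi> m x * inner (q x) (bnormal D x)) - (LINT x:S m|lborel. d1 x + d2 x)"
    using div_D subres_basis(2)[OF m d12] by simp
  have int: "arc_integrable (\<lambda>x. \<phi> m x * inner (q x) (bnormal D x))" "arc_integrable (\<lambda>x. \<phi> m x * g_bd x)"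
    using arc_integrable_bnormal(1)[OF regular_D, of "\<lambda>x. \<phi> m x *\<^sub>R q x"] arc_integrable_times_g_bd
    by (auto intro!: continuous_intros cont q_cont)
  have "arc_int (\<lambda>x. \<phi> m x * flux_gap x) = arc_int (\<lambda>x. \<phi> m x * inner (q x) (bnormal D x)) - arc_int (\<lambda>x. \<phi> m x * g_bd x)"
    unfolding arc_int_diff[OF int, symmetric] by (simp add: flux_gap_def right_diff_distrib)
  then have "residual w (\<phi> m) = (LINT x:D|lborel. w x * \<phi> m x) + (LINT x:S m|lborel. d1 x + d2 x) - arc_int (\<lambda>x. \<phi> m x * flux_gap x)"
    unfolding residual_def green by simp
  moreover have "(LINT x:D|lborel. w x * \<phi> m x) = (LINT x:S m|lborel. w x)"
    using subres_basis(2)[OF m w] by (simp add: mult.commute)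
  moreover have "arc_int (\<lambda>x. \<phi> m x * flux_gap x) = bd_corr m + (\<Sum>(v, p)\<in>outer m. face_flux m v p) - (\<Sum>(v, p)\<in>outer m. face_g m v p)"
    using bd_corr_eq_arc_int[OF m] flux_gap_on_subcell[OF m] by (simp add: case_prod_unfold sum_subtractf)
  ultimately show ?thesis unfolding flux sum_nbrs_split by simp
qed

text \<open>The interior part of the sum is row \<open>m\<close> of \<open>A\<close> applied to the reconstructed fluxes. There the correction
vector itself appears, as \<open>L L\<^sup>-\<^sup>1 G = G\<close> for a vector \<open>G\<close> of total zero.\<close>

lemma recon_flux_sum:
  assumes conn: "subgrid_connected M c" and m: "m < N"
    and qF: "int_flux M F w c = q" and gN: "num_flux M NF w c = g"
  shows "(\<Sum>(v, p)\<in>nbrs M c m. face_sign M c m v p * recon_flux M F NF w c m v p) =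
    (\<Sum>p\<in>inner_nbrs m. face_flux m c p) - bd_corr m + (\<Sum>(v, p)\<in>outer m. face_g m v p)"
proof -
  let ?F = "int_flux_vec M F w c" and ?G = "bd_corr_vec M F NF w c"
  let ?E = "length (int_faces M c)"
  have G: "?G = vec N bd_corr" unfolding bd_corr_vec_def qF gN bd_corr_def[abs_def] ..
  have Gc: "?G \<in> carrier_vec N" "total ?G = 0"
    unfolding G using sum_bd_corr by (simp_all add: total_def)
  have Fc: "?F \<in> carrier_vec ?E" by (simp add: int_flux_vec_def)
  have F_index: "?F $ j = face_flux a c b / face_sign M c a c b" if "j < ?E" "int_faces M c ! j = (a, b)" for j a b
    using that by (simp add: int_flux_vec_def qF face_flux_def)
  have F_val: "face_sign M c m c p * ?F $ face_index M c m p = face_flux m c p" if p: "p \<in> inner_nbrs m" for p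
  proof (cases "m < p")
    case True
    then show ?thesis
      using F_index[OF face_index[OF m p]] face_sign_nonzero[of m c p] by (simp add: min_def max_def)
  next
    case False
    then have pm: "min m p = p" "max m p = m" by simp_all
    show ?thesis
      using F_index[OF face_index[OF m p], unfolded pm] face_sign_flip[OF m p] face_flux_swap[OF m p]
        face_sign_nonzero[of m c p] by simp
  qed
  have "(\<Sum>p\<in>inner_nbrs m. face_sign M c m c p * recon_flux M F NF w c m c p) = (Defs.adj_mat M c *\<^sub>v recon_flux_vec M F NF w c) $ m"
    using adj_mat_correction(1)[OF conn N_pos Fc Gc] unfolding recon_flux_vec_def[symmetric]
    by (simp add: adj_mat_mult[OF m] recon_flux_def)
  also have "\<dots> = (Defs.adj_mat M c *\<^sub>v ?F - ?G) $ m"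
    unfolding recon_flux_vec_def adj_mat_correction(2)[OF conn N_pos Fc Gc] ..
  also have "\<dots> = (\<Sum>p\<in>inner_nbrs m. face_sign M c m c p * ?F $ face_index M c m p) - bd_corr m"
    using m Gc(1) by (simp add: adj_mat_mult[OF m Fc, symmetric] G)
  also have "\<dots> = (\<Sum>p\<in>inner_nbrs m. face_flux m c p) - bd_corr m" by (simp add: F_val)
  finally have inner: "(\<Sum>p\<in>inner_nbrs m. face_sign M c m c p * recon_flux M F NF w c m c p) = (\<Sum>p\<in>inner_nbrs m. face_flux m c p) - bd_corr m" .
  have "(\<Sum>(v, p)\<in>outer m. face_sign M c m v p * recon_flux M F NF w c m v p) = (\<Sum>(v, p)\<in>outer m. face_g m v p)"
    by (intro sum.cong refl) (auto simp: outer_def recon_flux_def gN face_g_def face_sign_nonzero)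
  then show ?thesis unfolding sum_nbrs_split[of "\<lambda>v p. face_sign M c m v p * recon_flux M F NF w c m v p"] inner by simp
qed

end

section \<open>Equivalence of the two schemes\<close>

lemma (in mesh_lines) submean_sum:
  assumes m: "m < N" and f: "\<And>p. p < n \<Longrightarrow> continuous_on UNIV (f p)"
  shows "submean M c m (\<lambda>x. \<Sum>p<n. b p * f p x) = (\<Sum>p<n. b p * submean M c m (f p))"
proof -
  have int: "set_integrable lborel (S m) (f p)" if "p < n" for p
    by (intro set_integrable_continuous compact_S m continuous_on_subset[OF f[OF that]]) simp
  have "(LINT x:S m|lborel. \<Sum>p<n. b p * f p x) = (\<Sum>p<n. LINT x:S m|lborel. b p * f p x)"
    unfolding set_lebesgue_integral_def scaleR_sum_right
    using set_integrable_mult_right[OF int] unfolding set_integrable_def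
    by (intro Bochner_Integration.integral_sum) auto
  then show ?thesis by (simp add: submean_def sum_divide_distrib)
qed

lemma invertible_mat_mult_eq_0:
  assumes A: "A \<in> carrier_mat n n" "invertible_mat A" and v: "v \<in> carrier_vec n" "A *\<^sub>v v = 0\<^sub>v n"
  shows "v = (0\<^sub>v n :: real Matrix.vec)"
proof -
  obtain B where B: "inverts_mat A B" "inverts_mat B A" using A(2) unfolding invertible_mat_def by blast
  have "dim_col B = n" using arg_cong[OF B(1)[unfolded inverts_mat_def], of dim_col] A(1) by simp
  moreover have "dim_row B = n" using arg_cong[OF B(2)[unfolded inverts_mat_def], of dim_col] A(1) by simp
  ultimately have Bc: "B \<in> carrier_mat n n" by auto
  have "v = (B * A) *\<^sub>v v" using B(2) Bc v unfolding inverts_mat_def by simp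
  also have "\<dots> = B *\<^sub>v (A *\<^sub>v v)" using assoc_mult_mat_vec[OF Bc A(1) v(1)] .
  also have "\<dots> = 0\<^sub>v n" unfolding v(2) using Bc by (intro eq_vecI) (auto simp: scalar_prod_def intro!: sum.neutral)
  finally show ?thesis .
qed

text \<open>Let \<open>e\<close> represent \<open>l\<close>. Then \<open>l (\<phi> m)\<close> is the integral of \<open>e\<close> over \<open>S m\<close>, that is, up to the area of
\<open>S m\<close> the component \<open>m\<close> of the projection matrix applied to the coefficients of \<open>e\<close>.\<close>

lemma (in mesh_lines) residual_zero_iff:
  assumes basis: "is_basis_Pk k (\<sigma> c)" and adm: "invertible_mat (proj_mat M \<sigma> c)"
    and l: "linear_fnl (Pk k) l"
  shows "(\<forall>\<psi>\<in>Pk k. l \<psi> = 0) \<longleftrightarrow> (\<forall>m<N. l (\<phi> m) = 0)"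
proof
  assume *: "\<forall>m<N. l (\<phi> m) = 0"
  obtain e where e: "e \<in> Pk k" "\<And>\<psi>. \<psi> \<in> Pk k \<Longrightarrow> (LINT x:D|lborel. e x * \<psi> x) = l \<psi>"
    using riesz_Pk[OF compact_D D_interior l] by blast
  have \<sigma>: "\<sigma> c p \<in> Pk k" if "p < N" for p using basis that unfolding is_basis_Pk_def by blast
  obtain a where a: "\<And>x. e x = (\<Sum>p<N. a p * \<sigma> c p x)"
    using basis e(1) unfolding is_basis_Pk_def by blast
  have mean: "(\<Sum>p<N. proj_mat M \<sigma> c $$ (m, p) * a p) = 0" if m: "m < N" for m
  proof -
    have "0 = (LINT x:D|lborel. \<phi> m x * e x)"
      using * m e(2)[OF subres_basis(1)[OF m]] by (simp add: mult.commute)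
    also have "\<dots> = (LINT x:S m|lborel. e x)" by (rule subres_basis(2)[OF m e(1)])
    finally have "submean M c m e = 0" by (simp add: submean_def)
    moreover have "e = (\<lambda>x. \<Sum>p<N. a p * \<sigma> c p x)" using a by blast
    ultimately have "(\<Sum>p<N. a p * submean M c m (\<sigma> c p)) = 0"
      using submean_sum[OF m, of N "\<sigma> c" a] Pk_continuous[OF \<sigma>] by simp
    then show ?thesis using m by (simp add: proj_mat_def mult.commute)
  qed
  have "vec N a = 0\<^sub>v N"
  proof (rule invertible_mat_mult_eq_0[OF _ adm])
    show "proj_mat M \<sigma> c *\<^sub>v vec N a = 0\<^sub>v N"
    proof (rule eq_vecI)
      fix m assume "m < dim_vec (0\<^sub>v N :: real Matrix.vec)"
      then show "(proj_mat M \<sigma> c *\<^sub>v vec N a) $ m = 0\<^sub>v N $ m"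
        using mean[of m] by (simp add: proj_mat_def scalar_prod_def atLeast0LessThan)
    qed (simp add: proj_mat_def)
  qed (simp_all add: proj_mat_def)
  then have a0: "a p = 0" if "p < N" for p using that by (metis index_vec index_zero_vec(1))
  then have "e = (\<lambda>x. 0)" using a by (simp add: fun_eq_iff del: split_paired_All)
  then show "\<forall>\<psi>\<in>Pk k. l \<psi> = 0" using e(2) by (simp add: set_lebesgue_integral_def)
qed (use subres_basis(1) in blast)

theorem theorem2p2:
  fixes M :: "'c mesh" and c :: 'c
    and F :: "real \<Rightarrow> real \<times> real"
    and NF :: "real \<Rightarrow> real \<Rightarrow> real \<times> real \<Rightarrow> real"
    and \<sigma> :: "'c \<Rightarrow> nat \<Rightarrow> real \<times> real \<Rightarrow> real"
    and U :: "'c \<Rightarrow> nat \<Rightarrow> real \<Rightarrow> real"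
    and t :: real
  assumes mesh: "valid_mesh M" "c \<in> cells M" "faces_cover M c"
    and basis: "\<forall>v\<in>cells M. is_basis_Pk (deg M) (\<sigma> v)"
    and admissible: "invertible_mat (proj_mat M \<sigma> c)"
    and connected: "subgrid_connected M c"
    and diff: "\<forall>m<N_sub M. (U c m) differentiable (at t)"
    and flux_L2: "square_integrable_on (cell M c) (\<lambda>x. F (u_h M \<sigma> U t c x))"
    and numflux_int: "bd_integrable (frontier (cell M c)) (num_flux M NF (u_h M \<sigma> U t) c)"
  shows
    "(\<forall>\<psi>\<in>Pk (deg M).
        (LINT x:cell M c|lborel. deriv (\<lambda>s. u_h M \<sigma> U s c x) t * \<psi> x) =
        (LINT x:cell M c|lborel. inner (F (u_h M \<sigma> U t c x)) (grad \<psi> x))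
        - bd_integral (frontier (cell M c)) (\<lambda>x. \<psi> x * num_flux M NF (u_h M \<sigma> U t) c x))
     \<longleftrightarrow>
     (\<forall>m<N_sub M.
        ((\<lambda>s. submean M c m (u_h M \<sigma> U s c)) has_real_derivative
           - (1 / measure lborel (subcell M c m)) *
             (\<Sum>(v, p)\<in>nbrs M c m. face_sign M c m v p * recon_flux M F NF (u_h M \<sigma> U t) c m v p))
        (at t))"
proof -
  define \<S> where "\<S> = cell M ` cells M \<union> (\<Union>v\<in>cells M. subcell M v ` {..<N_sub M})"
  have "finite \<S>" "polygonal S" if "S \<in> \<S>" for S
    using mesh(1) that unfolding valid_mesh_def \<S>_def by auto
  moreover have "finite \<S>" using mesh(1) unfolding valid_mesh_def \<S>_def by auto
  ultimately obtain \<L> where L: "line_family \<L>" "\<forall>S\<in>\<S>. frontier S \<subseteq> \<Union>\<L>"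
    using polygonal_lines[of \<S>] by blast
  interpret mesh_lines \<L> M c
  proof (intro mesh_lines.intro mesh_lines_axioms.intro L(1) mesh)
    show "frontier (cell M v) \<subseteq> \<Union>\<L>" if "v \<in> cells M" for v using L(2) that unfolding \<S>_def by blast
    show "frontier (subcell M v p) \<subseteq> \<Union>\<L>" if "v \<in> cells M" "p < N_sub M" for v p
      using L(2) that unfolding \<S>_def by blast
  qed
  define q where "q = int_flux M F (u_h M \<sigma> U t) c"
  define g where "g = num_flux M NF (u_h M \<sigma> U t) c"
  note proj = L2_proj[OF compact_D D_interior flux_L2, where k = "k + 1"]
  have q_eq: "q = L2_proj (k + 1) D (\<lambda>x. F (u_h M \<sigma> U t c x))" by (simp add: q_def int_flux_def)
  interpret cell_fluxes \<L> M c q g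
    by unfold_locales (use proj(1) numflux_int in \<open>simp_all add: q_eq g_def\<close>)
  have basis_c: "is_basis_Pk k (\<sigma> c)" using basis mesh(2) by blast
  have \<sigma>: "\<sigma> c p \<in> Pk k" if "p < N" for p using basis_c that unfolding is_basis_Pk_def by blast
  define w where "w = (\<lambda>x. \<Sum>p<N. deriv (U c p) t * \<sigma> c p x)"
  have w: "w \<in> Pk k" unfolding w_def using \<sigma> by (intro Pk_sum Pk_cmult) auto
  have dU: "(U c p has_real_derivative deriv (U c p) t) (at t)" if "p < N" for p
    using diff that by (simp add: DERIV_deriv_iff_real_differentiable)
  have deriv_u: "deriv (\<lambda>s. u_h M \<sigma> U s c x) t = w x" for x
    unfolding u_h_def w_def using dU by (intro DERIV_imp_deriv DERIV_sum DERIV_cmult_right) auto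
  have weak: "((LINT x:D|lborel. deriv (\<lambda>s. u_h M \<sigma> U s c x) t * \<psi> x) =
        (LINT x:D|lborel. inner (F (u_h M \<sigma> U t c x)) (grad \<psi> x)) - bd_integral (frontier D) (\<lambda>x. \<psi> x * g x))
      \<longleftrightarrow> residual w \<psi> = 0" if \<psi>: "\<psi> \<in> Pk k" for \<psi>
  proof -
    have "grad \<psi> \<in> Pk_vec (k + 1)" using Pk_vec_mono[OF Pk_grad(1)[OF \<psi>]] by simp
    then have "(LINT x:D|lborel. inner (F (u_h M \<sigma> U t c x)) (grad \<psi> x)) = (LINT x:D|lborel. inner (q x) (grad \<psi> x))"
      using proj(2) unfolding q_eq by blast
    moreover have "bd_integral (frontier D) (\<lambda>x. \<psi> x * g x) = arc_int (\<lambda>x. \<psi> x * g_bd x)"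
      unfolding bd_integral_eq_arc_int[OF frontier_D_sub] by (simp add: g_bd_def mult.left_commute)
    ultimately show ?thesis unfolding residual_def deriv_u by auto
  qed
  have fv: "((\<lambda>s. submean M c m (u_h M \<sigma> U s c)) has_real_derivative - (1 / measure lborel (S m)) *
        (\<Sum>(v, p)\<in>nbrs M c m. face_sign M c m v p * recon_flux M F NF (u_h M \<sigma> U t) c m v p)) (at t)
      \<longleftrightarrow> residual w (\<phi> m) = 0" if m: "m < N" for m
  proof -
    have lin: "submean M c m (\<lambda>x. \<Sum>p<N. b p * \<sigma> c p x) = (\<Sum>p<N. b p * submean M c m (\<sigma> c p))" for b
      by (rule submean_sum[OF m Pk_continuous[OF \<sigma>]])
    have "((\<lambda>s. \<Sum>p<N. U c p s * submean M c m (\<sigma> c p)) has_real_derivative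
        (\<Sum>p<N. deriv (U c p) t * submean M c m (\<sigma> c p))) (at t)"
      using dU by (intro DERIV_sum DERIV_cmult_right) auto
    then have D: "((\<lambda>s. submean M c m (u_h M \<sigma> U s c)) has_real_derivative submean M c m w) (at t)"
      unfolding w_def u_h_def[abs_def] lin .
    let ?X = "\<Sum>(v, p)\<in>nbrs M c m. face_sign M c m v p * recon_flux M F NF (u_h M \<sigma> U t) c m v p"
    have res: "residual w (\<phi> m) = (LINT x:S m|lborel. w x) + ?X"
      unfolding residual_subres_basis[OF w m] recon_flux_sum[OF connected m q_def[symmetric] g_def[symmetric]] ..
    have "((\<lambda>s. submean M c m (u_h M \<sigma> U s c)) has_real_derivative - (1 / measure lborel (S m)) * ?X) (at t)
        \<longleftrightarrow> submean M c m w = - (1 / measure lborel (S m)) * ?X"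
      using D DERIV_unique by fastforce
    also have "\<dots> \<longleftrightarrow> residual w (\<phi> m) = 0"
      unfolding res submean_def using S_pos[OF m] by (auto simp: field_simps)
    finally show ?thesis .
  qed
  show ?thesis
    using residual_zero_iff[OF basis_c admissible residual_linear[OF w]] weak fv unfolding g_def by simp
qed

end
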